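(* Assume the spectral gap, removable singularity, quadratic degeneracy, $a$-regularity, $b$-regularity and unitary transfer conditions stated in the context. Then there is a constant $C_{10}\ge 0$, independent of $\varepsilon$, $\theta$ and $f$, such that (i) for all $\theta\in\Theta$, $0<\varepsilon<1$ and $f\in H^*$ one has $b_\theta[u_{\varepsilon,\theta}-(\mathcal E_\theta v+z)]\le C_{10}\varepsilon^2\|f\|_{*\theta}^2$, where $u_{\varepsilon,\theta}\in H$ solves $\varepsilon^{-2}a_\theta(u_{\varepsilon,\theta},\tilde u)+b_\theta(u_{\varepsilon,\theta},\tilde u)=\langle f,\tilde u\rangle$ for all $\tilde u\in H$, and $v+z\in V_\star\dot+Z$ solves $a^{\rm h}_{\theta/\varepsilon}(z,\tilde z)+b_0(v+z,\tilde v+\tilde z)=\langle f,\mathcal E_\theta\tilde v+\tilde z\rangle$ for all $\tilde v+\tilde z\in V_\star\dot+Z$; (ii) for all $\theta\in\Theta$ and $0<\varepsilon<1$, $$\big\|\mathcal L_{\varepsilon,\theta}^{-1}-\mathcal E_\theta\,\mathbb L_{\theta/\varepsilon}^{-1}\,\mathcal P^0_{\mathcal H_0}\,\mathcal E_\theta^{-1}\big\|_{(\mathcal H,d_\theta)\to(\mathcal H,d_\theta)}\le C_{11}\,\varepsilon,$$ $$C_{11}=C_{10}^{1/2}+\frac12K_e\nu_\star^{-1/2}\Big(1+\Big(\frac{1+K^2}{2(1-K_Z)}\Big)^{1/2}\Big),\qquad \nu_\star=\frac{\gamma(1-K_Z)}{3K^2}.$$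
   Context: $H$ is a separable complex Hilbert space, $n\ge 1$, $\Theta\subset\mathbb R^n$ is compact and connected with $0$ an interior point, and for each $\theta\in\Theta$, $a_\theta$ and $b_\theta$ are non-negative sesquilinear forms on $H\times H$. For a sesquilinear form $\mathfrak b$ write $\mathfrak b[u]:=\mathfrak b(u,u)$. Standing assumptions: for each $\theta$, $(u,\tilde u)_\theta:=a_\theta(u,\tilde u)+b_\theta(u,\tilde u)$ is an inner product on $H$ equivalent to the original one, with norm $\|\cdot\|_\theta$; there is $K>0$ with $\|u\|_{\theta_1}\le K\|u\|_{\theta_2}$ for all $u\in H$, $\theta_1,\theta_2\in\Theta$; there is $L_a>0$ with $|a_{\theta_1}(u,\tilde u)-a_{\theta_2}(u,\tilde u)|\le L_a|\theta_1-\theta_2|\,\|u\|_{\theta_1}\|\tilde u\|_{\theta_1}$ for all $u,\tilde u\in H$, $\theta_1,\theta_2\in\Theta$. $H^*$ is the space of antilinear continuous functionals on $H$, and $\|f\|_{*\theta}:=\sup_{u\ne0}|\langle f,u\rangle|/\|u\|_\theta$. $V_\theta:=\{v\in H: a_\theta[v]=0\}$ (a closed subspace), $W_\theta:=\{w\in H:(w,v)_\theta=0\ \forall v\in V_\theta\}$. Spectral gap condition: for every $\theta\in\Theta$ there is $\nu_\theta>0$ with $a_\theta[w]\ge\nu_\theta\|w\|_\theta^2$ for all $w\in W_\theta$. Removable singularity condition: there are a closed subspace $V_\star\subset H$ and $L_\star\ge0$ such that, with $V^\star_\theta:=V_\theta$ for $\theta\ne0$ and $V^\star_0:=V_\star$,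 one has $\inf_{v_2\in V^\star_{\theta_2}}\|v_1-v_2\|_{\theta_2}\le L_\star|\theta_1-\theta_2|\,\|v_1\|_{\theta_1}$ for all $v_1\in V^\star_{\theta_1}$, $\theta_1,\theta_2\in\Theta$. (Then $V_\star\subset V_0$.) $Z$ is a fixed closed subspace of $V_0$ with $V_0=V_\star\dot+Z$ (direct sum) and, for some $0\le K_Z<1$, $|(v_\star,z)_0|\le K_Z\|v_\star\|_0\|z\|_0$ for all $v_\star\in V_\star$, $z\in Z$. Quadratic degeneracy: there is $\gamma>0$ with $a_\theta[w]\ge\gamma|\theta|^2\|w\|_\theta^2$ for all $w\in W_\theta$, $\theta\in\Theta$. $a$-regularity: there exist sesquilinear maps $a_0':V_0\times H\to\mathbb C^n$, $a_0'':V_0\times V_0\to\mathbb C^{n\times n}$ and constants $K_{a'},K_{a''}\ge0$ with $|a_\theta(v,u)-a_0'(v,u)\cdot\theta|\le K_{a'}|\theta|^2\|v\|_0\|u\|_0$ for all $v\in V_0,u\in H,\theta\in\Theta$, and $|a_\theta(v,\tilde v)-a_0''(v,\tilde v)\theta\cdot\theta|\le K_{a''}|\theta|^3\|v\|_0\|\tilde v\|_0$ for all $v,\tilde v\in V_0$, $\theta\in\Theta$. $b$-regularity: there is $L_b\ge0$ with $|b_\theta(v,\tilde v)-b_0(v,\tilde v)|\le L_b|\theta|\,\|v\|_0\|\tilde v\|_\theta$ for all $v,\tilde v\in V_0$, $\theta\in\Theta$. Homogenised form: for $\theta\in\mathbb R^n$, $N_\theta:V_0\to W_0$ is the linear map such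 that $N_\theta v$ is the unique solution in $W_0$ of $a_0(N_\theta v,\tilde w_0)=-a_0'(v,\tilde w_0)\cdot\theta$ for all $\tilde w_0\in W_0$; and $a^{\rm h}_\theta(v,\tilde v):=a_0''(v,\tilde v)\theta\cdot\theta-a_0(N_\theta v,N_\theta\tilde v)$ for $v,\tilde v\in V_0$, $\theta\in\mathbb R^n$. Ambient space: $\mathcal H$ is a complex separable Hilbert space with a family of equivalent inner products $d_\theta$, $\theta\in\Theta$, such that $d_{\theta_1}[u]\le K_d\,d_{\theta_2}[u]$ for some $K_d>0$ and all $u,\theta_1,\theta_2$; $H$ is a compactly embedded dense subset of $\mathcal H$; and $d_\theta[u]\le b_\theta[u]$ for all $u\in H$, $\theta\in\Theta$. $\mathcal L_{\varepsilon,\theta}$ is the self-adjoint operator in $(\mathcal H,d_\theta)$ generated by the closed form $\varepsilon^{-2}a_\theta+b_\theta$ with form domain $H$. $\mathcal H_0$ is the closure of $V_\star\dot+Z$ in $\mathcal H$, equipped with $d_0$; $\mathcal P^0_{\mathcal H_0}$ is the $d_0$-orthogonal projection of $\mathcal H$ onto $\mathcal H_0$. For $\xi\in\mathbb R^n$, $\mathbb L_\xi$ is the self-adjoint operator in $\mathcal H_0$ generated by the form $\mathbb S_\xi(v+z,\tilde v+\tilde z):=a^{\rm h}_\xi(z,\tilde z)+b_0(v+z,\tilde v+\tilde z)$ with form domain $V_\star\dot+Z$. Unitary transfer condition: there are linear bijections $\mathcal E_\theta:V_\star\to V_\theta^\star$, $\theta\in\Theta$, with $b_\theta(\mathcal E_\theta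 v,\mathcal E_\theta\tilde v)=b_0(v,\tilde v)$ for all $v,\tilde v\in V_\star$ and $|b_\theta(\mathcal E_\theta v,z)-b_0(v,z)|\le K_b|\theta|\|v\|_0\|z\|_0$ for all $v\in V_\star,z\in Z$ ($K_b\ge0$ independent of $\theta$), which extend to bijections of $\mathcal H$ (again denoted $\mathcal E_\theta$) satisfying $d_\theta(\mathcal E_\theta u,\mathcal E_\theta\tilde u)=d_0(u,\tilde u)$ for all $u,\tilde u\in\mathcal H$, $\mathcal E_0=I$, and $\|\mathcal E_{\theta_1}-\mathcal E_{\theta_2}\|_{(\mathcal H,d_0)\to(\mathcal H,d_{\theta_1})}\le K_e|\theta_1-\theta_2|$ for all $\theta_1,\theta_2\in\Theta$ and some $K_e\ge0$. *)

theory Defs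
  imports "HOL-Analysis.Analysis"
begin

text \<open>The libraries have no complex inner product spaces. The class below adds to
  \<^class>\<open>real_inner\<close> (which supplies norm, distance and topology) a complex scalar
  multiplication extending the real one and a complex inner product whose real part is the
  real one. Inner products and sesquilinear forms are linear in the first argument and
  antilinear in the second.\<close>

class complex_inner = real_inner +
  fixes scaleC :: "complex \<Rightarrow> 'a \<Rightarrow> 'a"  (infixr \<open>*\<^sub>C\<close> 75)
    and cinner :: "'a \<Rightarrow> 'a \<Rightarrow> complex"
  assumes scaleC_add_right: "c *\<^sub>C (x + y) = c *\<^sub>C x + c *\<^sub>C y"
    and scaleC_add_left: "(c + e) *\<^sub>C x = c *\<^sub>C x + e *\<^sub>C x"
    and scaleC_scaleC: "c *\<^sub>C (e *\<^sub>C x) = (c * e) *\<^sub>C x"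
    and scaleR_scaleC: "r *\<^sub>R x = complex_of_real r *\<^sub>C x"
    and cinner_commute: "cinner x y = cnj (cinner y x)"
    and cinner_add_left: "cinner (x + y) w = cinner x w + cinner y w"
    and cinner_scaleC_left: "cinner (c *\<^sub>C x) y = c * cinner x y"
    and inner_eq_Re_cinner: "inner x y = Re (cinner x y)"

class complex_hilbert = complex_inner + complete_space

definition csubspace :: "'a::complex_inner set \<Rightarrow> bool" where
  "csubspace S \<longleftrightarrow> 0 \<in> S \<and> (\<forall>x\<in>S. \<forall>y\<in>S. x + y \<in> S) \<and> (\<forall>c. \<forall>x\<in>S. c *\<^sub>C x \<in> S)"

definition clinear_on :: "'a::complex_inner set \<Rightarrow> ('a \<Rightarrow> 'b::complex_inner) \<Rightarrow> bool" where
  "clinear_on S f \<longleftrightarrow> (\<forall>x\<in>S. \<forall>y\<in>S. f (x + y) = f x + f y) \<and>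
                      (\<forall>c. \<forall>x\<in>S. f (c *\<^sub>C x) = c *\<^sub>C f x)"

definition sesquilinear_on ::
    "'a::complex_inner set \<Rightarrow> 'a set \<Rightarrow> ('a \<Rightarrow> 'a \<Rightarrow> complex) \<Rightarrow> bool" where
  "sesquilinear_on S T s \<longleftrightarrow>
     (\<forall>u\<in>S. \<forall>u'\<in>S. \<forall>w\<in>T. s (u + u') w = s u w + s u' w) \<and>
     (\<forall>c. \<forall>u\<in>S. \<forall>w\<in>T. s (c *\<^sub>C u) w = c * s u w) \<and>
     (\<forall>u\<in>S. \<forall>w\<in>T. \<forall>w'\<in>T. s u (w + w') = s u w + s u w') \<and>
     (\<forall>c. \<forall>u\<in>S. \<forall>w\<in>T. s u (c *\<^sub>C w) = cnj c * s u w)"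

text \<open>The value \<open>s[u] = s(u,u)\<close>; only used for forms that are real on the diagonal.\<close>

definition diag :: "('a \<Rightarrow> 'a \<Rightarrow> complex) \<Rightarrow> 'a \<Rightarrow> real" where
  "diag s u = Re (s u u)"

definition nonneg_form :: "('a::complex_inner \<Rightarrow> 'a \<Rightarrow> complex) \<Rightarrow> bool" where
  "nonneg_form s \<longleftrightarrow>
     sesquilinear_on UNIV UNIV s \<and> (\<forall>u. s u u \<in> \<real> \<and> 0 \<le> diag s u)"

definition fnorm :: "('a \<Rightarrow> 'a \<Rightarrow> complex) \<Rightarrow> 'a \<Rightarrow> real" where
  "fnorm p u = sqrt (diag p u)"

definition equiv_inner_product :: "('a::complex_inner \<Rightarrow> 'a \<Rightarrow> complex) \<Rightarrow> bool" where
  "equiv_inner_product p \<longleftrightarrow>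
     sesquilinear_on UNIV UNIV p \<and> (\<forall>u w. p u w = cnj (p w u)) \<and>
     (\<forall>u. u \<noteq> 0 \<longrightarrow> 0 < diag p u) \<and>
     (\<exists>c>0. \<exists>C>0. \<forall>u. c * norm u \<le> fnorm p u \<and> fnorm p u \<le> C * norm u)"

definition antidual :: "('a::complex_inner \<Rightarrow> complex) set" where
  "antidual = {f. (\<forall>u w. f (u + w) = f u + f w) \<and> (\<forall>c u. f (c *\<^sub>C u) = cnj c * f u) \<and>
                  continuous_on UNIV f}"

text \<open>As for \<^const>\<open>onorm\<close>, the suprema below run over all vectors; \<open>u = 0\<close> contributes \<open>0 / 0 = 0\<close>.
  The operator norm takes values in \<^typ>\<open>ereal\<close>, so it is \<open>\<infinity>\<close> for unbounded maps.\<close>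

definition dual_norm :: "('a \<Rightarrow> 'a \<Rightarrow> complex) \<Rightarrow> ('a \<Rightarrow> complex) \<Rightarrow> real" where
  "dual_norm p f = (SUP u. cmod (f u) / fnorm p u)"

definition opnorm ::
    "('a \<Rightarrow> 'a \<Rightarrow> complex) \<Rightarrow> ('b \<Rightarrow> 'b \<Rightarrow> complex) \<Rightarrow> ('a \<Rightarrow> 'b) \<Rightarrow> ereal" where
  "opnorm p q T = (SUP u. ereal (fnorm q (T u) / fnorm p u))"

definition cdot :: "complex^'n \<Rightarrow> real^'n \<Rightarrow> complex" where
  "cdot x \<theta> = (\<Sum>i\<in>UNIV. x $ i * complex_of_real (\<theta> $ i))"

definition cquad :: "complex^'n^'n \<Rightarrow> real^'n \<Rightarrow> complex" where
  "cquad A \<theta> = cdot (A *v (\<chi> i. complex_of_real (\<theta> $ i))) \<theta>"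


type_synonym ('n, 'h) form_family = "real^'n \<Rightarrow> 'h \<Rightarrow> 'h \<Rightarrow> complex"

definition ip :: "('n::finite, 'h) form_family \<Rightarrow> ('n::finite, 'h) form_family \<Rightarrow> ('n::finite, 'h) form_family" where
  "ip a b \<theta> u w = a \<theta> u w + b \<theta> u w"

definition V_space :: "('n::finite, 'h) form_family \<Rightarrow> real^'n \<Rightarrow> 'h set" where
  "V_space a \<theta> = {v. a \<theta> v v = 0}"

definition W_space ::
    "('n::finite, 'h) form_family \<Rightarrow> ('n::finite, 'h) form_family \<Rightarrow> real^'n \<Rightarrow> 'h set" where
  "W_space a b \<theta> = {w. \<forall>v\<in>V_space a \<theta>. ip a b \<theta> w v = 0}"

definition V_reg :: "('n::finite, 'h) form_family \<Rightarrow> 'h set \<Rightarrow> real^'n \<Rightarrow> 'h set" where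
  "V_reg a Vs \<theta> = (if \<theta> = 0 then Vs else V_space a \<theta>)"

definition standing_assumptions ::
    "(real^'n) set \<Rightarrow> ('n::finite, 'h::complex_inner) form_family \<Rightarrow> ('n::finite, 'h) form_family \<Rightarrow>
     real \<Rightarrow> bool" where
  "standing_assumptions \<Theta> a b K \<longleftrightarrow>
     compact \<Theta> \<and> connected \<Theta> \<and> 0 \<in> interior \<Theta> \<and>
     (\<forall>\<theta>\<in>\<Theta>. nonneg_form (a \<theta>) \<and> nonneg_form (b \<theta>) \<and> equiv_inner_product (ip a b \<theta>)) \<and>
     K > 0 \<and>
     (\<forall>\<theta>1\<in>\<Theta>. \<forall>\<theta>2\<in>\<Theta>. \<forall>u. fnorm (ip a b \<theta>1) u \<le> K * fnorm (ip a b \<theta>2) u) \<and>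
     (\<exists>La>0. \<forall>\<theta>1\<in>\<Theta>. \<forall>\<theta>2\<in>\<Theta>. \<forall>u w.
        cmod (a \<theta>1 u w - a \<theta>2 u w) \<le>
          La * norm (\<theta>1 - \<theta>2) * fnorm (ip a b \<theta>1) u * fnorm (ip a b \<theta>1) w)"

definition spectral_gap ::
    "(real^'n) set \<Rightarrow> ('n::finite, 'h) form_family \<Rightarrow> ('n::finite, 'h) form_family \<Rightarrow> bool" where
  "spectral_gap \<Theta> a b \<longleftrightarrow>
     (\<forall>\<theta>\<in>\<Theta>. \<exists>\<nu>>0. \<forall>w\<in>W_space a b \<theta>. diag (a \<theta>) w \<ge> \<nu> * (fnorm (ip a b \<theta>) w)\<^sup>2)"

definition removable_singularity ::
    "(real^'n) set \<Rightarrow> ('n::finite, 'h::complex_inner) form_family \<Rightarrow> ('n::finite, 'h) form_family \<Rightarrow>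
     'h set \<Rightarrow> bool" where
  "removable_singularity \<Theta> a b Vs \<longleftrightarrow>
     csubspace Vs \<and> closed Vs \<and>
     (\<exists>Ls\<ge>0. \<forall>\<theta>1\<in>\<Theta>. \<forall>\<theta>2\<in>\<Theta>. \<forall>v1\<in>V_reg a Vs \<theta>1.
        (INF v2\<in>V_reg a Vs \<theta>2. fnorm (ip a b \<theta>2) (v1 - v2)) \<le>
          Ls * norm (\<theta>1 - \<theta>2) * fnorm (ip a b \<theta>1) v1)"

definition defect_complement ::
    "('n::finite, 'h::complex_inner) form_family \<Rightarrow> ('n::finite, 'h) form_family \<Rightarrow>
     'h set \<Rightarrow> 'h set \<Rightarrow> real \<Rightarrow> bool" where
  "defect_complement a b Vs Z KZ \<longleftrightarrow>
     csubspace Z \<and> closed Z \<and> Z \<subseteq> V_space a 0 \<and>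
     V_space a 0 = {v + z | v z. v \<in> Vs \<and> z \<in> Z} \<and> Vs \<inter> Z = {0} \<and>
     0 \<le> KZ \<and> KZ < 1 \<and>
     (\<forall>v\<in>Vs. \<forall>z\<in>Z. cmod (ip a b 0 v z) \<le> KZ * fnorm (ip a b 0) v * fnorm (ip a b 0) z)"

definition quadratic_degeneracy ::
    "(real^'n) set \<Rightarrow> ('n::finite, 'h) form_family \<Rightarrow> ('n::finite, 'h) form_family \<Rightarrow> real \<Rightarrow> bool" where
  "quadratic_degeneracy \<Theta> a b \<gamma> \<longleftrightarrow>
     \<gamma> > 0 \<and>
     (\<forall>\<theta>\<in>\<Theta>. \<forall>w\<in>W_space a b \<theta>.
        diag (a \<theta>) w \<ge> \<gamma> * (norm \<theta>)\<^sup>2 * (fnorm (ip a b \<theta>) w)\<^sup>2)"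

definition a_regularity ::
    "(real^'n) set \<Rightarrow> ('n::finite, 'h::complex_inner) form_family \<Rightarrow> ('n::finite, 'h) form_family \<Rightarrow>
     ('h \<Rightarrow> 'h \<Rightarrow> complex^'n) \<Rightarrow> ('h \<Rightarrow> 'h \<Rightarrow> complex^'n^'n) \<Rightarrow> bool" where
  "a_regularity \<Theta> a b a' a'' \<longleftrightarrow>
     (\<forall>i. sesquilinear_on (V_space a 0) UNIV (\<lambda>v u. a' v u $ i)) \<and>
     (\<forall>i j. sesquilinear_on (V_space a 0) (V_space a 0) (\<lambda>v w. a'' v w $ i $ j)) \<and>
     (\<exists>K'\<ge>0. \<forall>v\<in>V_space a 0. \<forall>u. \<forall>\<theta>\<in>\<Theta>.
        cmod (a \<theta> v u - cdot (a' v u) \<theta>) \<le>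
          K' * (norm \<theta>)\<^sup>2 * fnorm (ip a b 0) v * fnorm (ip a b 0) u) \<and>
     (\<exists>K''\<ge>0. \<forall>v\<in>V_space a 0. \<forall>w\<in>V_space a 0. \<forall>\<theta>\<in>\<Theta>.
        cmod (a \<theta> v w - cquad (a'' v w) \<theta>) \<le>
          K'' * norm \<theta> ^ 3 * fnorm (ip a b 0) v * fnorm (ip a b 0) w)"

definition b_regularity ::
    "(real^'n) set \<Rightarrow> ('n::finite, 'h) form_family \<Rightarrow> ('n::finite, 'h) form_family \<Rightarrow> bool" where
  "b_regularity \<Theta> a b \<longleftrightarrow>
     (\<exists>Lb\<ge>0. \<forall>v\<in>V_space a 0. \<forall>w\<in>V_space a 0. \<forall>\<theta>\<in>\<Theta>.
        cmod (b \<theta> v w - b 0 v w) \<le>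
          Lb * norm \<theta> * fnorm (ip a b 0) v * fnorm (ip a b \<theta>) w)"

definition N_map ::
    "('n::finite, 'h) form_family \<Rightarrow> ('n::finite, 'h) form_family \<Rightarrow> ('h \<Rightarrow> 'h \<Rightarrow> complex^'n) \<Rightarrow>
     real^'n \<Rightarrow> 'h \<Rightarrow> 'h" where
  "N_map a b a' \<theta> v =
     (THE w. w \<in> W_space a b 0 \<and> (\<forall>w'\<in>W_space a b 0. a 0 w w' = - cdot (a' v w') \<theta>))"

definition hom_form ::
    "('n::finite, 'h) form_family \<Rightarrow> ('n::finite, 'h) form_family \<Rightarrow> ('h \<Rightarrow> 'h \<Rightarrow> complex^'n) \<Rightarrow>
     ('h \<Rightarrow> 'h \<Rightarrow> complex^'n^'n) \<Rightarrow> ('n::finite, 'h) form_family" where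
  "hom_form a b a' a'' \<theta> v w =
     cquad (a'' v w) \<theta> - a 0 (N_map a b a' \<theta> v) (N_map a b a' \<theta> w)"

text \<open>The inclusion of \<open>H\<close> into the ambient space is the injection \<open>J\<close>.\<close>

definition ambient_space ::
    "(real^'n) set \<Rightarrow> ('n::finite, 'h::complex_hilbert) form_family \<Rightarrow>
     ('h \<Rightarrow> 'k::complex_hilbert) \<Rightarrow> ('n::finite, 'k) form_family \<Rightarrow> bool" where
  "ambient_space \<Theta> b J d \<longleftrightarrow>
     separable_space (euclidean :: 'k topology) \<and>
     clinear_on UNIV J \<and> inj J \<and> closure (range J) = UNIV \<and>
     compact (closure (J ` cball 0 1)) \<and>
     (\<forall>\<theta>\<in>\<Theta>. equiv_inner_product (d \<theta>)) \<and>
     (\<exists>Kd>0. \<forall>\<theta>1\<in>\<Theta>. \<forall>\<theta>2\<in>\<Theta>. \<forall>u. diag (d \<theta>1) u \<le> Kd * diag (d \<theta>2) u) \<and>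
     (\<forall>\<theta>\<in>\<Theta>. \<forall>u. diag (d \<theta>) (J u) \<le> diag (b \<theta>) u)"

text \<open>\<open>E \<theta>\<close> is the map on \<open>V\<^sub>\<star>\<close> and \<open>EE \<theta>\<close> its extension to the ambient space.\<close>

definition unitary_transfer ::
    "(real^'n) set \<Rightarrow> ('n::finite, 'h::complex_inner) form_family \<Rightarrow> ('n::finite, 'h) form_family \<Rightarrow>
     'h set \<Rightarrow> 'h set \<Rightarrow> ('h \<Rightarrow> 'k::complex_inner) \<Rightarrow> ('n::finite, 'k) form_family \<Rightarrow>
     (real^'n \<Rightarrow> 'h \<Rightarrow> 'h) \<Rightarrow> (real^'n \<Rightarrow> 'k \<Rightarrow> 'k) \<Rightarrow> real \<Rightarrow> bool" where
  "unitary_transfer \<Theta> a b Vs Z J d E EE Ke \<longleftrightarrow>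
     (\<forall>\<theta>\<in>\<Theta>. clinear_on Vs (E \<theta>) \<and> bij_betw (E \<theta>) Vs (V_reg a Vs \<theta>) \<and>
        (\<forall>v\<in>Vs. \<forall>w\<in>Vs. b \<theta> (E \<theta> v) (E \<theta> w) = b 0 v w)) \<and>
     (\<exists>Kb\<ge>0. \<forall>\<theta>\<in>\<Theta>. \<forall>v\<in>Vs. \<forall>z\<in>Z.
        cmod (b \<theta> (E \<theta> v) z - b 0 v z) \<le>
          Kb * norm \<theta> * fnorm (ip a b 0) v * fnorm (ip a b 0) z) \<and>
     (\<forall>\<theta>\<in>\<Theta>. bij (EE \<theta>) \<and> (\<forall>v\<in>Vs. EE \<theta> (J v) = J (E \<theta> v)) \<and>
        (\<forall>u w. d \<theta> (EE \<theta> u) (EE \<theta> w) = d 0 u w)) \<and>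
     EE 0 = id \<and>
     Ke \<ge> 0 \<and>
     (\<forall>\<theta>1\<in>\<Theta>. \<forall>\<theta>2\<in>\<Theta>.
        opnorm (d 0) (d \<theta>1) (\<lambda>u. EE \<theta>1 u - EE \<theta>2 u) \<le> ereal (Ke * norm (\<theta>1 - \<theta>2)))"


definition full_form ::
    "('n::finite, 'h) form_family \<Rightarrow> ('n::finite, 'h) form_family \<Rightarrow> real \<Rightarrow> ('n::finite, 'h) form_family" where
  "full_form a b \<epsilon> \<theta> u w = complex_of_real (1 / \<epsilon>\<^sup>2) * a \<theta> u w + b \<theta> u w"

text \<open>Elements \<open>v + z\<close> of the direct sum of \<open>V\<^sub>\<star>\<close> and \<open>Z\<close> are represented by the pairs \<open>(v, z)\<close>.\<close>

definition limit_form ::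
    "('n::finite, 'h::plus) form_family \<Rightarrow> ('n::finite, 'h) form_family \<Rightarrow> ('h \<Rightarrow> 'h \<Rightarrow> complex^'n) \<Rightarrow>
     ('h \<Rightarrow> 'h \<Rightarrow> complex^'n^'n) \<Rightarrow> real^'n \<Rightarrow> 'h \<times> 'h \<Rightarrow> 'h \<times> 'h \<Rightarrow> complex" where
  "limit_form a b a' a'' \<xi> p q =
     hom_form a b a' a'' \<xi> (snd p) (snd q) + b 0 (fst p + snd p) (fst q + snd q)"

definition solves_full ::
    "('n::finite, 'h) form_family \<Rightarrow> ('n::finite, 'h) form_family \<Rightarrow> real \<Rightarrow> real^'n \<Rightarrow> ('h \<Rightarrow> complex) \<Rightarrow>
     'h \<Rightarrow> bool" where
  "solves_full a b \<epsilon> \<theta> f u \<longleftrightarrow> (\<forall>w. full_form a b \<epsilon> \<theta> u w = f w)"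

definition solves_limit ::
    "('n::finite, 'h::complex_inner) form_family \<Rightarrow> ('n::finite, 'h) form_family \<Rightarrow>
     ('h \<Rightarrow> 'h \<Rightarrow> complex^'n) \<Rightarrow> ('h \<Rightarrow> 'h \<Rightarrow> complex^'n^'n) \<Rightarrow> 'h set \<Rightarrow> 'h set \<Rightarrow>
     (real^'n \<Rightarrow> 'h \<Rightarrow> 'h) \<Rightarrow> real \<Rightarrow> real^'n \<Rightarrow> ('h \<Rightarrow> complex) \<Rightarrow> 'h \<times> 'h \<Rightarrow> bool" where
  "solves_limit a b a' a'' Vs Z E \<epsilon> \<theta> f p \<longleftrightarrow>
     p \<in> Vs \<times> Z \<and>
     (\<forall>v\<in>Vs. \<forall>z\<in>Z.
        limit_form a b a' a'' ((1 / \<epsilon>) *\<^sub>R \<theta>) p (v, z) = f (E \<theta> v + z))"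

text \<open>Operators generated by forms are represented by their graphs. In the Hilbert space
  \<open>X\<close> (a closed subspace of the ambient type) with inner product \<open>p\<close>, the self-adjoint operator
  generated by the form \<open>s\<close> with form domain \<open>\<iota> ` D\<close>, where \<open>\<iota>\<close> is injective on \<open>D\<close>, maps \<open>\<iota> u\<close> to
  \<open>g\<close> iff \<open>s(u,w) = p(g, \<iota> w)\<close> for all \<open>w \<in> D\<close>.\<close>

definition form_operator ::
    "'k set \<Rightarrow> ('k \<Rightarrow> 'k \<Rightarrow> complex) \<Rightarrow> ('i \<Rightarrow> 'k) \<Rightarrow> 'i set \<Rightarrow> ('i \<Rightarrow> 'i \<Rightarrow> complex) \<Rightarrow>
     ('k \<times> 'k) set" where
  "form_operator X p \<iota> D s =
     {(\<iota> u, g) | u g. u \<in> D \<and> g \<in> X \<and> (\<forall>w\<in>D. s u w = p g (\<iota> w))}"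

definition op_inverse :: "('k \<times> 'k) set \<Rightarrow> 'k \<Rightarrow> 'k" where
  "op_inverse T f = (THE u. (u, f) \<in> T)"

definition orth_proj :: "('k::minus \<Rightarrow> 'k \<Rightarrow> complex) \<Rightarrow> 'k set \<Rightarrow> 'k \<Rightarrow> 'k" where
  "orth_proj p X u = (THE x. x \<in> X \<and> (\<forall>y\<in>X. p (u - x) y = 0))"

definition H0_space :: "'h::plus set \<Rightarrow> 'h set \<Rightarrow> ('h \<Rightarrow> 'k::topological_space) \<Rightarrow> 'k set" where
  "H0_space Vs Z J = closure (J ` {v + z | v z. v \<in> Vs \<and> z \<in> Z})"

definition L_op ::
    "('n::finite, 'h) form_family \<Rightarrow> ('n::finite, 'h) form_family \<Rightarrow> ('h \<Rightarrow> 'k) \<Rightarrow> ('n::finite, 'k) form_family \<Rightarrow>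
     real \<Rightarrow> real^'n \<Rightarrow> ('k \<times> 'k) set" where
  "L_op a b J d \<epsilon> \<theta> = form_operator UNIV (d \<theta>) J UNIV (full_form a b \<epsilon> \<theta>)"

definition LL_op ::
    "('n::finite, 'h::plus) form_family \<Rightarrow> ('n::finite, 'h) form_family \<Rightarrow> ('h \<Rightarrow> 'h \<Rightarrow> complex^'n) \<Rightarrow>
     ('h \<Rightarrow> 'h \<Rightarrow> complex^'n^'n) \<Rightarrow> 'h set \<Rightarrow> 'h set \<Rightarrow> ('h \<Rightarrow> 'k::topological_space) \<Rightarrow>
     ('n::finite, 'k) form_family \<Rightarrow> real^'n \<Rightarrow> ('k \<times> 'k) set" where
  "LL_op a b a' a'' Vs Z J d \<xi> =
     form_operator (H0_space Vs Z J) (d 0) (\<lambda>(v, z). J (v + z)) (Vs \<times> Z)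
       (limit_form a b a' a'' \<xi>)"

definition \<nu>_star :: "real \<Rightarrow> real \<Rightarrow> real \<Rightarrow> real" where
  "\<nu>_star K KZ \<gamma> = \<gamma> * (1 - KZ) / (3 * K\<^sup>2)"

end

theory Submission
  imports Defs
begin

text \<open>The limit solution \<open>(v, z)\<close> is turned into a trial vector \<open>U = E\<^sub>\<theta> v + z + N\<^sub>\<theta> z\<close> for the full
  problem. Its residual is tested against an arbitrary \<open>w\<close>, split as \<open>w = E\<^sub>\<theta> v' + z' + x\<close> with
  \<open>\<bar>\<theta>\<bar> \<parallel>z'\<parallel> + \<parallel>x\<parallel> \<le> C a\<^sub>\<theta>[w]\<^bsup>1/2\<^esup>\<close>, a quantity of order \<open>\<epsilon>\<close> in the energy norm of \<open>w\<close>. On the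
  other side, coercivity \<open>a\<^sup>h\<^sub>\<xi>[z] \<ge> c \<bar>\<xi>\<bar>\<^sup>2 \<parallel>z\<parallel>\<^sup>2\<close> gives \<open>\<bar>\<theta>\<bar> \<parallel>z\<parallel> \<le> C \<epsilon> \<parallel>f\<parallel>\<close> and even
  \<open>\<bar>\<theta>\<bar>\<^sup>2 \<parallel>z\<parallel> \<le> C \<epsilon>\<^sup>2 \<parallel>f\<parallel>\<close>, so that every term of the residual is \<open>O(\<epsilon>)\<close> uniformly in \<open>\<theta>\<close>.
  The operator estimate then compares the limit problems with right-hand sides transported by
  \<open>E\<^sub>\<theta>\<close> on all of the ambient space and on \<open>V\<^sub>\<star>\<close> only; these differ by \<open>O(\<bar>\<theta>\<bar> \<parallel>z'\<parallel>)\<close>, which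
  coercivity again absorbs.\<close>

text \<open>The obstacle is uniformity as \<theta> tends to 0. Quadratic degeneracy controls the
  \<open>W_space\<close> part of a vector by a_\<theta> only with the weight |\<theta>|, while the
  unweighted gap is given for each parameter separately. The remedy is to split that part a second
  time, at the parameter 0: the gap of a_0 survives small perturbations by Lipschitz continuity, and
  for the remaining \<theta> the degenerate bound is itself a gap. The weight |\<theta>| then stays
  on the \<open>Z\<close> component only. Coercivity of the homogenised form comes from a_\<theta>:
  the corrector \<open>N\<close> removes the first-order term, so the a_\<theta>-energy of the
  corrected z is the homogenised energy up to O(|\<theta>|^3), and a lower bound for small \<theta>
  extends to all \<xi> by homogeneity of degree two. The conditions on a_0' and a_0'' concern
  \<theta> in \<Theta>; a ball inside \<Theta> and homogeneity turn them into bounds for every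
  parameter.\<close>

lemma scaleC_of_real: "complex_of_real r *\<^sub>C x = r *\<^sub>R x"
  by (simp add: scaleR_scaleC)

lemma scaleC_minus_one: "(- 1) *\<^sub>C x = - (x :: 'a::complex_inner)"
  using scaleC_of_real[of "-1" x] by simp

lemma scaleC_scaleR: "c *\<^sub>C (r *\<^sub>R x) = r *\<^sub>R (c *\<^sub>C x)"
  by (simp add: scaleR_scaleC scaleC_scaleC mult.commute)

lemma norm_scaleC: "norm (c *\<^sub>C x) = cmod c * norm (x :: 'a::complex_inner)"
proof -
  have "inner (c *\<^sub>C x) (c *\<^sub>C x) = Re (c * cnj c * cinner x x)"
    by (metis cinner_commute cinner_scaleC_left complex_cnj_mult inner_eq_Re_cinner mult.assoc
        mult.left_commute)
  also have "\<dots> = (cmod c)\<^sup>2 * inner x x"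
    by (simp add: complex_mult_cnj cmod_power2 inner_eq_Re_cinner)
  finally show ?thesis
    by (simp add: norm_eq_sqrt_inner real_sqrt_mult)
qed

lemma bounded_linear_scaleC: "bounded_linear (\<lambda>x :: 'a::complex_inner. c *\<^sub>C x)"
  by (rule bounded_linear_intro[where K = "cmod c"])
    (simp_all add: scaleC_add_right scaleC_scaleR norm_scaleC mult.commute)

lemma csubspace_imp_subspace: "csubspace S \<Longrightarrow> subspace S"
  unfolding csubspace_def subspace_def scaleR_scaleC by blast

lemma csubspace_closure:
  assumes "csubspace S"
  shows "csubspace (closure S)"
proof -
  have add: "x + y \<in> closure S" if xy: "x \<in> closure S" "y \<in> closure S" for x y
  proof -
    obtain f g where "\<forall>n. f n \<in> S" "f \<longlonglongrightarrow> x" "\<forall>n. g n \<in> S" "g \<longlonglongrightarrow> y"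
      using xy unfolding closure_sequential by metis
    then have "\<And>n. f n + g n \<in> S" "(\<lambda>n. f n + g n) \<longlonglongrightarrow> x + y"
      using assms by (auto simp: csubspace_def intro: tendsto_add)
    then show ?thesis
      unfolding closure_sequential by (intro exI[of _ "\<lambda>n. f n + g n"]) simp
  qed
  have "c *\<^sub>C x \<in> closure S" if "x \<in> closure S" for c x
  proof -
    have "c *\<^sub>C x \<in> closure ((\<lambda>x. c *\<^sub>C x) ` S)"
      using closure_bounded_linear_image_subset[OF bounded_linear_scaleC] that by blast
    moreover have "(\<lambda>x. c *\<^sub>C x) ` S \<subseteq> S"
      using assms by (auto simp: csubspace_def)
    ultimately show ?thesis using closure_mono by blast
  qed
  then show ?thesis
    using add assms closure_subset[of S] by (auto simp: csubspace_def)
qed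

lemma csubspace_sum:
  assumes "csubspace S" "csubspace T"
  shows "csubspace {v + z | v z. v \<in> S \<and> z \<in> T}"
  unfolding csubspace_def
proof (intro conjI ballI allI)
  have "0 = (0 :: 'a) + 0" "0 \<in> S" "0 \<in> T"
    using assms by (simp_all add: csubspace_def)
  then show "0 \<in> {v + z |v z. v \<in> S \<and> z \<in> T}" by blast
next
  fix x y assume "x \<in> {v + z |v z. v \<in> S \<and> z \<in> T}" "y \<in> {v + z |v z. v \<in> S \<and> z \<in> T}"
  then obtain v z v' z' where "x = v + z" "y = v' + z'" "v \<in> S" "v' \<in> S" "z \<in> T" "z' \<in> T" by blast
  then have "x + y = (v + v') + (z + z')" "v + v' \<in> S" "z + z' \<in> T"
    using assms by (auto simp: csubspace_def algebra_simps)
  then show "x + y \<in> {v + z |v z. v \<in> S \<and> z \<in> T}" by blast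
next
  fix c x assume "x \<in> {v + z |v z. v \<in> S \<and> z \<in> T}"
  then obtain v z where "x = v + z" "v \<in> S" "z \<in> T" by blast
  then have "c *\<^sub>C x = c *\<^sub>C v + c *\<^sub>C z" "c *\<^sub>C v \<in> S" "c *\<^sub>C z \<in> T"
    using assms by (auto simp: csubspace_def scaleC_add_right)
  then show "c *\<^sub>C x \<in> {v + z |v z. v \<in> S \<and> z \<in> T}" by blast
qed

lemma sesquilinear_onD:
  assumes "sesquilinear_on S T s"
  shows "\<lbrakk>u \<in> S; u' \<in> S; w \<in> T\<rbrakk> \<Longrightarrow> s (u + u') w = s u w + s u' w"
    and "\<lbrakk>u \<in> S; w \<in> T\<rbrakk> \<Longrightarrow> s (c *\<^sub>C u) w = c * s u w"
    and "\<lbrakk>u \<in> S; w \<in> T; w' \<in> T\<rbrakk> \<Longrightarrow> s u (w + w') = s u w + s u w'"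
    and "\<lbrakk>u \<in> S; w \<in> T\<rbrakk> \<Longrightarrow> s u (c *\<^sub>C w) = cnj c * s u w"
  using assms unfolding sesquilinear_on_def by blast+

section \<open>Non-negative sesquilinear forms\<close>

context
  fixes s :: "'a::complex_inner \<Rightarrow> 'a \<Rightarrow> complex"
  assumes nf: "nonneg_form s"
begin

lemma nonneg_form_add_left: "s (u + u') w = s u w + s u' w"
  and nonneg_form_scaleC_left: "s (c *\<^sub>C u) w = c * s u w"
  and nonneg_form_add_right: "s u (w + w') = s u w + s u w'"
  and nonneg_form_scaleC_right: "s u (c *\<^sub>C w) = cnj c * s u w"
  using nf unfolding nonneg_form_def by (auto simp: sesquilinear_onD)

lemma nonneg_form_minus_left: "s (- u) w = - s u w"
  and nonneg_form_minus_right: "s u (- w) = - s u w"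
  using nonneg_form_scaleC_left[of "-1"] nonneg_form_scaleC_right[of _ "-1"]
  by (simp_all add: scaleC_minus_one)

lemma nonneg_form_diff_left: "s (u - u') w = s u w - s u' w"
  and nonneg_form_diff_right: "s u (w - w') = s u w - s u w'"
  by (simp_all only: diff_conv_add_uminus nonneg_form_add_left nonneg_form_minus_left
      nonneg_form_add_right nonneg_form_minus_right)

lemma nonneg_form_scaleR_left: "s (r *\<^sub>R u) w = r * s u w"
  and nonneg_form_scaleR_right: "s u (r *\<^sub>R w) = r * s u w"
  by (simp_all add: scaleR_scaleC nonneg_form_scaleC_left nonneg_form_scaleC_right)

lemma nonneg_form_zero_left: "s 0 w = 0"
  using nonneg_form_scaleR_left[of 0 0 w] by simp

lemma nonneg_form_diag_nonneg: "0 \<le> diag s u"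
  and nonneg_form_Im: "Im (s u u) = 0"
  using nf unfolding nonneg_form_def by (auto simp: complex_is_Real_iff)

lemma nonneg_form_diag_of_real: "s u u = complex_of_real (diag s u)"
  by (simp add: complex_eq_iff nonneg_form_Im diag_def)

text \<open>Polarisation: the diagonal being real at \<open>u + w\<close> makes the imaginary parts
  of \<open>s u w\<close> and \<open>s w u\<close> opposite, and its being real at
  \<open>u + \<i> *\<^sub>C w\<close> makes their real parts equal.\<close>

lemma nonneg_form_commute: "s u w = cnj (s w u)"
proof -
  have "Im (s (u + w) (u + w)) = 0" "Im (s (u + \<i> *\<^sub>C w) (u + \<i> *\<^sub>C w)) = 0"
    by (simp_all add: nonneg_form_Im)
  then show ?thesis
    by (simp add: nonneg_form_add_left nonneg_form_add_right nonneg_form_scaleC_left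
        nonneg_form_scaleC_right nonneg_form_Im complex_eq_iff)
qed

lemma fnorm_nonneg: "0 \<le> fnorm s u"
  by (simp add: fnorm_def nonneg_form_diag_nonneg)

lemma fnorm_square: "(fnorm s u)\<^sup>2 = diag s u"
  by (simp add: fnorm_def nonneg_form_diag_nonneg)

lemma nonneg_form_diag_eq: "s u u = complex_of_real ((fnorm s u)\<^sup>2)"
  by (simp only: fnorm_square nonneg_form_diag_of_real[symmetric])

lemma fnorm_scaleC: "fnorm s (c *\<^sub>C u) = cmod c * fnorm s u"
proof -
  have "s (c *\<^sub>C u) (c *\<^sub>C u) = c * cnj c * s u u"
    by (simp only: nonneg_form_scaleC_left nonneg_form_scaleC_right mult_ac)
  then have "diag s (c *\<^sub>C u) = Re (c * cnj c * s u u)"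
    by (simp only: diag_def)
  also have "\<dots> = (cmod c)\<^sup>2 * diag s u"
    by (subst nonneg_form_diag_of_real)
      (simp only: complex_norm_square[symmetric] of_real_mult[symmetric] Re_complex_of_real)
  finally show ?thesis
    by (simp add: fnorm_def real_sqrt_mult)
qed

lemma fnorm_minus: "fnorm s (- u) = fnorm s u"
  using fnorm_scaleC[of "-1" u] by (simp add: scaleC_minus_one)

lemma fnorm_zero: "fnorm s 0 = 0"
  by (simp add: fnorm_def diag_def nonneg_form_zero_left)

lemma nonneg_form_Cauchy_Schwarz: "cmod (s u w) \<le> fnorm s u * fnorm s w"
proof -
  define X where "X = s u w"
  have X': "s w u = cnj X"
    using nonneg_form_commute[of w u] by (simp add: X_def)
  \<comment> \<open>The factor \<open>X\<close> in the subtracted multiple turns the phase so that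
    the cross term is real; what remains is a real quadratic in \<open>t\<close>.\<close>
  have main: "0 \<le> diag s u - 2 * t * (cmod X)\<^sup>2 + t\<^sup>2 * (cmod X)\<^sup>2 * diag s w" for t
  proof -
    let ?c = "complex_of_real t * X"
    have "s (u - ?c *\<^sub>C w) (u - ?c *\<^sub>C w) =
        s u u - cnj ?c * X - ?c * cnj X + ?c * cnj ?c * s w w"
      by (simp add: nonneg_form_diff_left nonneg_form_diff_right nonneg_form_scaleC_left
          nonneg_form_scaleC_right X' algebra_simps flip: X_def)
    also have "\<dots> = complex_of_real
        (diag s u - 2 * t * (cmod X)\<^sup>2 + t\<^sup>2 * (cmod X)\<^sup>2 * diag s w)"
      by (subst (1 2) nonneg_form_diag_of_real)
        (simp add: complex_eq_iff cmod_power2, simp add: power2_eq_square algebra_simps)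
    finally show ?thesis
      using nonneg_form_diag_nonneg[of "u - ?c *\<^sub>C w"] by (simp add: diag_def)
  qed
  have "(cmod X)\<^sup>2 \<le> diag s u * diag s w"
  proof (cases "diag s w = 0")
    case True
    have "cmod X = 0"
    proof (rule ccontr)
      assume nz: "cmod X \<noteq> 0"
      \<comment> \<open>The form is only semidefinite, so \<open>diag s w\<close> may vanish. The
        quadratic is then affine in \<open>t\<close>, and this \<open>t\<close> makes it equal to
        \<open>- diag s u - 2\<close>.\<close>
      have "0 \<le> diag s u - 2 * ((diag s u + 1) / (cmod X)\<^sup>2) * (cmod X)\<^sup>2"
        using main[of "(diag s u + 1) / (cmod X)\<^sup>2"] True by simp
      then show False using nz nonneg_form_diag_nonneg[of u] by simp
    qed
    then show ?thesis using True by simp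
  next
    case False
    then have pos: "diag s w > 0"
      using nonneg_form_diag_nonneg[of w] by simp
    have "0 \<le> diag s u - (cmod X)\<^sup>2 / diag s w"
      using main[of "1 / diag s w"] pos by (simp add: power2_eq_square field_simps)
    then show ?thesis using pos by (simp add: field_simps)
  qed
  then have "cmod X \<le> sqrt (diag s u * diag s w)"
    by (rule real_le_rsqrt)
  then show ?thesis by (simp add: X_def fnorm_def real_sqrt_mult)
qed

lemma diag_add: "diag s (u + w) = diag s u + 2 * Re (s u w) + diag s w"
proof -
  have "Re (s w u) = Re (s u w)"
    using nonneg_form_commute[of w u] by simp
  then show ?thesis
    by (simp add: diag_def nonneg_form_add_left nonneg_form_add_right)
qed

lemma fnorm_triangle: "fnorm s (u + w) \<le> fnorm s u + fnorm s w"
proof -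
  have "diag s (u + w) \<le> (fnorm s u)\<^sup>2 + 2 * (fnorm s u * fnorm s w) + (fnorm s w)\<^sup>2"
    using complex_Re_le_cmod[of "s u w"] nonneg_form_Cauchy_Schwarz[of u w]
    by (simp add: diag_add fnorm_square)
  also have "\<dots> = (fnorm s u + fnorm s w)\<^sup>2"
    by (simp add: power2_sum)
  finally show ?thesis
    unfolding fnorm_def[of s "u + w"]
    by (intro real_le_lsqrt) (auto intro: add_nonneg_nonneg fnorm_nonneg)
qed

lemma fnorm_triangle_diff: "fnorm s (u - w) \<le> fnorm s u + fnorm s w"
  using fnorm_triangle[of u "- w"] by (simp add: fnorm_minus)

end

lemma equiv_inner_product_nonneg_form:
  assumes "equiv_inner_product p"
  shows "nonneg_form p"
proof -
  have "p u u \<in> \<real>" for u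
    using assms unfolding equiv_inner_product_def
    by (metis Reals_cnj_iff)
  moreover have "0 \<le> diag p u" for u
  proof (cases "u = 0")
    case True
    have "p (0 *\<^sub>C 0) 0 = 0"
      using assms unfolding equiv_inner_product_def sesquilinear_on_def by (metis UNIV_I mult_zero_left)
    moreover have "(0 :: complex) *\<^sub>C (0 :: 'a) = 0"
      using scaleC_of_real[of 0 "0 :: 'a"] by simp
    ultimately show ?thesis using True by (simp add: diag_def)
  next
    case False
    then show ?thesis
      using assms unfolding equiv_inner_product_def by (blast intro: less_imp_le)
  qed
  moreover have "sesquilinear_on UNIV UNIV p"
    using assms by (simp only: equiv_inner_product_def)
  ultimately show ?thesis
    unfolding nonneg_form_def by blast
qed

lemma equiv_inner_product_fnorm_eq_0: "equiv_inner_product p \<Longrightarrow> fnorm p u = 0 \<longleftrightarrow> u = 0"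
  using fnorm_zero[OF equiv_inner_product_nonneg_form, of p]
    fnorm_square[OF equiv_inner_product_nonneg_form, of p u]
  unfolding equiv_inner_product_def by (metis less_irrefl power_zero_numeral)

instance complex_hilbert \<subseteq> banach ..

section \<open>Representation of functionals by coercive Hermitian forms\<close>

text \<open>The map \<open>I\<close> plays the role of multiplication by \<open>\<i>\<close>; this covers closed complex
  subspaces as well as products of two of them, which carry no complex structure of their own.\<close>

lemma coercive_form_representation:
  fixes D :: "'a::banach set" and s :: "'a \<Rightarrow> 'a \<Rightarrow> complex" and f :: "'a \<Rightarrow> complex"
  assumes D: "subspace D" "closed D"
    and s_add: "\<And>u u' w. \<lbrakk>u \<in> D; u' \<in> D; w \<in> D\<rbrakk> \<Longrightarrow> s (u + u') w = s u w + s u' w"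
    and s_scale: "\<And>r u w. \<lbrakk>u \<in> D; w \<in> D\<rbrakk> \<Longrightarrow> s (r *\<^sub>R u) w = complex_of_real r * s u w"
    and s_commute: "\<And>u w. \<lbrakk>u \<in> D; w \<in> D\<rbrakk> \<Longrightarrow> s u w = cnj (s w u)"
    and s_bound: "\<And>u w. \<lbrakk>u \<in> D; w \<in> D\<rbrakk> \<Longrightarrow> cmod (s u w) \<le> C * norm u * norm w"
    and s_coercive: "\<And>u. u \<in> D \<Longrightarrow> c * (norm u)\<^sup>2 \<le> Re (s u u)" "c > 0"
    and f_add: "\<And>u w. \<lbrakk>u \<in> D; w \<in> D\<rbrakk> \<Longrightarrow> f (u + w) = f u + f w"
    and f_scale: "\<And>r u. u \<in> D \<Longrightarrow> f (r *\<^sub>R u) = complex_of_real r * f u"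
    and f_bound: "\<And>u. u \<in> D \<Longrightarrow> cmod (f u) \<le> F * norm u"
    and I: "\<And>u. u \<in> D \<Longrightarrow> I u \<in> D" "\<And>u w. \<lbrakk>u \<in> D; w \<in> D\<rbrakk> \<Longrightarrow> s u (I w) = - \<i> * s u w"
      "\<And>w. w \<in> D \<Longrightarrow> f (I w) = - \<i> * f w"
  shows "\<exists>u\<in>D. \<forall>w\<in>D. s u w = f w"
proof -
  define B where "B u w = Re (s u w)" for u w
  define l where "l w = Re (f w)" for w
  \<comment> \<open>Energy functional: a minimiser over \<open>D\<close> satisfies
    \<open>B u w = l w\<close>, the real part of the required equation. Minimising needs real
    values, so the complex equation is recovered only at the end.\<close>
  define q where "q u = B u u - 2 * l u" for u
  have D_add: "u + w \<in> D" and D_diff: "u - w \<in> D" if "u \<in> D" "w \<in> D" for u w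
    using D that by (auto simp: subspace_add subspace_diff)
  have D_scale: "r *\<^sub>R u \<in> D" if "u \<in> D" for u r
    using D that by (simp add: subspace_scale)
  have B_commute: "B u w = B w u" if "u \<in> D" "w \<in> D" for u w
    using s_commute[OF that] by (simp add: B_def)
  have B_add: "B (u + u') w = B u w + B u' w" if "u \<in> D" "u' \<in> D" "w \<in> D" for u u' w
    using s_add[OF that] by (simp add: B_def)
  have B_scale: "B (r *\<^sub>R u) w = r * B u w" if "u \<in> D" "w \<in> D" for r u w
    using s_scale[OF that] by (simp add: B_def)
  have B_add': "B w (u + u') = B w u + B w u'" if "u \<in> D" "u' \<in> D" "w \<in> D" for u u' w
    using that B_add B_commute D_add by metis
  have B_scale': "B u (r *\<^sub>R w) = r * B u w" if "u \<in> D" "w \<in> D" for r u w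
    using that B_scale B_commute D_scale by metis
  have B_bound: "\<bar>B u w\<bar> \<le> C * norm u * norm w" if "u \<in> D" "w \<in> D" for u w
    using s_bound[OF that] abs_Re_le_cmod[of "s u w"] by (simp add: B_def)
  have l_bound: "\<bar>l u\<bar> \<le> F * norm u" if "u \<in> D" for u
    using f_bound[OF that] abs_Re_le_cmod[of "f u"] by (simp add: l_def)
  have l_add: "l (u + w) = l u + l w" if "u \<in> D" "w \<in> D" for u w
    using f_add[OF that] by (simp add: l_def)
  have l_scale: "l (r *\<^sub>R u) = r * l u" if "u \<in> D" for r u
    using f_scale[OF that] by (simp add: l_def)
  have q_step: "q (u + t *\<^sub>R w) = q u + 2 * t * (B u w - l w) + t\<^sup>2 * B w w"
    if "u \<in> D" "w \<in> D" for u w t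
  proof -
    have "B (u + t *\<^sub>R w) (u + t *\<^sub>R w) = B u u + t * B u w + t * B w u + t * t * B w w"
      using that by (simp add: B_add B_add' B_scale B_scale' D_add D_scale algebra_simps)
    then show ?thesis
      using that B_commute[of w u]
      by (simp add: q_def l_add l_scale D_scale power2_eq_square algebra_simps)
  qed
  have q_below: "q u \<ge> - F\<^sup>2 / c" if "u \<in> D" for u
  proof -
    have "q u \<ge> c * (norm u)\<^sup>2 - 2 * (F * norm u)"
      using s_coercive(1)[OF that] l_bound[OF that] by (simp add: q_def B_def)
    also have "c * (norm u)\<^sup>2 - 2 * (F * norm u) = (c * norm u - F)\<^sup>2 / c - F\<^sup>2 / c"
      using \<open>c > 0\<close> by (simp add: power2_eq_square field_simps)
    also have "\<dots> \<ge> - F\<^sup>2 / c"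
      using \<open>c > 0\<close> by simp
    finally show ?thesis by simp
  qed
  have D0: "0 \<in> D" using D by (simp add: subspace_0)
  define m where "m = (INF u\<in>D. q u)"
  have bdd: "bdd_below (q ` D)"
    using q_below by (intro bdd_belowI2[where m = "- F\<^sup>2 / c"])
  have m_le: "m \<le> q u" if "u \<in> D" for u
    unfolding m_def using bdd that by (rule cINF_lower)
  have "\<exists>u\<in>D. q u < m + inverse (real (Suc n))" for n
  proof -
    have "\<exists>y\<in>q ` D. y < m + inverse (real (Suc n))"
    proof (subst cInf_less_iff[symmetric])
      show "Inf (q ` D) < m + inverse (real (Suc n))" unfolding m_def by simp
    qed (use bdd D0 in auto)
    then show ?thesis by auto
  qed
  then obtain x where xD: "\<And>n. x n \<in> D" and xq: "\<And>n. q (x n) < m + inverse (real (Suc n))"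
    by metis
  text \<open>The parallelogram identity makes every minimising sequence Cauchy.\<close>
  have par: "c * (norm (u - w))\<^sup>2 \<le> 2 * (q u - m) + 2 * (q w - m)" if "u \<in> D" "w \<in> D" for u w
  proof -
    define y where "y = w - u"
    have y: "y \<in> D" "w = u + 1 *\<^sub>R y" using that D_diff by (auto simp: y_def)
    have "m \<le> q (u + (1/2) *\<^sub>R y)"
      using m_le D_add D_scale that(1) y(1) by blast
    then have "m \<le> q u + (B u y - l y) + B y y / 4"
      unfolding q_step[OF that(1) y(1)] by (simp add: power2_eq_square)
    moreover have "q w = q u + 2 * (B u y - l y) + B y y"
      unfolding y(2) using q_step[OF that(1) y(1), of 1] by simp
    moreover have "c * (norm (u - w))\<^sup>2 \<le> B y y"
      using s_coercive(1)[OF y(1)] by (simp add: B_def y_def norm_minus_commute)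
    ultimately show ?thesis by simp
  qed
  have "Cauchy x"
  proof (rule metric_CauchyI)
    fix e :: real assume "e > 0"
    have "(\<lambda>n. inverse (real (Suc n))) \<longlonglongrightarrow> 0" by (rule LIMSEQ_inverse_real_of_nat)
    moreover have "c * e\<^sup>2 / 4 > 0" using \<open>c > 0\<close> \<open>e > 0\<close> by simp
    ultimately have "\<forall>\<^sub>F n in sequentially. inverse (real (Suc n)) < c * e\<^sup>2 / 4"
      by (rule order_tendstoD(2))
    then obtain N where N: "\<And>n. n \<ge> N \<Longrightarrow> inverse (real (Suc n)) < c * e\<^sup>2 / 4"
      unfolding eventually_sequentially by blast
    have "dist (x i) (x j) < e" if "i \<ge> N" "j \<ge> N" for i j
    proof -
      have "c * (norm (x i - x j))\<^sup>2 < c * e\<^sup>2"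
        using par[OF xD xD, of i j] xq[of i] xq[of j] N[OF that(1)] N[OF that(2)] by simp
      then have "(norm (x i - x j))\<^sup>2 < e\<^sup>2" using \<open>c > 0\<close> by simp
      then show ?thesis using \<open>e > 0\<close> by (simp add: dist_norm power2_less_imp_less)
    qed
    then show "\<exists>M. \<forall>i\<ge>M. \<forall>j\<ge>M. dist (x i) (x j) < e" by blast
  qed
  then obtain u where u: "x \<longlonglongrightarrow> u" using convergent_eq_Cauchy[of x] by auto
  then have uD: "u \<in> D" using D(2) xD closed_sequentially by blast
  have "B u w = l w" if wD: "w \<in> D" for w
  proof -
    text \<open>Every \<open>x n + t w\<close> competes with the infimum.\<close>
    have lower: "0 \<le> 2 * t * (B u w - l w) + t\<^sup>2 * B w w" for t
    proof -
      have "(\<lambda>n. B (x n) w) \<longlonglongrightarrow> B u w"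
      proof (rule Lim_null[THEN iffD2], rule Lim_null_comparison)
        show "\<forall>\<^sub>F n in sequentially. norm (B (x n) w - B u w) \<le> C * norm (x n - u) * norm w"
        proof (rule always_eventually, rule allI)
          fix n
          note xu = D_diff[OF xD[of n] uD]
          have "B ((x n - u) + u) w = B (x n - u) w + B u w"
            by (rule B_add[OF xu uD wD])
          then show "norm (B (x n) w - B u w) \<le> C * norm (x n - u) * norm w"
            using B_bound[OF xu wD] by simp
        qed
        have "(\<lambda>n. C * norm (x n - u) * norm w) \<longlonglongrightarrow> C * norm (u - u) * norm w"
          by (intro tendsto_intros u)
        then show "(\<lambda>n. C * norm (x n - u) * norm w) \<longlonglongrightarrow> 0" by simp
      qed
      then have "(\<lambda>n. inverse (real (Suc n)) + 2 * t * (B (x n) w - l w) + t\<^sup>2 * B w w)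
          \<longlonglongrightarrow> 0 + 2 * t * (B u w - l w) + t\<^sup>2 * B w w"
        by (intro tendsto_intros LIMSEQ_inverse_real_of_nat)
      moreover have "0 \<le> inverse (real (Suc n)) + 2 * t * (B (x n) w - l w) + t\<^sup>2 * B w w" for n
        using m_le[OF D_add[OF xD D_scale[OF wD]], of n t] xq[of n] q_step[OF xD wD, of n t]
        by linarith
      ultimately have "0 \<le> 0 + 2 * t * (B u w - l w) + t\<^sup>2 * B w w"
        by (intro LIMSEQ_le_const) blast+
      then show ?thesis by simp
    qed
    \<comment> \<open>A quadratic in \<open>t\<close> that is non-negative for all \<open>t\<close>
      and vanishes at 0 has no linear term. The choice t = - X / b exhibits this; the summand 1 in
      \<open>b\<close> keeps the denominator positive.\<close>
    define X where "X = B u w - l w"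
    define b where "b = \<bar>B w w\<bar> + 1"
    have "b > 0" by (simp add: b_def)
    have "(- (X / b))\<^sup>2 * B w w \<le> (- (X / b))\<^sup>2 * b"
      by (intro mult_left_mono) (auto simp: b_def)
    then have "0 \<le> 2 * (- (X / b)) * X + (- (X / b))\<^sup>2 * b"
      using lower[of "- (X / b)"] unfolding X_def by linarith
    also have "\<dots> = - X\<^sup>2 / b" using \<open>b > 0\<close> by (simp add: power2_eq_square field_simps)
    finally have "X\<^sup>2 \<le> 0" using \<open>b > 0\<close> by (simp add: field_simps)
    then show ?thesis by (simp add: X_def)
  qed
  then have Re_eq: "Re (s u w) = Re (f w)" if "w \<in> D" for w
    using that by (simp add: B_def l_def)
  \<comment> \<open>Testing with \<open>I w\<close> multiplies both sides by - \<i>, so the real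
    part of that equation is the imaginary part of the equation for \<open>w\<close>.\<close>
  have "s u w = f w" if "w \<in> D" for w
    using Re_eq[OF that] Re_eq[OF I(1)[OF that]] I(2)[OF uD that] I(3)[OF that]
    by (simp add: complex_eq_iff)
  then show ?thesis using uD by blast
qed

text \<open>Closedness and completeness refer to the original norm, orthogonality to
  \<open>p\<close>. The projection is therefore found as the representative in \<open>S\<close> of
  the functional \<open>p u\<close>, with the constants of the norm equivalence as bound and
  coercivity constant.\<close>

lemma orthogonal_decomposition:
  fixes p :: "'a::complex_hilbert \<Rightarrow> 'a \<Rightarrow> complex"
  assumes p: "equiv_inner_product p" and S: "csubspace S" "closed S"
  shows "\<exists>x\<in>S. \<forall>y\<in>S. p (u - x) y = 0"
proof -
  note nf = equiv_inner_product_nonneg_form[OF p]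
  obtain c C where c: "c > 0" "\<And>u. c * norm u \<le> fnorm p u" and C: "C > 0" "\<And>u. fnorm p u \<le> C * norm u"
    using p unfolding equiv_inner_product_def by blast
  have bound: "cmod (p u w) \<le> C\<^sup>2 * norm u * norm w" for u w
  proof -
    have "cmod (p u w) \<le> (C * norm u) * (C * norm w)"
      using nonneg_form_Cauchy_Schwarz[OF nf, of u w] C
        mult_mono[OF C(2)[of u] C(2)[of w]] fnorm_nonneg[OF nf] by fastforce
    then show ?thesis by (simp add: power2_eq_square mult_ac)
  qed
  have "\<exists>x\<in>S. \<forall>w\<in>S. p x w = p u w"
  proof (rule coercive_form_representation[where I = "\<lambda>w. \<i> *\<^sub>C w" and C = "C\<^sup>2" and c = "c\<^sup>2"
        and F = "C\<^sup>2 * norm u"])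
    show "c\<^sup>2 * (norm u)\<^sup>2 \<le> Re (p u u)" for u
      using power_mono[OF c(2)[of u], of 2] \<open>c > 0\<close> fnorm_square[OF nf, of u]
      by (simp add: power_mult_distrib diag_def)
    show "p u w = cnj (p w u)" for u w by (rule nonneg_form_commute[OF nf])
    show "subspace S" using S csubspace_imp_subspace by blast
  qed (use S bound \<open>c > 0\<close> in \<open>auto simp: csubspace_def nonneg_form_add_left[OF nf]
      nonneg_form_add_right[OF nf] nonneg_form_scaleR_left[OF nf] nonneg_form_scaleR_right[OF nf]
      nonneg_form_scaleC_right[OF nf]\<close>)
  then show ?thesis by (metis nonneg_form_diff_left[OF nf] right_minus_eq)
qed

section \<open>Bounds for antilinear functionals and for forms\<close>

lemma antidual_bounded:
  fixes f :: "'h::complex_inner \<Rightarrow> complex"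
  assumes "f \<in> antidual"
  shows "\<exists>M\<ge>0. \<forall>u. cmod (f u) \<le> M * norm u"
proof -
  have add: "f (u + w) = f u + f w" and sc: "f (c *\<^sub>C u) = cnj c * f u" for u w c
    using assms by (auto simp: antidual_def)
  have scR: "f (r *\<^sub>R u) = r * f u" for r u
    using sc[of "complex_of_real r" u] by (simp add: scaleR_scaleC)
  have f0: "f 0 = 0" using scR[of 0 0] by simp
  have "isCont f 0"
    using assms by (simp add: antidual_def continuous_on_eq_continuous_at)
  then obtain \<delta> where "\<delta> > 0" and \<delta>: "\<And>x. norm x < \<delta> \<Longrightarrow> cmod (f x) < 1"
    unfolding continuous_at_eps_delta by (metis dist_0_norm dist_commute f0 zero_less_one)
  have "cmod (f u) \<le> 2 / \<delta> * norm u" for u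
  proof (cases "u = 0")
    case False
    define r where "r = \<delta> / (2 * norm u)"
    have r: "r > 0" using False \<open>\<delta> > 0\<close> by (simp add: r_def)
    have "norm (r *\<^sub>R u) < \<delta>" using False \<open>\<delta> > 0\<close> by (simp add: r_def)
    then have "r * cmod (f u) < 1" using \<delta>[of "r *\<^sub>R u"] r by (simp add: scR norm_mult)
    then show ?thesis using False \<open>\<delta> > 0\<close> by (simp add: r_def field_simps)
  qed (simp add: f0)
  then show ?thesis using \<open>\<delta> > 0\<close> by (intro exI[of _ "2 / \<delta>"]) auto
qed

text \<open>A real supremum yields estimates only if its set is bounded above. Continuity of
  \<open>f\<close> bounds the quotients in the original norm, and the equivalence of
  \<open>p\<close> with it carries the bound over.\<close>

lemma dual_norm_bound:
  fixes f :: "'h::complex_inner \<Rightarrow> complex"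
  assumes "f \<in> antidual" and p: "equiv_inner_product p"
  shows "cmod (f u) \<le> dual_norm p f * fnorm p u" "0 \<le> dual_norm p f"
proof -
  note nf = equiv_inner_product_nonneg_form[OF p]
  obtain M where M: "M \<ge> 0" "\<And>u. cmod (f u) \<le> M * norm u"
    using antidual_bounded[OF assms(1)] by blast
  obtain c where c: "c > 0" "\<And>u. c * norm u \<le> fnorm p u"
    using p unfolding equiv_inner_product_def by blast
  have ratio: "cmod (f u) / fnorm p u \<le> M / c" for u
  proof (cases "u = 0")
    case True
    then show ?thesis using M(1) c(1) fnorm_zero[OF nf] by simp
  next
    case False
    have "cmod (f u) \<le> M * (fnorm p u / c)"
    proof (rule order_trans[OF M(2) mult_left_mono[OF _ M(1)]])
      show "norm u \<le> fnorm p u / c" using c(1) c(2)[of u] by (simp add: field_simps)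
    qed
    moreover have "fnorm p u > 0"
      using False fnorm_nonneg[OF nf, of u] equiv_inner_product_fnorm_eq_0[OF p, of u] by linarith
    ultimately show ?thesis by (simp add: field_simps)
  qed
  have bdd: "bdd_above (range (\<lambda>u. cmod (f u) / fnorm p u))"
    using ratio by (intro bdd_aboveI2)
  have le: "cmod (f u) / fnorm p u \<le> dual_norm p f" for u
    unfolding dual_norm_def using bdd by (intro cSUP_upper) auto
  show "0 \<le> dual_norm p f"
    using le[of 0] fnorm_zero[OF nf] by simp
  show "cmod (f u) \<le> dual_norm p f * fnorm p u"
  proof (cases "fnorm p u = 0")
    case True
    then have "u = 0" using equiv_inner_product_fnorm_eq_0[OF p] by blast
    then show ?thesis using M(2)[of 0] True by simp
  next
    case False
    then have "fnorm p u > 0" using fnorm_nonneg[OF nf, of u] by simp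
    then show ?thesis using le[of u] by (simp add: field_simps)
  qed
qed

lemma nonneg_form_bounded_linear:
  fixes s :: "'a::complex_inner \<Rightarrow> 'a \<Rightarrow> complex"
  assumes s: "nonneg_form s" and C: "\<And>u. fnorm s u \<le> C * norm u"
  shows "bounded_linear (\<lambda>u. s u w)"
proof (rule bounded_linear_intro[where K = "C * fnorm s w"])
  show "norm (s u w) \<le> norm u * (C * fnorm s w)" for u
    using order_trans[OF nonneg_form_Cauchy_Schwarz[OF s, of u w]
        mult_right_mono[OF C[of u] fnorm_nonneg[OF s, of w]]]
    by (simp add: mult_ac)
qed (simp_all add: nonneg_form_add_left[OF s] nonneg_form_scaleR_left[OF s] scaleR_conv_of_real)

text \<open>Turns a remainder estimate for small parameters into an exact identity: after replacing
  \<theta> by s \<theta> and dividing by the leading power of s, the error still carries one factor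
  s.\<close>

lemma nonpos_if_le_all_multiples:
  fixes x X :: real
  assumes "s0 > 0" "\<And>s. \<lbrakk>0 < s; s \<le> s0\<rbrakk> \<Longrightarrow> x \<le> s * X"
  shows "x \<le> 0"
proof (rule ccontr)
  assume "\<not> x \<le> 0"
  then have "x > 0" by simp
  moreover have "x \<le> s0 * X" using assms by simp
  ultimately have "X > 0" using assms(1) by (smt (verit) mult_nonneg_nonpos)
  define s where "s = min s0 (x / (2 * X))"
  have "s > 0" "s \<le> s0" using assms(1) \<open>x > 0\<close> \<open>X > 0\<close> by (auto simp: s_def)
  then have "x \<le> s * X" using assms(2) by simp
  also have "\<dots> \<le> x / (2 * X) * X"
    using \<open>X > 0\<close> by (intro mult_right_mono) (auto simp: s_def)
  also have "\<dots> = x / 2" using \<open>X > 0\<close> by simp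
  finally show False using \<open>x > 0\<close> by simp
qed

text \<open>Used to divide an energy inequality by a norm that may be zero.\<close>

lemma le_if_power2_le_mult:
  fixes x y :: real
  assumes "x\<^sup>2 \<le> y * x" "0 \<le> x" "0 \<le> y"
  shows "x \<le> y"
  using assms by (cases "x = 0") (auto simp: power2_eq_square)

lemma cdot_scaleR: "cdot x (t *\<^sub>R \<theta>) = complex_of_real t * cdot x \<theta>"
  by (simp add: cdot_def sum_distrib_left mult_ac)

lemma cquad_sum:
  "cquad A \<theta> = (\<Sum>i\<in>UNIV. \<Sum>j\<in>UNIV. A $ i $ j * complex_of_real (\<theta> $ j) * complex_of_real (\<theta> $ i))"
  by (simp add: cquad_def cdot_def matrix_vector_mult_def sum_distrib_right)

lemma cquad_scaleR: "cquad A (t *\<^sub>R \<theta>) = complex_of_real (t\<^sup>2) * cquad A \<theta>"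
  by (simp add: cquad_sum sum_distrib_left power2_eq_square mult_ac)

lemma sesquilinear_on_cdot:
  assumes "\<And>i. sesquilinear_on S T (\<lambda>v u. s v u $ i)"
  shows "sesquilinear_on S T (\<lambda>v u. cdot (s v u) \<theta>)"
proof -
  note * = sesquilinear_onD[OF assms]
  show ?thesis
    unfolding sesquilinear_on_def cdot_def
    by (intro conjI ballI allI)
      (simp_all add: * distrib_right sum.distrib sum_distrib_left mult.assoc)
qed

lemma sesquilinear_on_cquad:
  assumes "\<And>i j. sesquilinear_on S T (\<lambda>v u. s v u $ i $ j)"
  shows "sesquilinear_on S T (\<lambda>v u. cquad (s v u) \<theta>)"
proof -
  have "cquad A \<theta> = cdot (\<chi> i. cdot (A $ i) \<theta>) \<theta>" for A
    by (simp add: cquad_sum cdot_def sum_distrib_right)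
  moreover have "sesquilinear_on S T (\<lambda>v u. cdot (\<chi> i. cdot (s v u $ i) \<theta>) \<theta>)"
    by (intro sesquilinear_on_cdot) (simp add: sesquilinear_on_cdot assms)
  ultimately show ?thesis by simp
qed

section \<open>Degenerate families of forms\<close>

text \<open>The constants whose existence the hypotheses assert become parameters here, so that
  later constants can be written down as explicit expressions in them. \<open>r\<close> is the
  radius of a ball inside \<Theta>, \<open>M\<close> bounds \<Theta>, and \<nu> is the gap at the
  parameter 0. The condition \<open>removable\<close> provides an actual vector in place of an
  infimum.\<close>

locale degenerate_family =
  fixes \<Theta> :: "(real^'n::finite) set"
    and a b :: "real^'n \<Rightarrow> 'h::complex_hilbert \<Rightarrow> 'h \<Rightarrow> complex"
    and a' :: "'h \<Rightarrow> 'h \<Rightarrow> complex^'n"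
    and a'' :: "'h \<Rightarrow> 'h \<Rightarrow> complex^'n^'n"
    and Vs Z :: "'h set"
    and K KZ \<gamma> r M La \<nu> Ls K1 K2 Lb :: real
  assumes ball: "cball 0 r \<subseteq> \<Theta>" and r_pos: "0 < r"
    and M: "\<And>\<theta>. \<theta> \<in> \<Theta> \<Longrightarrow> norm \<theta> \<le> M"
    and nf_a: "\<And>\<theta>. \<theta> \<in> \<Theta> \<Longrightarrow> nonneg_form (a \<theta>)"
    and nf_b: "\<And>\<theta>. \<theta> \<in> \<Theta> \<Longrightarrow> nonneg_form (b \<theta>)"
    and ip: "\<And>\<theta>. \<theta> \<in> \<Theta> \<Longrightarrow> equiv_inner_product (ip a b \<theta>)"
    and K_pos: "0 < K"
    and compare: "\<And>\<theta>1 \<theta>2 u. \<lbrakk>\<theta>1 \<in> \<Theta>; \<theta>2 \<in> \<Theta>\<rbrakk> \<Longrightarrow>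
      fnorm (ip a b \<theta>1) u \<le> K * fnorm (ip a b \<theta>2) u"
    and La_pos: "0 < La"
    and a_lipschitz: "\<And>\<theta>1 \<theta>2 u w. \<lbrakk>\<theta>1 \<in> \<Theta>; \<theta>2 \<in> \<Theta>\<rbrakk> \<Longrightarrow>
      cmod (a \<theta>1 u w - a \<theta>2 u w) \<le>
        La * norm (\<theta>1 - \<theta>2) * fnorm (ip a b \<theta>1) u * fnorm (ip a b \<theta>1) w"
    and \<nu>_pos: "0 < \<nu>"
    and gap: "\<And>w. w \<in> W_space a b 0 \<Longrightarrow> \<nu> * (fnorm (ip a b 0) w)\<^sup>2 \<le> diag (a 0) w"
    and Vs: "csubspace Vs" "closed Vs"
    and Ls_nonneg: "0 \<le> Ls"
    and removable: "\<And>\<theta>1 \<theta>2 v. \<lbrakk>\<theta>1 \<in> \<Theta>; \<theta>2 \<in> \<Theta>; v \<in> V_reg a Vs \<theta>1\<rbrakk> \<Longrightarrow>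
      \<exists>v'\<in>V_reg a Vs \<theta>2. fnorm (ip a b \<theta>2) (v - v') \<le>
        Ls * norm (\<theta>1 - \<theta>2) * fnorm (ip a b \<theta>1) v"
    and Z: "csubspace Z" "closed Z"
    and V0: "V_space a 0 = {v + z | v z. v \<in> Vs \<and> z \<in> Z}"
    and KZ: "0 \<le> KZ" "KZ < 1"
    and KZ_angle: "\<And>v z. \<lbrakk>v \<in> Vs; z \<in> Z\<rbrakk> \<Longrightarrow>
      cmod (ip a b 0 v z) \<le> KZ * fnorm (ip a b 0) v * fnorm (ip a b 0) z"
    and \<gamma>_pos: "0 < \<gamma>"
    and degeneracy: "\<And>\<theta> w. \<lbrakk>\<theta> \<in> \<Theta>; w \<in> W_space a b \<theta>\<rbrakk> \<Longrightarrow>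
      \<gamma> * (norm \<theta>)\<^sup>2 * (fnorm (ip a b \<theta>) w)\<^sup>2 \<le> diag (a \<theta>) w"
    and a'_sesq: "\<And>i. sesquilinear_on (V_space a 0) UNIV (\<lambda>v u. a' v u $ i)"
    and a''_sesq: "\<And>i j. sesquilinear_on (V_space a 0) (V_space a 0) (\<lambda>v u. a'' v u $ i $ j)"
    and K1_nonneg: "0 \<le> K1"
    and a'_approx: "\<And>v u \<theta>. \<lbrakk>v \<in> V_space a 0; \<theta> \<in> \<Theta>\<rbrakk> \<Longrightarrow>
      cmod (a \<theta> v u - cdot (a' v u) \<theta>) \<le>
        K1 * (norm \<theta>)\<^sup>2 * fnorm (ip a b 0) v * fnorm (ip a b 0) u"
    and K2_nonneg: "0 \<le> K2"
    and a''_approx: "\<And>v w \<theta>. \<lbrakk>v \<in> V_space a 0; w \<in> V_space a 0; \<theta> \<in> \<Theta>\<rbrakk> \<Longrightarrow>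
      cmod (a \<theta> v w - cquad (a'' v w) \<theta>) \<le>
        K2 * norm \<theta> ^ 3 * fnorm (ip a b 0) v * fnorm (ip a b 0) w"
    and Lb_nonneg: "0 \<le> Lb"
    and b_approx: "\<And>v w \<theta>. \<lbrakk>v \<in> V_space a 0; w \<in> V_space a 0; \<theta> \<in> \<Theta>\<rbrakk> \<Longrightarrow>
      cmod (b \<theta> v w - b 0 v w) \<le> Lb * norm \<theta> * fnorm (ip a b 0) v * fnorm (ip a b \<theta>) w"
begin

abbreviation "nn \<theta> \<equiv> fnorm (ip a b \<theta>)"
abbreviation "n0 \<equiv> fnorm (ip a b 0)"
abbreviation "V\<^sub>0 \<equiv> V_space a 0"
abbreviation "W\<^sub>0 \<equiv> W_space a b 0"
abbreviation "N \<equiv> N_map a b a'"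
abbreviation "hom \<equiv> hom_form a b a' a''"

lemma zero_in: "0 \<in> \<Theta>"
  using ball r_pos by auto

lemma M_nonneg: "0 \<le> M"
  using M[OF zero_in] by simp

lemma nf_ip: "\<theta> \<in> \<Theta> \<Longrightarrow> nonneg_form (ip a b \<theta>)"
  by (rule equiv_inner_product_nonneg_form[OF ip])

lemmas a_linear = nonneg_form_add_left[OF nf_a] nonneg_form_add_right[OF nf_a]
  nonneg_form_diff_left[OF nf_a] nonneg_form_diff_right[OF nf_a]
  nonneg_form_scaleC_left[OF nf_a] nonneg_form_scaleC_right[OF nf_a]
  nonneg_form_scaleR_left[OF nf_a] nonneg_form_scaleR_right[OF nf_a]
lemmas b_linear = nonneg_form_add_left[OF nf_b] nonneg_form_add_right[OF nf_b]
  nonneg_form_diff_left[OF nf_b] nonneg_form_diff_right[OF nf_b]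
  nonneg_form_scaleC_left[OF nf_b] nonneg_form_scaleC_right[OF nf_b]
  nonneg_form_scaleR_left[OF nf_b] nonneg_form_scaleR_right[OF nf_b]
lemmas ip_linear = nonneg_form_add_left[OF nf_ip] nonneg_form_add_right[OF nf_ip]
  nonneg_form_diff_left[OF nf_ip] nonneg_form_diff_right[OF nf_ip]
  nonneg_form_scaleC_left[OF nf_ip] nonneg_form_scaleC_right[OF nf_ip]
  nonneg_form_scaleR_left[OF nf_ip] nonneg_form_scaleR_right[OF nf_ip]
lemmas nn_nonneg = fnorm_nonneg[OF nf_ip]
lemmas n0_nonneg [simp] = fnorm_nonneg[OF nf_ip[OF zero_in]]
lemmas n0_triangle = fnorm_triangle[OF nf_ip[OF zero_in]]
lemmas n0_triangle_diff = fnorm_triangle_diff[OF nf_ip[OF zero_in]]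

lemma nn_eq_0: "\<theta> \<in> \<Theta> \<Longrightarrow> nn \<theta> u = 0 \<longleftrightarrow> u = 0"
  by (rule equiv_inner_product_fnorm_eq_0[OF ip])

lemma nn_le: "\<theta> \<in> \<Theta> \<Longrightarrow> nn \<theta> u \<le> K * n0 u" and n0_le: "\<theta> \<in> \<Theta> \<Longrightarrow> n0 u \<le> K * nn \<theta> u"
  using compare zero_in by auto

lemma diag_ip: "diag (ip a b \<theta>) u = diag (a \<theta>) u + diag (b \<theta>) u"
  by (simp add: ip_def diag_def)

lemma fnorm_a_le: "\<theta> \<in> \<Theta> \<Longrightarrow> fnorm (a \<theta>) u \<le> nn \<theta> u"
  and fnorm_b_le: "\<theta> \<in> \<Theta> \<Longrightarrow> fnorm (b \<theta>) u \<le> nn \<theta> u"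
  using nonneg_form_diag_nonneg[OF nf_a, of \<theta> u] nonneg_form_diag_nonneg[OF nf_b, of \<theta> u]
  by (simp_all add: fnorm_def diag_ip)

lemma a_le_nn: "\<theta> \<in> \<Theta> \<Longrightarrow> cmod (a \<theta> u w) \<le> nn \<theta> u * nn \<theta> w"
  by (rule order_trans[OF nonneg_form_Cauchy_Schwarz[OF nf_a] mult_mono])
    (auto intro: fnorm_a_le fnorm_nonneg nf_a nf_ip)

lemma b_le_nn: "\<theta> \<in> \<Theta> \<Longrightarrow> cmod (b \<theta> u w) \<le> nn \<theta> u * nn \<theta> w"
  by (rule order_trans[OF nonneg_form_Cauchy_Schwarz[OF nf_b] mult_mono])
    (auto intro: fnorm_b_le fnorm_nonneg nf_b nf_ip)

lemma nn_mult_le: "\<theta> \<in> \<Theta> \<Longrightarrow> nn \<theta> u * nn \<theta> w \<le> K\<^sup>2 * n0 u * n0 w"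
  using mult_mono[OF nn_le[of \<theta> u] nn_le[of \<theta> w]] K_pos nn_nonneg[of \<theta>]
  by (simp add: power2_eq_square mult_ac)

lemma a_bound: "\<theta> \<in> \<Theta> \<Longrightarrow> cmod (a \<theta> u w) \<le> K\<^sup>2 * n0 u * n0 w"
  using a_le_nn nn_mult_le order_trans by blast

lemma b_bound: "\<theta> \<in> \<Theta> \<Longrightarrow> cmod (b \<theta> u w) \<le> K\<^sup>2 * n0 u * n0 w"
  using b_le_nn nn_mult_le order_trans by blast

lemma a_diff_bound: "\<theta> \<in> \<Theta> \<Longrightarrow> cmod (a \<theta> u w - a 0 u w) \<le> La * norm \<theta> * n0 u * n0 w"
  using a_lipschitz[OF zero_in, of \<theta> u w] by (simp add: norm_minus_commute)

lemma V_iff: "\<theta> \<in> \<Theta> \<Longrightarrow> v \<in> V_space a \<theta> \<longleftrightarrow> fnorm (a \<theta>) v = 0"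
  using nonneg_form_diag_eq[OF nf_a, of \<theta> v] by (simp add: V_space_def)

lemma V_left: "\<lbrakk>\<theta> \<in> \<Theta>; v \<in> V_space a \<theta>\<rbrakk> \<Longrightarrow> a \<theta> v w = 0"
  and V_right: "\<lbrakk>\<theta> \<in> \<Theta>; v \<in> V_space a \<theta>\<rbrakk> \<Longrightarrow> a \<theta> w v = 0"
  using nonneg_form_Cauchy_Schwarz[OF nf_a, of \<theta> v w]
    nonneg_form_Cauchy_Schwarz[OF nf_a, of \<theta> w v] V_iff by auto

lemma V_eq: "\<theta> \<in> \<Theta> \<Longrightarrow> V_space a \<theta> = {v. \<forall>w. a \<theta> v w = 0}"
  using V_left by (auto simp: V_space_def)

lemma V_csubspace: "\<theta> \<in> \<Theta> \<Longrightarrow> csubspace (V_space a \<theta>)"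
  unfolding csubspace_def by (simp add: V_eq nonneg_form_zero_left[OF nf_a] a_linear)

lemma norm_compare: "\<theta> \<in> \<Theta> \<Longrightarrow> \<exists>C>0. \<forall>u. nn \<theta> u \<le> C * norm u \<and> norm u \<le> C * nn \<theta> u"
proof -
  assume "\<theta> \<in> \<Theta>"
  then obtain c C where c: "c > 0" "C > 0" "\<And>u. c * norm u \<le> nn \<theta> u" "\<And>u. nn \<theta> u \<le> C * norm u"
    using ip[OF \<open>\<theta> \<in> \<Theta>\<close>] unfolding equiv_inner_product_def by blast
  define D where "D = max C (1 / c)"
  have "nn \<theta> u \<le> D * norm u" for u
    using c(4)[of u] mult_right_mono[of C D "norm u"] by (simp add: D_def)
  moreover have "norm u \<le> D * nn \<theta> u" for u
  proof -
    have "norm u \<le> 1 / c * nn \<theta> u" using c(1) c(3)[of u] by (simp add: field_simps)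
    also have "\<dots> \<le> D * nn \<theta> u"
      using \<open>\<theta> \<in> \<Theta>\<close> by (intro mult_right_mono) (auto simp: D_def nn_nonneg)
    finally show ?thesis .
  qed
  moreover have "D > 0" using c by (simp add: D_def)
  ultimately show ?thesis by blast
qed

lemma bounded_linear_a:
  assumes "\<theta> \<in> \<Theta>"
  shows "bounded_linear (\<lambda>u. a \<theta> u w)"
proof -
  obtain C where "\<And>u. nn \<theta> u \<le> C * norm u" using norm_compare[OF assms] by blast
  then show ?thesis
    using fnorm_a_le[OF assms] by (intro nonneg_form_bounded_linear[OF nf_a[OF assms]]) (rule order_trans)
qed

lemma V_closed:
  assumes "\<theta> \<in> \<Theta>"
  shows "closed (V_space a \<theta>)"
proof -
  have "V_space a \<theta> = (\<Inter>w. {v. a \<theta> v w = 0})"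
    by (auto simp: V_eq[OF assms])
  moreover have "closed {v. a \<theta> v w = 0}" for w
    by (intro closed_Collect_eq linear_continuous_on bounded_linear_a assms continuous_on_const)
  ultimately show ?thesis by (metis (no_types, lifting) closed_INT)
qed

lemma W_csubspace: "\<theta> \<in> \<Theta> \<Longrightarrow> csubspace (W_space a b \<theta>)"
  unfolding csubspace_def W_space_def
  by (auto simp: ip_linear nonneg_form_zero_left[OF nf_ip])

lemma W_closed:
  assumes "\<theta> \<in> \<Theta>"
  shows "closed (W_space a b \<theta>)"
proof -
  have "W_space a b \<theta> = (\<Inter>v\<in>V_space a \<theta>. {w. ip a b \<theta> w v = 0})"
    by (auto simp: W_space_def)
  moreover have "closed {w. ip a b \<theta> w v = 0}" for v
    using norm_compare[OF assms] nonneg_form_bounded_linear[OF nf_ip[OF assms], of _ v]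
    by (intro closed_Collect_eq linear_continuous_on continuous_on_const) blast
  ultimately show ?thesis by (metis (no_types, lifting) closed_INT)
qed

lemma V_W_decomposition:
  assumes "\<theta> \<in> \<Theta>"
  shows "\<exists>v\<in>V_space a \<theta>. u - v \<in> W_space a b \<theta> \<and> nn \<theta> v \<le> nn \<theta> u \<and> nn \<theta> (u - v) \<le> nn \<theta> u"
proof -
  obtain v where v: "v \<in> V_space a \<theta>" "\<And>y. y \<in> V_space a \<theta> \<Longrightarrow> ip a b \<theta> (u - v) y = 0"
    using orthogonal_decomposition[OF ip V_csubspace V_closed] assms by blast
  have "diag (ip a b \<theta>) u = diag (ip a b \<theta>) ((u - v) + v)" by simp
  also have "\<dots> = diag (ip a b \<theta>) (u - v) + diag (ip a b \<theta>) v"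
    by (subst diag_add[OF nf_ip[OF assms]]) (simp add: v)
  finally have "diag (ip a b \<theta>) (u - v) \<le> diag (ip a b \<theta>) u" "diag (ip a b \<theta>) v \<le> diag (ip a b \<theta>) u"
    using nonneg_form_diag_nonneg[OF nf_ip[OF assms]] by auto
  then show ?thesis using v by (intro bexI[of _ v]) (auto simp: fnorm_def W_space_def)
qed

lemma Vs_subset: "Vs \<subseteq> V\<^sub>0" and Z_subset: "Z \<subseteq> V\<^sub>0"
proof -
  have "0 \<in> Vs" "0 \<in> Z" using Vs(1) Z(1) by (auto simp: csubspace_def)
  then have "v + 0 \<in> V\<^sub>0" "0 + z \<in> V\<^sub>0" if "v \<in> Vs" "z \<in> Z" for v z
    unfolding V0 using that by blast+
  then show "Vs \<subseteq> V\<^sub>0" "Z \<subseteq> V\<^sub>0"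
    using \<open>0 \<in> Vs\<close> \<open>0 \<in> Z\<close> by auto
qed

lemma V_reg_subset: "V_reg a Vs \<theta> \<subseteq> V_space a \<theta>"
  using Vs_subset by (simp add: V_reg_def)

lemma V_reg_csubspace: "\<theta> \<in> \<Theta> \<Longrightarrow> csubspace (V_reg a Vs \<theta>)"
  using Vs V_csubspace by (simp add: V_reg_def)

lemma n0_b: "v \<in> V\<^sub>0 \<Longrightarrow> n0 v = fnorm (b 0) v"
  using V_left[OF zero_in] by (simp add: fnorm_def diag_ip) (simp add: diag_def)

text \<open>A bound for the two oblique projections of \<open>Vs\<close> + \<open>Z\<close> onto its
  summands, in the norm \<open>n0\<close>.\<close>

definition "\<kappa> = 1 / sqrt (1 - KZ)"

lemma \<kappa>_pos: "0 < \<kappa>"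
  using KZ by (simp add: \<kappa>_def)

text \<open>The angle condition and 2 x y \<le> x^2 + y^2 bound the cross term by KZ times the sum
  of the squared norms, so the factor 1 - KZ of that sum survives in the squared norm of v +
  z.\<close>

lemma sum_lower:
  assumes "v \<in> Vs" "z \<in> Z"
  shows "n0 v \<le> \<kappa> * n0 (v + z)" "n0 z \<le> \<kappa> * n0 (v + z)"
proof -
  have "- Re (ip a b 0 v z) \<le> cmod (ip a b 0 v z)"
    using abs_Re_le_cmod[of "ip a b 0 v z"] by linarith
  also have "\<dots> \<le> KZ * (n0 v * n0 z)" using KZ_angle[OF assms] by (simp only: mult.assoc)
  finally have "- (2 * Re (ip a b 0 v z)) \<le> 2 * (KZ * (n0 v * n0 z))" by linarith
  also have "\<dots> \<le> KZ * ((n0 v)\<^sup>2 + (n0 z)\<^sup>2)"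
    using mult_left_mono[OF sum_squares_bound[of "n0 v" "n0 z"] KZ(1)] by (simp only: mult_ac)
  finally have "(1 - KZ) * ((n0 v)\<^sup>2 + (n0 z)\<^sup>2) \<le> (n0 v)\<^sup>2 + 2 * Re (ip a b 0 v z) + (n0 z)\<^sup>2"
    by (simp add: algebra_simps)
  then have main: "(1 - KZ) * ((n0 v)\<^sup>2 + (n0 z)\<^sup>2) \<le> (n0 (v + z))\<^sup>2"
    by (simp only: fnorm_square[OF nf_ip[OF zero_in]] diag_add[OF nf_ip[OF zero_in]])
  have *: "x \<le> \<kappa> * n0 (v + z)" if "x\<^sup>2 \<le> (n0 v)\<^sup>2 + (n0 z)\<^sup>2" for x
  proof (rule power2_le_imp_le)
    have "(1 - KZ) * x\<^sup>2 \<le> (n0 (v + z))\<^sup>2"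
      using mult_left_mono[OF that, of "1 - KZ"] KZ main by linarith
    then show "x\<^sup>2 \<le> (\<kappa> * n0 (v + z))\<^sup>2"
      using KZ by (simp add: \<kappa>_def power_mult_distrib power_divide field_simps)
  qed (use \<kappa>_pos in simp)
  show "n0 v \<le> \<kappa> * n0 (v + z)" by (rule *) simp
  show "n0 z \<le> \<kappa> * n0 (v + z)" by (rule *) simp
qed

section \<open>Coefficients of the expansion of a_\<theta> at the parameter 0\<close>

definition "A1 = La + K1 * r"
definition "A2 = (K\<^sup>2 + K2 * r ^ 3) / r\<^sup>2"

lemma A1_pos: "0 < A1" and A2_nonneg: "0 \<le> A2"
  using La_pos K1_nonneg K2_nonneg r_pos
  by (auto simp: A1_def A2_def intro!: add_pos_nonneg divide_nonneg_nonneg add_nonneg_nonneg)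

lemma scaled_in:
  assumes "0 \<le> s" "s * norm \<theta> \<le> r"
  shows "s *\<^sub>R \<theta> \<in> \<Theta>"
  using assms ball by auto

text \<open>The regularity condition is evaluated on the sphere |\<theta>| = r inside \<Theta>.
  Since a_0(v, u) = 0 for v in \<open>V\<^sub>0\<close>, Lipschitz continuity bounds a_\<theta>(v,
  u) there by La r, and linearity in \<theta> spreads the bound to all \<theta>. \<open>A1\<close>
  is the resulting constant; \<open>A2\<close> arises in the same way from the comparison of norms
  and homogeneity of degree two.\<close>

lemma a'_bound:
  assumes v: "v \<in> V\<^sub>0"
  shows "cmod (cdot (a' v u) \<theta>) \<le> A1 * norm \<theta> * n0 v * n0 u"
proof (cases "\<theta> = 0")
  case True
  then show ?thesis by (simp add: cdot_def)
next
  case False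
  define s where "s = r / norm \<theta>"
  have s: "s > 0" "s * norm \<theta> = r" using False r_pos by (auto simp: s_def)
  let ?\<theta> = "s *\<^sub>R \<theta>"
  have in\<Theta>: "?\<theta> \<in> \<Theta>" using s by (intro scaled_in) auto
  have nrm: "norm ?\<theta> = r" using s by simp
  have "cmod (cdot (a' v u) ?\<theta>) \<le> cmod (a ?\<theta> v u) + cmod (a ?\<theta> v u - cdot (a' v u) ?\<theta>)"
    by norm
  also have "\<dots> \<le> La * r * n0 v * n0 u + K1 * r\<^sup>2 * n0 v * n0 u"
    using a_diff_bound[OF in\<Theta>, of v u] a'_approx[OF v in\<Theta>, of u] V_left[OF zero_in v] nrm by simp
  also have "\<dots> = A1 * (s * norm \<theta>) * n0 v * n0 u"
    by (simp add: s(2) A1_def power2_eq_square algebra_simps)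
  also have "\<dots> = s * (A1 * norm \<theta> * n0 v * n0 u)" by (simp add: mult_ac)
  finally show ?thesis using s(1) by (simp add: cdot_scaleR norm_mult)
qed

lemma a''_bound:
  assumes v: "v \<in> V\<^sub>0" "w \<in> V\<^sub>0"
  shows "cmod (cquad (a'' v w) \<theta>) \<le> A2 * (norm \<theta>)\<^sup>2 * n0 v * n0 w"
proof (cases "\<theta> = 0")
  case True
  then show ?thesis by (simp add: cquad_sum)
next
  case False
  define s where "s = r / norm \<theta>"
  have s: "s > 0" "s * norm \<theta> = r" using False r_pos by (auto simp: s_def)
  let ?\<theta> = "s *\<^sub>R \<theta>"
  have in\<Theta>: "?\<theta> \<in> \<Theta>" using s by (intro scaled_in) auto
  have nrm: "norm ?\<theta> = r" using s by simp
  have "s\<^sup>2 * cmod (cquad (a'' v w) \<theta>) = cmod (cquad (a'' v w) ?\<theta>)"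
    by (simp add: cquad_scaleR norm_mult norm_power)
  also have "\<dots> \<le> cmod (a ?\<theta> v w) + cmod (a ?\<theta> v w - cquad (a'' v w) ?\<theta>)"
    by norm
  also have "\<dots> \<le> (K\<^sup>2 + K2 * r ^ 3) * (n0 v * n0 w)"
    using a_bound[OF in\<Theta>, of v w] a''_approx[OF v in\<Theta>] unfolding nrm by (simp add: algebra_simps)
  also have "\<dots> = A2 * (s * norm \<theta>)\<^sup>2 * (n0 v * n0 w)" using r_pos by (simp add: A2_def s(2))
  also have "\<dots> = s\<^sup>2 * (A2 * (norm \<theta>)\<^sup>2 * n0 v * n0 w)"
    by (simp add: power_mult_distrib)
  finally show ?thesis using s(1) by simp
qed

lemma a_V0_bound:
  assumes "v \<in> V\<^sub>0" "w \<in> V\<^sub>0" "\<theta> \<in> \<Theta>"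
  shows "cmod (a \<theta> v w) \<le> (A2 + K2 * norm \<theta>) * (norm \<theta>)\<^sup>2 * n0 v * n0 w"
proof -
  have "cmod (a \<theta> v w) \<le> cmod (cquad (a'' v w) \<theta>) + cmod (a \<theta> v w - cquad (a'' v w) \<theta>)"
    by norm
  also have "\<dots> \<le> A2 * (norm \<theta>)\<^sup>2 * n0 v * n0 w + K2 * norm \<theta> ^ 3 * n0 v * n0 w"
    using a''_bound[OF assms(1,2)] a''_approx[OF assms] by (intro add_mono)
  finally show ?thesis by (simp add: algebra_simps power2_eq_square power3_eq_cube)
qed

text \<open>On \<open>V\<^sub>0\<close> in both arguments a_\<theta> is of second order, so its
  first-order coefficient has to vanish: divide by s and let s tend to 0.\<close>

lemma a'_V0:
  assumes v: "v \<in> V\<^sub>0" "w \<in> V\<^sub>0"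
  shows "cdot (a' v w) \<theta> = 0"
proof (cases "\<theta> = 0")
  case True
  then show ?thesis by (simp add: cdot_def)
next
  case False
  let ?X = "(A2 + K2 * r + K1) * (norm \<theta>)\<^sup>2 * (n0 v * n0 w)"
  have "cmod (cdot (a' v w) \<theta>) \<le> 0"
  proof (rule nonpos_if_le_all_multiples[of "r / norm \<theta>" _ ?X])
    show "0 < r / norm \<theta>" using False r_pos by simp
    fix s assume s: "0 < s" "s \<le> r / norm \<theta>"
    let ?\<theta> = "s *\<^sub>R \<theta>"
    have sr: "s * norm \<theta> \<le> r" using s False by (simp add: field_simps)
    have in\<Theta>: "?\<theta> \<in> \<Theta>" using s sr by (intro scaled_in) auto
    have nrm: "norm ?\<theta> = s * norm \<theta>" using s by simp
    have "s * cmod (cdot (a' v w) \<theta>) = cmod (cdot (a' v w) ?\<theta>)"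
      using s by (simp add: cdot_scaleR norm_mult)
    also have "\<dots> \<le> cmod (a ?\<theta> v w) + cmod (a ?\<theta> v w - cdot (a' v w) ?\<theta>)"
      by norm
    also have "\<dots> \<le> (A2 + K2 * (s * norm \<theta>)) * (s * norm \<theta>)\<^sup>2 * n0 v * n0 w
        + K1 * (s * norm \<theta>)\<^sup>2 * n0 v * n0 w"
      using a_V0_bound[OF v in\<Theta>] a'_approx[OF v(1) in\<Theta>, of w] unfolding nrm by (intro add_mono)
    also have "\<dots> = (A2 + K2 * (s * norm \<theta>) + K1) * ((s * norm \<theta>)\<^sup>2 * n0 v * n0 w)"
      by (simp add: algebra_simps)
    also have "\<dots> \<le> (A2 + K2 * r + K1) * ((s * norm \<theta>)\<^sup>2 * n0 v * n0 w)"
      using sr K2_nonneg by (intro mult_right_mono add_mono mult_left_mono) auto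
    also have "\<dots> = s * (s * ?X)" by (simp add: power2_eq_square algebra_simps)
    finally show "cmod (cdot (a' v w) \<theta>) \<le> s * ?X" using s(1) by simp
  qed
  then show ?thesis by simp
qed

text \<open>The Hermitian symmetry of a_\<theta> passes to its second-order coefficient because the
  remainder is cubic: after division by s^2 a factor s is left.\<close>

lemma a''_commute:
  assumes v: "v \<in> V\<^sub>0" "w \<in> V\<^sub>0"
  shows "cquad (a'' v w) \<theta> = cnj (cquad (a'' w v) \<theta>)"
proof (cases "\<theta> = 0")
  case True
  then show ?thesis by (simp add: cquad_sum)
next
  case False
  let ?D = "\<lambda>\<theta>. cquad (a'' v w) \<theta> - cnj (cquad (a'' w v) \<theta>)"
  let ?X = "2 * K2 * norm \<theta> ^ 3 * n0 v * n0 w"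
  have "cmod (?D \<theta>) \<le> 0"
  proof (rule nonpos_if_le_all_multiples[of "r / norm \<theta>" _ ?X])
    show "0 < r / norm \<theta>" using False r_pos by simp
    fix s assume s: "0 < s" "s \<le> r / norm \<theta>"
    let ?\<theta> = "s *\<^sub>R \<theta>"
    have sr: "s * norm \<theta> \<le> r" using s False by (simp add: field_simps)
    have in\<Theta>: "?\<theta> \<in> \<Theta>" using s sr by (intro scaled_in) auto
    have nrm: "norm ?\<theta> = s * norm \<theta>" using s by simp
    have "s\<^sup>2 * cmod (?D \<theta>) = cmod (complex_of_real (s\<^sup>2) * ?D \<theta>)"
      by (simp add: norm_mult norm_power)
    also have "complex_of_real (s\<^sup>2) * ?D \<theta> = ?D ?\<theta>"
      by (simp add: cquad_scaleR right_diff_distrib)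
    also have "?D ?\<theta> = cnj (a ?\<theta> w v - cquad (a'' w v) ?\<theta>) - (a ?\<theta> v w - cquad (a'' v w) ?\<theta>)"
      using nonneg_form_commute[OF nf_a[OF in\<Theta>], of v w] by simp
    also have "cmod \<dots> \<le> cmod (cnj (a ?\<theta> w v - cquad (a'' w v) ?\<theta>))
        + cmod (a ?\<theta> v w - cquad (a'' v w) ?\<theta>)" by (rule norm_triangle_ineq4)
    also have "\<dots> \<le> K2 * (s * norm \<theta>) ^ 3 * n0 w * n0 v + K2 * (s * norm \<theta>) ^ 3 * n0 v * n0 w"
      unfolding complex_mod_cnj
      using a''_approx[OF v in\<Theta>] a''_approx[OF v(2,1) in\<Theta>] unfolding nrm by (intro add_mono)
    also have "\<dots> = s\<^sup>2 * (s * ?X)"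
      by (simp add: power2_eq_square power3_eq_cube algebra_simps)
    finally show "cmod (?D \<theta>) \<le> s * ?X" using s(1) by simp
  qed
  then show ?thesis by simp
qed

lemmas a'_linear = sesquilinear_onD[OF sesquilinear_on_cdot[OF a'_sesq]]
lemmas a''_linear = sesquilinear_onD[OF sesquilinear_on_cquad[OF a''_sesq]]

section \<open>The corrector N and the homogenised form\<close>

lemma N_map_unique:
  assumes "w1 \<in> W\<^sub>0" "w2 \<in> W\<^sub>0" "\<And>w'. w' \<in> W\<^sub>0 \<Longrightarrow> a 0 w1 w' = a 0 w2 w'"
  shows "w1 = w2"
proof -
  have W: "w1 - w2 \<in> W\<^sub>0"
    using subspace_diff[OF csubspace_imp_subspace[OF W_csubspace[OF zero_in]]] assms by blast
  have "a 0 (w1 - w2) (w1 - w2) = 0"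
    using assms(3)[OF W] by (subst nonneg_form_diff_left[OF nf_a[OF zero_in]]) simp
  then have "\<nu> * (n0 (w1 - w2))\<^sup>2 \<le> 0"
    using gap[OF W] by (simp add: diag_def)
  then have "n0 (w1 - w2) = 0" using \<nu>_pos by (simp add: mult_le_0_iff)
  then show ?thesis using nn_eq_0[OF zero_in] by simp
qed

text \<open>By the gap at 0, a_0 is coercive on \<open>W\<^sub>0\<close> in the norm
  \<open>n0\<close> and hence, after the norm comparison with constant \<open>C\<close>, in the
  original norm.\<close>

lemma N_map_exists:
  assumes v: "v \<in> V\<^sub>0"
  shows "\<exists>w\<in>W\<^sub>0. \<forall>w'\<in>W\<^sub>0. a 0 w w' = - cdot (a' v w') \<theta>"
proof -
  obtain C where C: "C > 0" "\<And>u. n0 u \<le> C * norm u" "\<And>u. norm u \<le> C * n0 u"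
    using norm_compare[OF zero_in] by blast
  note nf = nf_a[OF zero_in]
  show ?thesis
  proof (rule coercive_form_representation[where I = "\<lambda>w. \<i> *\<^sub>C w" and C = "C\<^sup>2" and c = "\<nu> / C\<^sup>2"
        and F = "A1 * norm \<theta> * n0 v * C"])
    show "subspace W\<^sub>0" "closed W\<^sub>0"
      using W_csubspace W_closed csubspace_imp_subspace zero_in by auto
    show "a 0 u w = cnj (a 0 w u)" for u w by (rule nonneg_form_commute[OF nf])
    show "cmod (a 0 u w) \<le> C\<^sup>2 * norm u * norm w" for u w
    proof -
      have "cmod (a 0 u w) \<le> n0 u * n0 w" by (rule a_le_nn[OF zero_in])
      also have "\<dots> \<le> (C * norm u) * (C * norm w)"
        using C by (intro mult_mono) auto
      finally show ?thesis by (simp add: power2_eq_square mult_ac)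
    qed
    show "\<nu> / C\<^sup>2 * (norm u)\<^sup>2 \<le> Re (a 0 u u)" if "u \<in> W\<^sub>0" for u
    proof -
      have "(norm u)\<^sup>2 \<le> (C * n0 u)\<^sup>2" using C by (intro power_mono) auto
      then have "\<nu> / C\<^sup>2 * (norm u)\<^sup>2 \<le> \<nu> / C\<^sup>2 * (C * n0 u)\<^sup>2"
        using \<nu>_pos by (intro mult_left_mono) auto
      also have "\<dots> = \<nu> * (n0 u)\<^sup>2" using C(1) by (simp add: power_mult_distrib)
      also have "\<dots> \<le> Re (a 0 u u)" using gap[OF that] by (simp add: diag_def)
      finally show ?thesis .
    qed
    show "\<nu> / C\<^sup>2 > 0" using \<nu>_pos C(1) by simp
    show "cmod (- cdot (a' v u) \<theta>) \<le> A1 * norm \<theta> * n0 v * C * norm u" for u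
    proof -
      have "cmod (cdot (a' v u) \<theta>) \<le> A1 * norm \<theta> * n0 v * n0 u" by (rule a'_bound[OF v])
      also have "\<dots> \<le> A1 * norm \<theta> * n0 v * (C * norm u)"
        using A1_pos C by (intro mult_left_mono) auto
      finally show ?thesis by (simp add: mult_ac)
    qed
    show "\<i> *\<^sub>C u \<in> W\<^sub>0" if "u \<in> W\<^sub>0" for u
      using W_csubspace[OF zero_in] that by (simp add: csubspace_def)
    show "- cdot (a' v (r *\<^sub>R u)) \<theta> = complex_of_real r * - cdot (a' v u) \<theta>" for r u
      using a'_linear(4)[OF v, of u "complex_of_real r" \<theta>] by (simp add: scaleR_scaleC)
  qed (use v zero_in in \<open>auto simp: a_linear a'_linear\<close>)
qed

lemma N_in: "v \<in> V\<^sub>0 \<Longrightarrow> N \<theta> v \<in> W\<^sub>0"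
  and N_W: "\<lbrakk>v \<in> V\<^sub>0; w \<in> W\<^sub>0\<rbrakk> \<Longrightarrow> a 0 (N \<theta> v) w = - cdot (a' v w) \<theta>"
proof -
  have "N \<theta> v \<in> W\<^sub>0 \<and> (\<forall>w'\<in>W\<^sub>0. a 0 (N \<theta> v) w' = - cdot (a' v w') \<theta>)" if "v \<in> V\<^sub>0"
    unfolding N_map_def
  proof (rule theI')
    show "\<exists>!w. w \<in> W\<^sub>0 \<and> (\<forall>w'\<in>W\<^sub>0. a 0 w w' = - cdot (a' v w') \<theta>)"
    proof (rule ex_ex1I)
      show "\<exists>w. w \<in> W\<^sub>0 \<and> (\<forall>w'\<in>W\<^sub>0. a 0 w w' = - cdot (a' v w') \<theta>)"
        using N_map_exists[OF that] by blast
    qed (auto intro: N_map_unique)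
  qed
  then show "v \<in> V\<^sub>0 \<Longrightarrow> N \<theta> v \<in> W\<^sub>0"
    "\<lbrakk>v \<in> V\<^sub>0; w \<in> W\<^sub>0\<rbrakk> \<Longrightarrow> a 0 (N \<theta> v) w = - cdot (a' v w) \<theta>" by blast+
qed

text \<open>The defining equation of \<open>N\<close> extends from \<open>W\<^sub>0\<close> to all test vectors because both
  sides vanish on \<open>V\<^sub>0\<close>.\<close>

lemma a0_N:
  assumes v: "v \<in> V\<^sub>0"
  shows "a 0 (N \<theta> v) u = - cdot (a' v u) \<theta>"
proof -
  obtain x where x: "x \<in> V\<^sub>0" "u - x \<in> W\<^sub>0"
    using V_W_decomposition[OF zero_in, of u] by blast
  have "a 0 (N \<theta> v) u = a 0 (N \<theta> v) (u - x)"
    using V_right[OF zero_in x(1)] by (simp add: a_linear zero_in)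
  also have "\<dots> = - cdot (a' v (u - x)) \<theta>" by (rule N_W[OF v x(2)])
  also have "cdot (a' v (u - x)) \<theta> = cdot (a' v ((u - x) + x)) \<theta>"
    by (subst a'_linear(3)[OF v]) (simp_all add: a'_V0[OF v x(1)])
  finally show ?thesis by simp
qed

definition "A3 = A1 / \<nu>"

lemma A3_pos: "0 < A3"
  using A1_pos \<nu>_pos by (simp add: A3_def)

text \<open>Test the equation for N_\<theta> v with N_\<theta> v itself; the gap \<nu> in the
  denominator of \<open>A3\<close> comes from the left-hand side.\<close>

lemma N_bound:
  assumes v: "v \<in> V\<^sub>0"
  shows "n0 (N \<theta> v) \<le> A3 * norm \<theta> * n0 v"
proof (rule le_if_power2_le_mult)
  have "\<nu> * (n0 (N \<theta> v))\<^sup>2 \<le> Re (a 0 (N \<theta> v) (N \<theta> v))"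
    using gap[OF N_in[OF v]] by (simp add: diag_def)
  also have "\<dots> \<le> cmod (cdot (a' v (N \<theta> v)) \<theta>)"
    using complex_Re_le_cmod[of "a 0 (N \<theta> v) (N \<theta> v)"] a0_N[OF v] by (metis norm_minus_cancel)
  also have "\<dots> \<le> A1 * norm \<theta> * n0 v * n0 (N \<theta> v)" by (rule a'_bound[OF v])
  finally show "(n0 (N \<theta> v))\<^sup>2 \<le> A3 * norm \<theta> * n0 v * n0 (N \<theta> v)"
    using \<nu>_pos by (simp add: A3_def field_simps)
qed (use A3_pos in auto)

lemma N_add:
  assumes "v \<in> V\<^sub>0" "w \<in> V\<^sub>0"
  shows "N \<theta> (v + w) = N \<theta> v + N \<theta> w"
proof (rule N_map_unique)
  have vw: "v + w \<in> V\<^sub>0" using assms V_csubspace[OF zero_in] by (simp add: csubspace_def)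
  then show "N \<theta> (v + w) \<in> W\<^sub>0" by (rule N_in)
  show "N \<theta> v + N \<theta> w \<in> W\<^sub>0"
    using N_in[OF assms(1)] N_in[OF assms(2)] W_csubspace[OF zero_in] by (simp add: csubspace_def)
  show "a 0 (N \<theta> (v + w)) w' = a 0 (N \<theta> v + N \<theta> w) w'" for w'
    using assms vw by (simp add: a0_N a_linear zero_in a'_linear)
qed

lemma N_scaleC:
  assumes "v \<in> V\<^sub>0"
  shows "N \<theta> (c *\<^sub>C v) = c *\<^sub>C N \<theta> v"
proof (rule N_map_unique)
  have cv: "c *\<^sub>C v \<in> V\<^sub>0" using assms V_csubspace[OF zero_in] by (simp add: csubspace_def)
  then show "N \<theta> (c *\<^sub>C v) \<in> W\<^sub>0" by (rule N_in)
  show "c *\<^sub>C N \<theta> v \<in> W\<^sub>0"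
    using N_in[OF assms(1)] W_csubspace[OF zero_in] by (simp add: csubspace_def)
  show "a 0 (N \<theta> (c *\<^sub>C v)) w' = a 0 (c *\<^sub>C N \<theta> v) w'" for w'
    using assms cv by (simp add: a0_N a_linear zero_in a'_linear)
qed

lemma N_scale_param:
  assumes "v \<in> V\<^sub>0"
  shows "N (t *\<^sub>R \<theta>) v = complex_of_real t *\<^sub>C N \<theta> v"
proof (rule N_map_unique)
  show "N (t *\<^sub>R \<theta>) v \<in> W\<^sub>0" using assms by (rule N_in)
  show "complex_of_real t *\<^sub>C N \<theta> v \<in> W\<^sub>0"
    using N_in[OF assms(1)] W_csubspace[OF zero_in] by (simp add: csubspace_def)
  show "a 0 (N (t *\<^sub>R \<theta>) v) w' = a 0 (complex_of_real t *\<^sub>C N \<theta> v) w'" for w'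
    using assms by (simp add: a0_N a_linear zero_in cdot_scaleR)
qed

lemma hom_sesquilinear: "sesquilinear_on V\<^sub>0 V\<^sub>0 (hom \<theta>)"
  unfolding sesquilinear_on_def hom_form_def
  by (auto simp: a''_linear N_add N_scaleC a_linear zero_in algebra_simps)

lemmas hom_linear = sesquilinear_onD[OF hom_sesquilinear]

lemma hom_commute: "\<lbrakk>v \<in> V\<^sub>0; w \<in> V\<^sub>0\<rbrakk> \<Longrightarrow> hom \<theta> v w = cnj (hom \<theta> w v)"
  using a''_commute[of v w \<theta>] nonneg_form_commute[OF nf_a[OF zero_in], of "N \<theta> v" "N \<theta> w"]
  by (simp add: hom_form_def)

lemma hom_scale_param: "\<lbrakk>v \<in> V\<^sub>0; w \<in> V\<^sub>0\<rbrakk> \<Longrightarrow> hom (t *\<^sub>R \<theta>) v w = complex_of_real (t\<^sup>2) * hom \<theta> v w"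
  by (simp add: hom_form_def cquad_scaleR N_scale_param a_linear zero_in power2_eq_square
      algebra_simps)

lemma hom_bound:
  assumes v: "v \<in> V\<^sub>0" "w \<in> V\<^sub>0"
  shows "cmod (hom \<theta> v w) \<le> (A2 + A3\<^sup>2) * (norm \<theta>)\<^sup>2 * n0 v * n0 w"
proof -
  have "cmod (hom \<theta> v w) \<le> cmod (cquad (a'' v w) \<theta>) + cmod (a 0 (N \<theta> v) (N \<theta> w))"
    unfolding hom_form_def by (rule norm_triangle_ineq4)
  also have "\<dots> \<le> A2 * (norm \<theta>)\<^sup>2 * n0 v * n0 w + n0 (N \<theta> v) * n0 (N \<theta> w)"
    by (intro add_mono a''_bound v a_le_nn zero_in)
  also have "n0 (N \<theta> v) * n0 (N \<theta> w) \<le> (A3 * norm \<theta> * n0 v) * (A3 * norm \<theta> * n0 w)"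
    using A3_pos by (intro mult_mono N_bound v) auto
  finally show ?thesis by (simp add: algebra_simps power2_eq_square)
qed

end

lemma full_form_nonneg:
  assumes "nonneg_form (a \<theta>)" "nonneg_form (b \<theta>)"
  shows "nonneg_form (full_form a b \<epsilon> \<theta>)"
  using assms unfolding nonneg_form_def sesquilinear_on_def diag_def full_form_def
  by (auto simp: algebra_simps)

section \<open>Corrected vectors and coercivity of the homogenised form\<close>

context degenerate_family
begin

definition "A4 = K1 + La * A3"
definition "A5 = K2 + K1 * A3"

lemma A4_nonneg: "0 \<le> A4" and A5_nonneg: "0 \<le> A5"
  using K1_nonneg K2_nonneg La_pos A3_pos by (simp_all add: A4_def A5_def)

text \<open>This is the purpose of \<open>N\<close>: a_0(N_\<theta> v, u) cancels the first-order
  part of a_\<theta>(v, u) exactly, for every u. Replacing a_0 by a_\<theta> in the corrector term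
  costs La |\<theta>| times the norm of N_\<theta> v, which is again of second order.\<close>

lemma corrected_bound:
  assumes v: "v \<in> V\<^sub>0" and \<theta>: "\<theta> \<in> \<Theta>"
  shows "cmod (a \<theta> (v + N \<theta> v) u) \<le> A4 * (norm \<theta>)\<^sup>2 * n0 v * n0 u"
proof -
  have "a \<theta> (v + N \<theta> v) u =
      (a \<theta> v u - cdot (a' v u) \<theta>) + (a \<theta> (N \<theta> v) u - a 0 (N \<theta> v) u)"
    by (simp add: a_linear \<theta> a0_N[OF v])
  then have "cmod (a \<theta> (v + N \<theta> v) u) \<le>
      cmod (a \<theta> v u - cdot (a' v u) \<theta>) + cmod (a \<theta> (N \<theta> v) u - a 0 (N \<theta> v) u)"
    by (metis norm_triangle_ineq)
  also have "\<dots> \<le> K1 * (norm \<theta>)\<^sup>2 * n0 v * n0 u + La * norm \<theta> * n0 (N \<theta> v) * n0 u"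
    by (intro add_mono a'_approx a_diff_bound v \<theta>)
  also have "La * norm \<theta> * n0 (N \<theta> v) * n0 u \<le> La * norm \<theta> * (A3 * norm \<theta> * n0 v) * n0 u"
    using La_pos by (intro mult_right_mono mult_left_mono N_bound v) auto
  finally show ?thesis by (simp add: A4_def power2_eq_square algebra_simps)
qed

text \<open>Against a test vector in \<open>V\<^sub>0\<close> one more order is gained. Up to a
  cubic error, a_\<theta>(N_\<theta> v, w) is the conjugate of the first-order term of a_\<theta>(w,
  N_\<theta> v), which by the equation for N_\<theta> w equals - a_0(N_\<theta> v, N_\<theta> w).
  The second-order terms together are thus the homogenised form.\<close>

lemma corrected_hom:
  assumes v: "v \<in> V\<^sub>0" "w \<in> V\<^sub>0" and \<theta>: "\<theta> \<in> \<Theta>"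
  shows "cmod (a \<theta> (v + N \<theta> v) w - hom \<theta> v w) \<le> A5 * norm \<theta> ^ 3 * n0 v * n0 w"
proof -
  have "a 0 (N \<theta> v) (N \<theta> w) = cnj (- cdot (a' w (N \<theta> v)) \<theta>)"
    using nonneg_form_commute[OF nf_a[OF zero_in], of "N \<theta> v" "N \<theta> w"] a0_N[OF v(2)] by metis
  moreover have "a \<theta> (N \<theta> v) w = cnj (a \<theta> w (N \<theta> v))"
    by (rule nonneg_form_commute[OF nf_a[OF \<theta>]])
  ultimately have "a \<theta> (v + N \<theta> v) w - hom \<theta> v w =
      (a \<theta> v w - cquad (a'' v w) \<theta>) + cnj (a \<theta> w (N \<theta> v) - cdot (a' w (N \<theta> v)) \<theta>)"
    by (simp add: a_linear \<theta> hom_form_def)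
  then have "cmod (a \<theta> (v + N \<theta> v) w - hom \<theta> v w) \<le>
      cmod (a \<theta> v w - cquad (a'' v w) \<theta>) + cmod (a \<theta> w (N \<theta> v) - cdot (a' w (N \<theta> v)) \<theta>)"
    by (metis norm_triangle_ineq complex_mod_cnj)
  also have "\<dots> \<le> K2 * norm \<theta> ^ 3 * n0 v * n0 w + K1 * (norm \<theta>)\<^sup>2 * n0 w * n0 (N \<theta> v)"
    by (intro add_mono a'_approx a''_approx v \<theta>)
  also have "K1 * (norm \<theta>)\<^sup>2 * n0 w * n0 (N \<theta> v) \<le> K1 * (norm \<theta>)\<^sup>2 * n0 w * (A3 * norm \<theta> * n0 v)"
    using K1_nonneg by (intro mult_left_mono N_bound v) auto
  finally show ?thesis
    by (simp add: A5_def power2_eq_square power3_eq_cube algebra_simps)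
qed

text \<open>One direction suffices: a lower bound for the a_\<theta>-energy of the corrected vector
  is to become a lower bound for the homogenised form.\<close>

lemma corrected_diag:
  assumes z: "z \<in> V\<^sub>0" and \<theta>: "\<theta> \<in> \<Theta>"
  shows "diag (a \<theta>) (z + N \<theta> z) \<le> Re (hom \<theta> z z) + (A5 + A4 * A3) * norm \<theta> ^ 3 * (n0 z)\<^sup>2"
proof -
  let ?u = "z + N \<theta> z"
  have "a \<theta> ?u ?u = a \<theta> ?u z + a \<theta> ?u (N \<theta> z)"
    by (rule nonneg_form_add_right[OF nf_a[OF \<theta>]])
  then have "diag (a \<theta>) ?u - Re (hom \<theta> z z) = Re ((a \<theta> ?u z - hom \<theta> z z) + a \<theta> ?u (N \<theta> z))"
    by (simp add: diag_def)
  also have "\<dots> \<le> cmod ((a \<theta> ?u z - hom \<theta> z z) + a \<theta> ?u (N \<theta> z))" by (rule complex_Re_le_cmod)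
  also have "\<dots> \<le> cmod (a \<theta> ?u z - hom \<theta> z z) + cmod (a \<theta> ?u (N \<theta> z))" by (rule norm_triangle_ineq)
  also have "\<dots> \<le> A5 * norm \<theta> ^ 3 * n0 z * n0 z + A4 * (norm \<theta>)\<^sup>2 * n0 z * n0 (N \<theta> z)"
    by (intro add_mono corrected_hom corrected_bound z \<theta>)
  also have "A4 * (norm \<theta>)\<^sup>2 * n0 z * n0 (N \<theta> z) \<le> A4 * (norm \<theta>)\<^sup>2 * n0 z * (A3 * norm \<theta> * n0 z)"
    using A4_nonneg by (intro mult_left_mono N_bound z) auto
  finally show ?thesis by (simp add: power2_eq_square power3_eq_cube algebra_simps)
qed

lemma diag_a_add_V:
  assumes "\<theta> \<in> \<Theta>" "v \<in> V_space a \<theta>"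
  shows "diag (a \<theta>) (u - v) = diag (a \<theta>) u"
  by (simp add: diag_def a_linear assms V_left V_right)

text \<open>For small \<open>\<theta>\<close> the vector \<open>z\<close> stays at a distance from \<open>V\<^sub>\<theta>\<close> comparable to its norm, since
  \<open>V\<^sub>\<theta>\<close> is close to \<open>V\<^sub>\<star>\<close>; quadratic degeneracy applies to the component in \<open>W\<^sub>\<theta>\<close>.\<close>

lemma hom_coercive_small:
  "\<exists>c>0. \<exists>r1>0. \<forall>\<theta>. norm \<theta> \<le> r1 \<longrightarrow> (\<forall>z\<in>Z. c * (norm \<theta>)\<^sup>2 * (n0 z)\<^sup>2 \<le> Re (hom \<theta> z z))"
proof -
  \<comment> \<open>The angle condition keeps z at distance at least 2 \<sigma> \<open>n0 z\<close>
    from \<open>Vs\<close>. One half pays for the errors collected in \<open>B\<close>: moving from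
    the kernel of a_\<theta> to \<open>Vs\<close>, and the corrector. Likewise \<open>c\<close> is
    half of what degeneracy yields, the other half absorbing the cubic remainder with constant
    \<open>C\<close>; the summand 1 beside \<open>C\<close> avoids a zero denominator in
    \<open>r1\<close>.\<close>
  define \<sigma> where "\<sigma> = 1 / (2 * \<kappa>)"
  define B where "B = Ls * (K * (1 + A3 * r)) + A3"
  define c where "c = \<gamma> * (\<sigma> / K)\<^sup>2 / 2"
  define C where "C = A5 + A4 * A3"
  define r1 where "r1 = min r (min (\<sigma> / B) (c / (C + 1)))"
  have pos: "\<sigma> > 0" "B > 0" "c > 0" "C \<ge> 0"
    using \<kappa>_pos Ls_nonneg K_pos A3_pos r_pos \<gamma>_pos A4_nonneg A5_nonneg
    by (auto simp: \<sigma>_def B_def c_def C_def intro!: add_nonneg_pos)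
  then have r1: "r1 > 0" using r_pos by (simp add: r1_def)
  have "c * (norm \<theta>)\<^sup>2 * (n0 z)\<^sup>2 \<le> Re (hom \<theta> z z)" if t: "norm \<theta> \<le> r1" and z: "z \<in> Z" for \<theta> z
  proof (cases "\<theta> = 0")
    case True
    have z0: "z \<in> V\<^sub>0" using z Z_subset by blast
    show ?thesis using hom_scale_param[OF z0 z0, of 0 0] True by simp
  next
    case False
    have z0: "z \<in> V\<^sub>0" using z Z_subset by blast
    have tr: "norm \<theta> \<le> r" and tB: "norm \<theta> * B \<le> \<sigma>" and tC: "norm \<theta> * C \<le> c"
    proof -
      show "norm \<theta> \<le> r" using t by (simp add: r1_def)
      have "norm \<theta> \<le> \<sigma> / B" "norm \<theta> \<le> c / (C + 1)" using t by (simp_all add: r1_def)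
      then have "norm \<theta> * B \<le> \<sigma>" "norm \<theta> * (C + 1) \<le> c" using pos by (simp_all add: field_simps)
      then show "norm \<theta> * B \<le> \<sigma>" "norm \<theta> * C \<le> c" by (auto simp: distrib_left intro: order_trans[rotated])
    qed
    have \<theta>: "\<theta> \<in> \<Theta>" using tr ball by auto
    define u where "u = z + N \<theta> z"
    have Nz: "n0 (N \<theta> z) \<le> A3 * norm \<theta> * n0 z" by (rule N_bound[OF z0])
    have "n0 u \<le> n0 z + A3 * norm \<theta> * n0 z"
      unfolding u_def using n0_triangle[of z "N \<theta> z"] Nz by linarith
    also have "\<dots> \<le> (1 + A3 * r) * n0 z"
      using mult_right_mono[OF mult_left_mono[OF tr, of A3], of "n0 z"] A3_pos by (simp add: algebra_simps)
    finally have u: "n0 u \<le> (1 + A3 * r) * n0 z" .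
    obtain x where x: "x \<in> V_space a \<theta>" "u - x \<in> W_space a b \<theta>" "nn \<theta> x \<le> nn \<theta> u"
      using V_W_decomposition[OF \<theta>] by blast
    have "nn \<theta> x \<le> K * n0 u" using x(3) nn_le[OF \<theta>, of u] by linarith
    also have "\<dots> \<le> K * ((1 + A3 * r) * n0 z)" using K_pos u by simp
    finally have nx: "nn \<theta> x \<le> K * (1 + A3 * r) * n0 z" by (simp add: mult_ac)
    \<comment> \<open>Removability from \<theta> to 0 replaces the kernel component \<open>x\<close>
      of \<open>u\<close> by a vector of \<open>Vs\<close>, to which the angle condition applies.
      For nonzero \<theta> the space \<open>V_reg\<close> is the whole kernel, so \<open>x\<close>
      is admissible.\<close>
    obtain v where v: "v \<in> Vs" "n0 (x - v) \<le> Ls * norm \<theta> * nn \<theta> x"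
      using removable[OF \<theta> zero_in, of x] x(1) False by (auto simp: V_reg_def)
    have xv: "n0 (x - v) \<le> Ls * norm \<theta> * (K * (1 + A3 * r) * n0 z)"
      using v(2) mult_left_mono[OF nx, of "Ls * norm \<theta>"] Ls_nonneg by fastforce
    have "- v \<in> Vs" using v Vs(1) csubspace_imp_subspace subspace_neg by blast
    then have "n0 z \<le> \<kappa> * n0 (- v + z)" using sum_lower(2) z by blast
    also have "- v + z = ((u - x) + (x - v)) - N \<theta> z" by (simp add: u_def)
    finally have "n0 z \<le> \<kappa> * n0 (((u - x) + (x - v)) - N \<theta> z)" .
    then have "2 * \<sigma> * n0 z \<le> n0 (((u - x) + (x - v)) - N \<theta> z)"
      using \<kappa>_pos by (simp add: \<sigma>_def field_simps)
    also have "\<dots> \<le> n0 (u - x) + n0 (x - v) + n0 (N \<theta> z)"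
      using n0_triangle[of "u - x" "x - v"] n0_triangle_diff[of "(u - x) + (x - v)" "N \<theta> z"]
      by linarith
    also have "\<dots> \<le> n0 (u - x) + norm \<theta> * B * n0 z"
      using xv Nz by (simp add: B_def algebra_simps)
    also have "\<dots> \<le> n0 (u - x) + \<sigma> * n0 z"
      using mult_right_mono[OF tB, of "n0 z"] by simp
    finally have "\<sigma> * n0 z \<le> n0 (u - x)" by simp
    also have "\<dots> \<le> K * nn \<theta> (u - x)" by (rule n0_le[OF \<theta>])
    finally have "\<sigma> / K * n0 z \<le> nn \<theta> (u - x)" using K_pos by (simp add: field_simps)
    then have "(\<sigma> / K * n0 z)\<^sup>2 \<le> (nn \<theta> (u - x))\<^sup>2"
      using pos K_pos by (intro power_mono) auto
    then have "\<gamma> * (norm \<theta>)\<^sup>2 * (\<sigma> / K * n0 z)\<^sup>2 \<le> \<gamma> * (norm \<theta>)\<^sup>2 * (nn \<theta> (u - x))\<^sup>2"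
      using \<gamma>_pos by (intro mult_left_mono) auto
    also have "\<dots> \<le> diag (a \<theta>) (u - x)" by (rule degeneracy[OF \<theta> x(2)])
    also have "\<dots> = diag (a \<theta>) u" by (rule diag_a_add_V[OF \<theta> x(1)])
    also have "\<dots> \<le> Re (hom \<theta> z z) + C * norm \<theta> ^ 3 * (n0 z)\<^sup>2"
      unfolding u_def C_def by (rule corrected_diag[OF z0 \<theta>])
    also have "C * norm \<theta> ^ 3 * (n0 z)\<^sup>2 = (norm \<theta> * C) * ((norm \<theta>)\<^sup>2 * (n0 z)\<^sup>2)"
      by (simp add: power2_eq_square power3_eq_cube)
    also have "\<dots> \<le> c * ((norm \<theta>)\<^sup>2 * (n0 z)\<^sup>2)"
      using tC by (intro mult_right_mono) auto
    also have "\<gamma> * (norm \<theta>)\<^sup>2 * (\<sigma> / K * n0 z)\<^sup>2 = 2 * (c * (norm \<theta>)\<^sup>2 * (n0 z)\<^sup>2)"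
      by (simp add: c_def power_mult_distrib power_divide)
    finally show ?thesis by (simp add: mult.assoc)
  qed
  then show ?thesis using pos(3) r1 by blast
qed

text \<open>Both sides are homogeneous of degree two in \<xi>, so the estimate on a ball scales to
  the whole parameter space.\<close>

lemma hom_coercive_ex:
  "\<exists>c>0. \<forall>\<xi>. \<forall>z\<in>Z. c * (norm \<xi>)\<^sup>2 * (n0 z)\<^sup>2 \<le> Re (hom \<xi> z z)"
proof -
  obtain c r1 where c: "c > 0" "r1 > 0"
    and small: "\<And>\<theta> z. \<lbrakk>norm \<theta> \<le> r1; z \<in> Z\<rbrakk> \<Longrightarrow> c * (norm \<theta>)\<^sup>2 * (n0 z)\<^sup>2 \<le> Re (hom \<theta> z z)"
    using hom_coercive_small by blast
  have "c * (norm \<xi>)\<^sup>2 * (n0 z)\<^sup>2 \<le> Re (hom \<xi> z z)" if z: "z \<in> Z" for \<xi> z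
  proof (cases "\<xi> = 0")
    case True
    then show ?thesis using small[of \<xi> z] c z by simp
  next
    case False
    define s where "s = r1 / norm \<xi>"
    have s: "s > 0" "norm (s *\<^sub>R \<xi>) = s * norm \<xi>" "s * norm \<xi> = r1"
      using False c by (auto simp: s_def)
    have z0: "z \<in> V\<^sub>0" using z Z_subset by blast
    have "c * (s * norm \<xi>)\<^sup>2 * (n0 z)\<^sup>2 \<le> s\<^sup>2 * Re (hom \<xi> z z)"
      using small[of "s *\<^sub>R \<xi>" z] s hom_scale_param[OF z0 z0, of s \<xi>] z by simp
    then have "s\<^sup>2 * (c * (norm \<xi>)\<^sup>2 * (n0 z)\<^sup>2) \<le> s\<^sup>2 * Re (hom \<xi> z z)"
      by (simp add: power_mult_distrib mult_ac)
    then show ?thesis using s(1) by simp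
  qed
  then show ?thesis using c by blast
qed

definition "c0 = (SOME c. c > 0 \<and> (\<forall>\<xi>. \<forall>z\<in>Z. c * (norm \<xi>)\<^sup>2 * (n0 z)\<^sup>2 \<le> Re (hom \<xi> z z)))"

lemma c0_pos: "0 < c0"
  and hom_coercive: "z \<in> Z \<Longrightarrow> c0 * (norm \<xi>)\<^sup>2 * (n0 z)\<^sup>2 \<le> Re (hom \<xi> z z)"
proof -
  have "c0 > 0 \<and> (\<forall>\<xi>. \<forall>z\<in>Z. c0 * (norm \<xi>)\<^sup>2 * (n0 z)\<^sup>2 \<le> Re (hom \<xi> z z))"
    unfolding c0_def by (rule someI_ex) (use hom_coercive_ex in blast)
  then show "0 < c0" "z \<in> Z \<Longrightarrow> c0 * (norm \<xi>)\<^sup>2 * (n0 z)\<^sup>2 \<le> Re (hom \<xi> z z)" by blast+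
qed

section \<open>Decomposition of test vectors\<close>

lemma W_bound:
  assumes \<theta>: "\<theta> \<in> \<Theta>" and y: "y \<in> W_space a b \<theta>"
  shows "norm \<theta> * n0 y \<le> K / sqrt \<gamma> * fnorm (a \<theta>) y"
proof -
  have "(sqrt \<gamma> * norm \<theta> * nn \<theta> y)\<^sup>2 \<le> (fnorm (a \<theta>) y)\<^sup>2"
    using degeneracy[OF \<theta> y] \<gamma>_pos by (simp add: power_mult_distrib fnorm_square[OF nf_a[OF \<theta>]])
  then have "sqrt \<gamma> * norm \<theta> * nn \<theta> y \<le> fnorm (a \<theta>) y"
    using fnorm_nonneg[OF nf_a[OF \<theta>]] by (rule power2_le_imp_le)
  then have "norm \<theta> * (K * nn \<theta> y) \<le> K / sqrt \<gamma> * fnorm (a \<theta>) y"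
    using \<gamma>_pos K_pos by (simp add: field_simps)
  moreover have "norm \<theta> * n0 y \<le> norm \<theta> * (K * nn \<theta> y)"
    by (intro mult_left_mono n0_le \<theta>) auto
  ultimately show ?thesis by linarith
qed

text \<open>In contrast to the whole of y, its \<open>W\<^sub>0\<close> component is controlled
  without the weight |\<theta>|. For |\<theta>| at least r2 degeneracy already does this. For
  smaller \<theta> the Lipschitz error La |\<theta>| is at most \<nu> / 2, so half of the gap at 0
  remains when a_0 is replaced by a_\<theta>.\<close>

lemma W0_component_bound:
  "\<exists>C\<ge>0. \<forall>\<theta>\<in>\<Theta>. \<forall>y\<in>W_space a b \<theta>. \<forall>v\<in>V\<^sub>0. y - v \<in> W\<^sub>0 \<longrightarrow> n0 v \<le> n0 y \<longrightarrow>
      n0 (y - v) \<le> n0 y \<longrightarrow> n0 (y - v) \<le> C * fnorm (a \<theta>) y"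
proof -
  define q where "q = K / sqrt \<gamma>"
  define A7 where "A7 = sqrt (A2 + K2 * M)"
  define r2 where "r2 = \<nu> / (2 * La)"
  define C where "C = max (q / r2) (sqrt (2 / \<nu>) * (1 + A7 * q))"
  have pos: "q > 0" "A7 \<ge> 0" "r2 > 0"
    using K_pos \<gamma>_pos A2_nonneg K2_nonneg M_nonneg \<nu>_pos La_pos by (auto simp: q_def A7_def r2_def)
  have "C \<ge> 0" using pos by (simp add: C_def le_max_iff_disj)
  have "n0 (y - v) \<le> C * fnorm (a \<theta>) y"
    if \<theta>: "\<theta> \<in> \<Theta>" and y: "y \<in> W_space a b \<theta>" and v: "v \<in> V\<^sub>0" "y - v \<in> W\<^sub>0" "n0 v \<le> n0 y"
      "n0 (y - v) \<le> n0 y" for \<theta> y v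
  proof -
    let ?\<alpha> = "fnorm (a \<theta>) y" and ?w = "y - v"
    have \<alpha>: "?\<alpha> \<ge> 0" by (rule fnorm_nonneg[OF nf_a[OF \<theta>]])
    have ty: "norm \<theta> * n0 y \<le> q * ?\<alpha>" using W_bound[OF \<theta> y] by (simp add: q_def)
    have *: "n0 ?w \<le> q / r2 * ?\<alpha> \<or> n0 ?w \<le> sqrt (2 / \<nu>) * (1 + A7 * q) * ?\<alpha>"
    proof (cases "norm \<theta> \<ge> r2")
      case True
      have "r2 * n0 y \<le> q * ?\<alpha>"
        using ty mult_right_mono[OF True, of "n0 y"] by simp
      then have "n0 y \<le> q / r2 * ?\<alpha>" using pos by (simp add: field_simps)
      then show ?thesis using v by linarith
    next
      case False
      \<comment> \<open>Passing from y to y - v adds the a_\<theta>-norm of v. As a_\<theta> is of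
        second order on \<open>V\<^sub>0\<close>, this norm is at most a multiple of |\<theta>|
        \<open>n0 y\<close>, which degeneracy bounds by the a_\<theta>-norm of y.\<close>
      have "(fnorm (a \<theta>) v)\<^sup>2 \<le> (A2 + K2 * norm \<theta>) * (norm \<theta>)\<^sup>2 * n0 v * n0 v"
        using complex_Re_le_cmod[of "a \<theta> v v"] a_V0_bound[OF v(1) v(1) \<theta>]
        unfolding fnorm_square[OF nf_a[OF \<theta>]] diag_def by linarith
      also have "\<dots> = (A2 + K2 * norm \<theta>) * (norm \<theta> * n0 v)\<^sup>2"
        by (simp add: power2_eq_square)
      also have "\<dots> \<le> (A2 + K2 * M) * (norm \<theta> * n0 v)\<^sup>2"
        using M[OF \<theta>] K2_nonneg by (intro mult_right_mono add_mono mult_left_mono) auto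
      also have "\<dots> = (A7 * (norm \<theta> * n0 v))\<^sup>2"
        using A2_nonneg K2_nonneg M_nonneg by (simp add: A7_def power_mult_distrib)
      finally have "fnorm (a \<theta>) v \<le> A7 * (norm \<theta> * n0 v)"
        using pos by (intro power2_le_imp_le[of "fnorm (a \<theta>) v"]) auto
      also have "\<dots> \<le> A7 * (q * ?\<alpha>)"
        using ty mult_left_mono[OF v(3), of "norm \<theta>"] pos by (intro mult_left_mono) auto
      finally have "fnorm (a \<theta>) ?w \<le> (1 + A7 * q) * ?\<alpha>"
        using fnorm_triangle_diff[OF nf_a[OF \<theta>], of y v] by (simp add: algebra_simps)
      then have w2: "diag (a \<theta>) ?w \<le> ((1 + A7 * q) * ?\<alpha>)\<^sup>2"
        unfolding fnorm_square[OF nf_a[OF \<theta>], symmetric]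
        by (intro power_mono fnorm_nonneg[OF nf_a[OF \<theta>]])
      have "diag (a 0) ?w - diag (a \<theta>) ?w \<le> cmod (a \<theta> ?w ?w - a 0 ?w ?w)"
        using complex_Re_le_cmod[of "a 0 ?w ?w - a \<theta> ?w ?w"]
        by (simp add: diag_def norm_minus_commute)
      also have "\<dots> \<le> La * norm \<theta> * n0 ?w * n0 ?w" by (rule a_diff_bound[OF \<theta>])
      also have "\<dots> = (La * norm \<theta>) * (n0 ?w)\<^sup>2" by (simp add: power2_eq_square)
      also have "\<dots> \<le> \<nu> / 2 * (n0 ?w)\<^sup>2"
        using False La_pos by (intro mult_right_mono) (auto simp: r2_def field_simps)
      finally have "\<nu> / 2 * (n0 ?w)\<^sup>2 \<le> ((1 + A7 * q) * ?\<alpha>)\<^sup>2"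
        using gap[OF v(2)] w2 by linarith
      then have "(n0 ?w)\<^sup>2 \<le> 2 / \<nu> * ((1 + A7 * q) * ?\<alpha>)\<^sup>2" using \<nu>_pos by (simp add: field_simps)
      also have "\<dots> = (sqrt (2 / \<nu>) * (1 + A7 * q) * ?\<alpha>)\<^sup>2"
        using \<nu>_pos by (simp add: power_mult_distrib)
      finally have "n0 ?w \<le> sqrt (2 / \<nu>) * (1 + A7 * q) * ?\<alpha>"
        using pos \<alpha> \<nu>_pos by (intro power2_le_imp_le[of "n0 ?w"]) auto
      then show ?thesis ..
    qed
    have "q / r2 * ?\<alpha> \<le> C * ?\<alpha>" "sqrt (2 / \<nu>) * (1 + A7 * q) * ?\<alpha> \<le> C * ?\<alpha>"
      using \<alpha> by (intro mult_right_mono; simp add: C_def)+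
    then show ?thesis using * by linarith
  qed
  then show ?thesis using \<open>C \<ge> 0\<close> by blast
qed

text \<open>Three splittings are combined: w at the parameter \<theta>, then its
  \<open>W_space\<close> part at the parameter 0, then the resulting \<open>V\<^sub>0\<close>
  component along \<open>Vs\<close> and \<open>Z\<close>. Everything taken from the
  \<open>W_space\<close> part is bounded by the a_\<theta>-norm of w, which does not see the kernel
  component of w.\<close>

lemma test_decomposition:
  "\<exists>C\<ge>0. \<forall>\<theta>\<in>\<Theta>. \<forall>w. \<exists>v\<in>V_reg a Vs \<theta>. \<exists>z\<in>Z. \<exists>x. w = v + z + x \<and>
      n0 v \<le> C * nn \<theta> w \<and> n0 z \<le> C * nn \<theta> w \<and>
      norm \<theta> * n0 z \<le> C * fnorm (a \<theta>) w \<and> n0 x \<le> C * fnorm (a \<theta>) w"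
proof -
  obtain CW where CW: "CW \<ge> 0" "\<And>\<theta> y v. \<lbrakk>\<theta> \<in> \<Theta>; y \<in> W_space a b \<theta>; v \<in> V\<^sub>0; y - v \<in> W\<^sub>0; n0 v \<le> n0 y;
      n0 (y - v) \<le> n0 y\<rbrakk> \<Longrightarrow> n0 (y - v) \<le> CW * fnorm (a \<theta>) y"
    using W0_component_bound by blast
  define q where "q = K / sqrt \<gamma>"
  define C1 where "C1 = K + \<kappa> * K + K * (Ls * M) * (\<kappa> * K)"
  define C2 where "C2 = CW + K * Ls * (\<kappa> * q)"
  define C where "C = \<kappa> + \<kappa> * K + \<kappa> * q + C1 + C2"
  have q: "q > 0" using K_pos \<gamma>_pos by (simp add: q_def)
  have nonneg: "0 \<le> \<kappa>" "0 \<le> \<kappa> * K" "0 \<le> \<kappa> * q" "0 \<le> C1" "0 \<le> C2"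
    using \<kappa>_pos K_pos q Ls_nonneg M_nonneg CW(1) by (auto simp: C1_def C2_def)
  have C: "C \<ge> 0" "\<kappa> \<le> C" "\<kappa> * K \<le> C" "\<kappa> * q \<le> C" "C1 \<le> C" "C2 \<le> C" "CW \<le> C"
    using nonneg K_pos q Ls_nonneg \<kappa>_pos by (auto simp: C_def C2_def)
  have "\<exists>v\<in>V_reg a Vs \<theta>. \<exists>z\<in>Z. \<exists>x. w = v + z + x \<and>
      n0 v \<le> C * nn \<theta> w \<and> n0 z \<le> C * nn \<theta> w \<and>
      norm \<theta> * n0 z \<le> C * fnorm (a \<theta>) w \<and> n0 x \<le> C * fnorm (a \<theta>) w" if \<theta>: "\<theta> \<in> \<Theta>" for \<theta> w
  proof -
    obtain p where p: "p \<in> V_space a \<theta>" "w - p \<in> W_space a b \<theta>" "nn \<theta> p \<le> nn \<theta> w"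
        "nn \<theta> (w - p) \<le> nn \<theta> w"
      using V_W_decomposition[OF \<theta>] by blast
    define y where "y = w - p"
    have nw: "nn \<theta> w \<ge> 0" by (rule nn_nonneg[OF \<theta>])
    have \<alpha>: "fnorm (a \<theta>) w \<ge> 0" by (rule fnorm_nonneg[OF nf_a[OF \<theta>]])
    have y\<alpha>: "fnorm (a \<theta>) y = fnorm (a \<theta>) w"
      unfolding y_def fnorm_def by (simp add: diag_a_add_V \<theta> p)
    show ?thesis
    \<comment> \<open>At 0 the space \<open>V_reg\<close> is \<open>Vs\<close>, so the kernel
      component itself has to be split along \<open>Vs\<close> and \<open>Z\<close>. For other
      \<theta> it already lies in \<open>V_reg\<close> and stays whole.\<close>
    proof (cases "\<theta> = 0")
      case True
      have "p \<in> V\<^sub>0" using p(1) True by simp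
      then obtain v z where vz: "v \<in> Vs" "z \<in> Z" "p = v + z"
        unfolding V0 by blast
      have "n0 v \<le> \<kappa> * n0 p" "n0 z \<le> \<kappa> * n0 p" using sum_lower[OF vz(1,2)] vz by auto
      moreover have "\<kappa> * n0 p \<le> C * n0 w"
        using p(3) True C \<kappa>_pos by (intro mult_mono) auto
      moreover have "n0 y \<le> CW * fnorm (a 0) y"
        using CW(2)[OF zero_in, of y 0] p(2) V_csubspace[OF zero_in] True
          fnorm_zero[OF nf_ip[OF zero_in]] by (simp add: y_def csubspace_def)
      moreover have "CW * fnorm (a 0) y \<le> C * fnorm (a 0) w"
        using C \<alpha> True y\<alpha> by (simp add: mult_right_mono)
      ultimately have "n0 v \<le> C * n0 w" "n0 z \<le> C * n0 w" "n0 y \<le> C * fnorm (a 0) w" by linarith+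
      moreover have "w = v + z + y" using vz by (simp add: y_def)
      moreover have "norm \<theta> * n0 z \<le> C * fnorm (a \<theta>) w" using True C \<alpha> by simp
      ultimately show ?thesis using vz True by (auto simp: V_reg_def)
    next
      case False
      have yW: "y \<in> W_space a b \<theta>" using p by (simp add: y_def)
      have yn: "n0 y \<le> K * nn \<theta> w"
        unfolding y_def by (rule order_trans[OF n0_le[OF \<theta>] mult_left_mono[OF p(4)]]) (use K_pos in simp)
      have ty: "norm \<theta> * n0 y \<le> q * fnorm (a \<theta>) w"
        using W_bound[OF \<theta> yW] y\<alpha> by (simp add: q_def)
      obtain v0 where v0: "v0 \<in> V\<^sub>0" "y - v0 \<in> W\<^sub>0" "n0 v0 \<le> n0 y" "n0 (y - v0) \<le> n0 y"
        using V_W_decomposition[OF zero_in] by blast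
      obtain v1 z where vz: "v1 \<in> Vs" "z \<in> Z" "v0 = v1 + z"
        using v0(1) unfolding V0 by blast
      have "n0 v1 \<le> \<kappa> * n0 v0" "n0 z \<le> \<kappa> * n0 v0" using sum_lower[OF vz(1,2)] vz by auto
      moreover have "\<kappa> * n0 v0 \<le> \<kappa> * n0 y" using v0(3) \<kappa>_pos by simp
      ultimately have v1y: "n0 v1 \<le> \<kappa> * n0 y" and zy: "n0 z \<le> \<kappa> * n0 y" by linarith+
      have "\<kappa> * n0 y \<le> \<kappa> * (K * nn \<theta> w)" using yn \<kappa>_pos by simp
      then have v1w: "n0 v1 \<le> \<kappa> * K * nn \<theta> w" and zw: "n0 z \<le> \<kappa> * K * nn \<theta> w"
        using v1y zy by (simp_all add: mult.assoc)
      have "norm \<theta> * (\<kappa> * n0 y) \<le> \<kappa> * (q * fnorm (a \<theta>) w)"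
        using mult_left_mono[OF ty, of \<kappa>] \<kappa>_pos by (simp add: mult_ac)
      then have tv1: "norm \<theta> * n0 v1 \<le> \<kappa> * q * fnorm (a \<theta>) w"
        and tz: "norm \<theta> * n0 z \<le> \<kappa> * q * fnorm (a \<theta>) w"
        using mult_left_mono[OF v1y, of "norm \<theta>"] mult_left_mono[OF zy, of "norm \<theta>"]
        unfolding mult.assoc by (auto intro: order_trans)
      obtain v' where v': "v' \<in> V_reg a Vs \<theta>" "nn \<theta> (v1 - v') \<le> Ls * norm \<theta> * n0 v1"
        using removable[OF zero_in \<theta>, of v1] vz(1) by (auto simp: V_reg_def)
      have d: "n0 (v1 - v') \<le> K * Ls * (norm \<theta> * n0 v1)"
        using order_trans[OF n0_le[OF \<theta>] mult_left_mono[OF v'(2), of K]] K_pos by (simp add: mult_ac)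
      \<comment> \<open>\<open>v1\<close> lies in \<open>Vs\<close> and must be exchanged for a
        vector \<open>v'\<close> of the kernel at \<theta>. The price is of order |\<theta>|
        \<open>n0 v1\<close>, hence of order of the a_\<theta>-norm of w, so the difference can join
        the remainder.\<close>
      define x where "x = (y - v0) + (v1 - v')"
      have "n0 x \<le> n0 (y - v0) + n0 (v1 - v')" unfolding x_def by (rule n0_triangle)
      also have "n0 (y - v0) \<le> CW * fnorm (a \<theta>) w" using CW(2)[OF \<theta> yW v0] y\<alpha> by simp
      also have "n0 (v1 - v') \<le> K * Ls * (\<kappa> * q * fnorm (a \<theta>) w)"
        by (rule order_trans[OF d mult_left_mono[OF tv1]]) (use K_pos Ls_nonneg in simp)
      finally have "n0 x \<le> C2 * fnorm (a \<theta>) w" by (simp add: C2_def algebra_simps)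
      then have x: "n0 x \<le> C * fnorm (a \<theta>) w" using mult_right_mono[OF C(6) \<alpha>] by linarith
      have "K * Ls * (norm \<theta> * n0 v1) \<le> K * Ls * (M * (\<kappa> * K * nn \<theta> w))"
        using M[OF \<theta>] v1w K_pos Ls_nonneg M_nonneg by (intro mult_left_mono mult_mono) auto
      then have "n0 (v1 - v') \<le> K * (Ls * M) * (\<kappa> * K) * nn \<theta> w" using d by (simp add: mult_ac)
      moreover have "n0 p \<le> K * nn \<theta> w"
        by (rule order_trans[OF n0_le[OF \<theta>] mult_left_mono[OF p(3)]]) (use K_pos in simp)
      moreover have "n0 (p + v') \<le> n0 p + (n0 v1 + n0 (v1 - v'))"
        using n0_triangle[of p v'] n0_triangle_diff[of v1 "v1 - v'"] by simp
      ultimately have "n0 (p + v') \<le> K * nn \<theta> w + \<kappa> * K * nn \<theta> w + K * (Ls * M) * (\<kappa> * K) * nn \<theta> w"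
        using v1w by linarith
      then have "n0 (p + v') \<le> C1 * nn \<theta> w" by (simp only: C1_def distrib_right)
      then have pv: "n0 (p + v') \<le> C * nn \<theta> w" using mult_right_mono[OF C(5) nw] by linarith
      have "p \<in> V_reg a Vs \<theta>" using p(1) False by (simp add: V_reg_def)
      then have "p + v' \<in> V_reg a Vs \<theta>"
        using v'(1) V_reg_csubspace[OF \<theta>] by (simp add: csubspace_def)
      moreover have "w = (p + v') + z + x" by (simp add: x_def y_def vz)
      moreover have "n0 z \<le> C * nn \<theta> w" using zw mult_right_mono[OF C(3) nw] by linarith
      moreover have "norm \<theta> * n0 z \<le> C * fnorm (a \<theta>) w" using tz mult_right_mono[OF C(4) \<alpha>] by linarith
      ultimately show ?thesis using vz(2) x pv by blast
    qed
  qed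
  then show ?thesis using C(1) by blast
qed

end

section \<open>The limit problem\<close>

context degenerate_family
begin

abbreviation "S \<equiv> limit_form a b a' a''"

lemma limit_form_Pair: "S \<xi> (v, z) (v', z') = hom \<xi> z z' + b 0 (v + z) (v' + z')"
  by (simp add: limit_form_def)

lemma Vs_Z_in_V0: "\<lbrakk>v \<in> Vs; z \<in> Z\<rbrakk> \<Longrightarrow> v + z \<in> V\<^sub>0"
  unfolding V0 by blast

lemma limit_form_add_left:
  assumes "p \<in> Vs \<times> Z" "p' \<in> Vs \<times> Z" "q \<in> Vs \<times> Z"
  shows "S \<xi> (p + p') q = S \<xi> p q + S \<xi> p' q"
proof -
  have eq: "fst p + fst p' + (snd p + snd p') = (fst p + snd p) + (fst p' + snd p')"
    by (simp add: algebra_simps)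
  have "snd p \<in> V\<^sub>0" "snd p' \<in> V\<^sub>0" "snd q \<in> V\<^sub>0"
    using assms Z_subset by auto
  then show ?thesis
    by (simp add: limit_form_def eq hom_linear b_linear zero_in)
qed

lemma limit_form_scaleR_left:
  assumes "p \<in> Vs \<times> Z" "q \<in> Vs \<times> Z"
  shows "S \<xi> (t *\<^sub>R p) q = complex_of_real t * S \<xi> p q"
proof -
  have eq: "t *\<^sub>R fst p + t *\<^sub>R snd p = t *\<^sub>R (fst p + snd p)"
    by (simp add: algebra_simps)
  have V: "snd p \<in> V\<^sub>0" "snd q \<in> V\<^sub>0"
    using assms Z_subset by auto
  then have "hom \<xi> (t *\<^sub>R snd p) (snd q) = complex_of_real t * hom \<xi> (snd p) (snd q)"
    unfolding scaleR_scaleC by (rule hom_linear(2))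
  then show ?thesis
    by (simp add: limit_form_def eq b_linear zero_in distrib_left)
qed

lemma limit_form_commute:
  assumes "p \<in> Vs \<times> Z" "q \<in> Vs \<times> Z"
  shows "S \<xi> p q = cnj (S \<xi> q p)"
proof -
  have "snd p \<in> V\<^sub>0" "snd q \<in> V\<^sub>0"
    using assms Z_subset by auto
  then show ?thesis
    unfolding limit_form_def complex_cnj_add
    using hom_commute nonneg_form_commute[OF nf_b[OF zero_in]] by metis
qed

lemma limit_form_bound:
  assumes "v \<in> Vs" "z \<in> Z" "v' \<in> Vs" "z' \<in> Z"
  shows "cmod (S \<xi> (v, z) (v', z')) \<le>
    ((A2 + A3\<^sup>2) * (norm \<xi>)\<^sup>2 + K\<^sup>2) * (n0 v + n0 z) * (n0 v' + n0 z')"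
proof -
  have "z \<in> V\<^sub>0" "z' \<in> V\<^sub>0" using assms Z_subset by auto
  then have "cmod (hom \<xi> z z') \<le> (A2 + A3\<^sup>2) * (norm \<xi>)\<^sup>2 * (n0 z * n0 z')"
    using hom_bound[of z z' \<xi>] by (simp add: mult.assoc)
  also have "\<dots> \<le> (A2 + A3\<^sup>2) * (norm \<xi>)\<^sup>2 * ((n0 v + n0 z) * (n0 v' + n0 z'))"
    using A2_nonneg by (intro mult_left_mono mult_mono) auto
  finally have 1: "cmod (hom \<xi> z z') \<le> (A2 + A3\<^sup>2) * (norm \<xi>)\<^sup>2 * ((n0 v + n0 z) * (n0 v' + n0 z'))" .
  have "cmod (b 0 (v + z) (v' + z')) \<le> K\<^sup>2 * (n0 (v + z) * n0 (v' + z'))"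
    using b_bound[OF zero_in] by (simp add: mult.assoc)
  also have "\<dots> \<le> K\<^sup>2 * ((n0 v + n0 z) * (n0 v' + n0 z'))"
    by (intro mult_left_mono mult_mono n0_triangle) auto
  finally have 2: "cmod (b 0 (v + z) (v' + z')) \<le> K\<^sup>2 * ((n0 v + n0 z) * (n0 v' + n0 z'))" .
  show ?thesis
    unfolding limit_form_Pair
    using 1 2 norm_triangle_ineq[of "hom \<xi> z z'" "b 0 (v + z) (v' + z')"]
    by (simp add: distrib_right mult.assoc)
qed

text \<open>On \<open>V\<^sub>0\<close> the form a_0 vanishes, so the b_0 part is exactly the
  squared norm of v + z. The first term is what makes |\<xi>| \<open>n0 z\<close>
  controllable.\<close>

lemma limit_form_coercive:
  assumes "v \<in> Vs" "z \<in> Z"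
  shows "c0 * (norm \<xi>)\<^sup>2 * (n0 z)\<^sup>2 + (n0 (v + z))\<^sup>2 \<le> Re (S \<xi> (v, z) (v, z))"
proof -
  have "(n0 (v + z))\<^sup>2 = Re (b 0 (v + z) (v + z))"
    unfolding n0_b[OF Vs_Z_in_V0[OF assms]] fnorm_square[OF nf_b[OF zero_in]] by (simp add: diag_def)
  then show ?thesis
    using hom_coercive[OF assms(2), of \<xi>] by (simp add: limit_form_Pair)
qed

text \<open>The functional is left abstract because two right-hand sides occur later: one
  transported by \<open>E\<close> and one given by the inner product of the ambient space. Pairs
  carry no complex scalar multiplication, so antilinearity is stated componentwise.\<close>

lemma limit_problem_solvable:
  assumes g_add: "\<And>p q. \<lbrakk>p \<in> Vs \<times> Z; q \<in> Vs \<times> Z\<rbrakk> \<Longrightarrow> g (p + q) = g p + g q"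
    and g_scale: "\<And>c v z. \<lbrakk>v \<in> Vs; z \<in> Z\<rbrakk> \<Longrightarrow> g (c *\<^sub>C v, c *\<^sub>C z) = cnj c * g (v, z)"
    and g_bound: "\<And>v z. \<lbrakk>v \<in> Vs; z \<in> Z\<rbrakk> \<Longrightarrow> cmod (g (v, z)) \<le> F * (n0 v + n0 z)" and F: "0 \<le> F"
  shows "\<exists>!p. p \<in> Vs \<times> Z \<and> (\<forall>v\<in>Vs. \<forall>z\<in>Z. S \<xi> p (v, z) = g (v, z))"
proof (rule ex_ex1I)
  obtain C where C: "C > 0" "\<And>u. n0 u \<le> C * norm u" "\<And>u. norm u \<le> C * n0 u"
    using norm_compare[OF zero_in] by blast
  have sum_le: "n0 v + n0 z \<le> 2 * C * norm (v, z)" for v z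
  proof -
    have "n0 v \<le> C * norm (v, z)"
      using C(1) by (intro order_trans[OF C(2)] mult_left_mono norm_fst_le) simp
    moreover have "n0 z \<le> C * norm (v, z)"
      using C(1) by (intro order_trans[OF C(2)] mult_left_mono norm_snd_le) simp
    ultimately show ?thesis by simp
  qed
  have le_sum: "norm (v, z) \<le> 2 * C * \<kappa> * n0 (v + z)" if "v \<in> Vs" "z \<in> Z" for v z
  proof -
    have "norm (v, z) \<le> norm v + norm z" by (rule norm_Pair_le)
    also have "\<dots> \<le> C * (\<kappa> * n0 (v + z)) + C * (\<kappa> * n0 (v + z))"
      using C(1) by (intro add_mono order_trans[OF C(3)] mult_left_mono sum_lower that) auto
    finally show ?thesis by (simp add: mult_ac)
  qed
  define B where "B = (A2 + A3\<^sup>2) * (norm \<xi>)\<^sup>2 + K\<^sup>2"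
  have B: "B \<ge> 0" using A2_nonneg by (simp add: B_def)
  have D: "subspace (Vs \<times> Z)"
    using Vs Z csubspace_imp_subspace by (auto simp: subspace_def csubspace_def scaleR_scaleC zero_prod_def)
  have "\<exists>p\<in>Vs \<times> Z. \<forall>q\<in>Vs \<times> Z. S \<xi> p q = g q"
  proof (rule coercive_form_representation[where C = "B * (2 * C)\<^sup>2"
        and c = "1 / (2 * C * \<kappa>)\<^sup>2" and F = "F * (2 * C)" and I = "\<lambda>p. (\<i> *\<^sub>C fst p, \<i> *\<^sub>C snd p)"])
    show "subspace (Vs \<times> Z)" by (rule D)
    show "closed (Vs \<times> Z)" using Vs Z by (simp add: closed_Times)
    show "cmod (S \<xi> p q) \<le> B * (2 * C)\<^sup>2 * norm p * norm q" if pq: "p \<in> Vs \<times> Z" "q \<in> Vs \<times> Z" for p q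
    proof -
      obtain v z v' z' where e: "p = (v, z)" "q = (v', z')" by fastforce
      have "cmod (S \<xi> p q) \<le> B * ((n0 v + n0 z) * (n0 v' + n0 z'))"
        using limit_form_bound pq unfolding e B_def by (simp add: mult.assoc)
      also have "\<dots> \<le> B * ((2 * C * norm p) * (2 * C * norm q))"
        unfolding e using B C(1) by (intro mult_left_mono mult_mono sum_le) auto
      finally show ?thesis by (simp add: power2_eq_square mult_ac)
    qed
    show "1 / (2 * C * \<kappa>)\<^sup>2 * (norm p)\<^sup>2 \<le> Re (S \<xi> p p)" if p: "p \<in> Vs \<times> Z" for p
    proof -
      obtain v z where e: "p = (v, z)" by fastforce
      have vz: "v \<in> Vs" "z \<in> Z" using p e by auto
      have "(norm p)\<^sup>2 \<le> (2 * C * \<kappa> * n0 (v + z))\<^sup>2"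
        unfolding e by (intro power_mono le_sum vz) auto
      then have "1 / (2 * C * \<kappa>)\<^sup>2 * (norm p)\<^sup>2 \<le> (n0 (v + z))\<^sup>2"
        using C(1) \<kappa>_pos by (simp add: power_mult_distrib field_simps)
      also have "\<dots> \<le> c0 * (norm \<xi>)\<^sup>2 * (n0 z)\<^sup>2 + (n0 (v + z))\<^sup>2"
        using c0_pos by simp
      also have "\<dots> \<le> Re (S \<xi> p p)" unfolding e by (rule limit_form_coercive[OF vz])
      finally show ?thesis .
    qed
    show "1 / (2 * C * \<kappa>)\<^sup>2 > 0" using C(1) \<kappa>_pos by simp
    show "g (p + q) = g p + g q" if "p \<in> Vs \<times> Z" "q \<in> Vs \<times> Z" for p q by (rule g_add[OF that])
    show "g (t *\<^sub>R p) = complex_of_real t * g p" if "p \<in> Vs \<times> Z" for t p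
      using g_scale[of "fst p" "snd p" "complex_of_real t"] that
      by (auto simp: scaleR_prod_def scaleR_scaleC)
    show "cmod (g p) \<le> F * (2 * C) * norm p" if "p \<in> Vs \<times> Z" for p
    proof -
      obtain v z where e: "p = (v, z)" by fastforce
      have "cmod (g p) \<le> F * (n0 v + n0 z)" using g_bound that e by simp
      also have "\<dots> \<le> F * (2 * C * norm p)" unfolding e by (intro mult_left_mono sum_le F)
      finally show ?thesis by (simp add: mult_ac)
    qed
    show "(\<i> *\<^sub>C fst p, \<i> *\<^sub>C snd p) \<in> Vs \<times> Z" if "p \<in> Vs \<times> Z" for p
      using that Vs Z by (auto simp: csubspace_def)
    show "S \<xi> p (\<i> *\<^sub>C fst q, \<i> *\<^sub>C snd q) = - \<i> * S \<xi> p q" if "p \<in> Vs \<times> Z" "q \<in> Vs \<times> Z" for p q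
    proof -
      have "snd p \<in> V\<^sub>0" "snd q \<in> V\<^sub>0" using that Z_subset by auto
      then show ?thesis
        by (simp add: limit_form_def hom_linear(4) flip: scaleC_add_right)
          (simp add: b_linear zero_in algebra_simps)
    qed
    show "g (\<i> *\<^sub>C fst q, \<i> *\<^sub>C snd q) = - \<i> * g q" if "q \<in> Vs \<times> Z" for q
      using g_scale[of "fst q" "snd q" \<i>] that by auto
  qed (intro limit_form_add_left limit_form_scaleR_left limit_form_commute; assumption)+
  then show "\<exists>p. p \<in> Vs \<times> Z \<and> (\<forall>v\<in>Vs. \<forall>z\<in>Z. S \<xi> p (v, z) = g (v, z))" by blast
next
  fix p q
  assume p: "p \<in> Vs \<times> Z \<and> (\<forall>v\<in>Vs. \<forall>z\<in>Z. S \<xi> p (v, z) = g (v, z))"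
    and q: "q \<in> Vs \<times> Z \<and> (\<forall>v\<in>Vs. \<forall>z\<in>Z. S \<xi> q (v, z) = g (v, z))"
  have D: "subspace (Vs \<times> Z)"
    using Vs Z csubspace_imp_subspace by (auto simp: subspace_def csubspace_def scaleR_scaleC zero_prod_def)
  define d where "d = p - q"
  have d: "d \<in> Vs \<times> Z" "p = q + d" using p q D by (auto simp: d_def intro: subspace_diff)
  have "S \<xi> d d = S \<xi> p d - S \<xi> q d"
    unfolding d(2) using limit_form_add_left[of q d d] q d(1) by simp
  also have "\<dots> = 0" using p q d(1) by (cases d) auto
  finally have "Re (S \<xi> d d) = 0" by simp
  then have "c0 * (norm \<xi>)\<^sup>2 * (n0 (snd d))\<^sup>2 + (n0 (fst d + snd d))\<^sup>2 \<le> 0"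
    using limit_form_coercive[of "fst d" "snd d" \<xi>] d(1) by auto
  then have "(n0 (fst d + snd d))\<^sup>2 \<le> 0"
    using c0_pos zero_le_mult_iff by (smt (verit) mult_nonneg_nonneg zero_le_power2)
  then have "n0 (fst d) \<le> 0" "n0 (snd d) \<le> 0"
    using sum_lower[of "fst d" "snd d"] d(1) by auto
  then have "n0 (fst d) = 0" "n0 (snd d) = 0"
    by (metis antisym n0_nonneg)+
  then have "d = 0" using nn_eq_0[OF zero_in] by (simp add: prod_eq_iff)
  then show "p = q" by (simp add: d_def)
qed

text \<open>The solution as its own test vector gives the energy bound, from which the first three
  estimates follow. The factor 1 + K in the hypothesis on \<open>g\<close> is the one that a
  functional transported by \<open>E\<close> acquires.\<close>

lemma limit_estimate:
  "\<exists>C\<ge>0. \<forall>\<xi> g D. \<forall>v\<in>Vs. \<forall>z\<in>Z. 0 \<le> D \<longrightarrow>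
    (\<forall>v'\<in>Vs. \<forall>z'\<in>Z. S \<xi> (v, z) (v', z') = g v' z') \<longrightarrow>
    (\<forall>v'\<in>Vs. \<forall>z'\<in>Z. cmod (g v' z') \<le> D * ((1 + K) * (n0 v' + n0 z'))) \<longrightarrow>
    n0 v \<le> C * D \<and> n0 z \<le> C * D \<and> norm \<xi> * n0 z \<le> C * D \<and> (norm \<xi>)\<^sup>2 * n0 z \<le> C * D"
proof -
  define C1 where "C1 = 2 * \<kappa> * (1 + K)"
  define C2 where "C2 = C1 / sqrt c0"
  define C3 where "C3 = (1 + K + C1) / c0"
  define C where "C = \<kappa> * C1 + C2 + C3"
  have pos: "C1 \<ge> 0" "C2 \<ge> 0" "C3 \<ge> 0" "\<kappa> * C1 \<ge> 0"
    using \<kappa>_pos K_pos c0_pos by (simp_all add: C1_def C2_def C3_def)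
  have "n0 v \<le> C * D \<and> n0 z \<le> C * D \<and> norm \<xi> * n0 z \<le> C * D \<and> (norm \<xi>)\<^sup>2 * n0 z \<le> C * D"
    if v: "v \<in> Vs" and z: "z \<in> Z" and D: "0 \<le> D"
      and sol: "\<forall>v'\<in>Vs. \<forall>z'\<in>Z. S \<xi> (v, z) (v', z') = g v' z'"
      and g: "\<forall>v'\<in>Vs. \<forall>z'\<in>Z. cmod (g v' z') \<le> D * ((1 + K) * (n0 v' + n0 z'))" for \<xi> g D v z
  proof -
    let ?s = "n0 (v + z)"
    have "n0 v + n0 z \<le> 2 * \<kappa> * ?s" using sum_lower[OF v z] by simp
    then have "D * ((1 + K) * (n0 v + n0 z)) \<le> D * ((1 + K) * (2 * \<kappa> * ?s))"
      using D K_pos by (intro mult_left_mono) auto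
    then have "cmod (g v z) \<le> D * ((1 + K) * (2 * \<kappa> * ?s))"
      by (rule order_trans[OF g[rule_format, OF v z]])
    then have "cmod (g v z) \<le> C1 * D * ?s" by (simp only: C1_def mult_ac)
    moreover have "c0 * (norm \<xi>)\<^sup>2 * (n0 z)\<^sup>2 + ?s\<^sup>2 \<le> cmod (g v z)"
      using order_trans[OF limit_form_coercive[OF v z, of \<xi>] complex_Re_le_cmod]
      unfolding sol[rule_format, OF v z] .
    ultimately have en: "c0 * (norm \<xi>)\<^sup>2 * (n0 z)\<^sup>2 + ?s\<^sup>2 \<le> C1 * D * ?s" by linarith
    have nn: "0 \<le> c0 * (norm \<xi>)\<^sup>2 * (n0 z)\<^sup>2" using c0_pos by simp
    have s: "?s \<le> C1 * D"
      by (rule le_if_power2_le_mult) (use en nn pos D in auto)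
    have "n0 v \<le> \<kappa> * (C1 * D)" "n0 z \<le> \<kappa> * (C1 * D)"
      using \<kappa>_pos by (intro order_trans[OF sum_lower(1)[OF v z]] order_trans[OF sum_lower(2)[OF v z]]
          mult_left_mono s; simp)+
    moreover have "norm \<xi> * n0 z \<le> C2 * D"
    proof (rule power2_le_imp_le)
      have "c0 * (norm \<xi>)\<^sup>2 * (n0 z)\<^sup>2 \<le> C1 * D * (C1 * D)"
      proof (rule order_trans)
        show "c0 * (norm \<xi>)\<^sup>2 * (n0 z)\<^sup>2 \<le> C1 * D * ?s"
          using en zero_le_power2[of ?s] by linarith
        show "C1 * D * ?s \<le> C1 * D * (C1 * D)" using pos D by (intro mult_left_mono s) simp
      qed
      then show "(norm \<xi> * n0 z)\<^sup>2 \<le> (C2 * D)\<^sup>2"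
        using c0_pos by (simp add: C2_def power_mult_distrib power_divide field_simps power2_eq_square)
    qed (use pos D in simp)
    moreover have "(norm \<xi>)\<^sup>2 * n0 z \<le> C3 * D"
    proof -
      \<comment> \<open>Testing with (0, z) makes every term carry a factor \<open>n0 z\<close>,
        which can be divided out; this gains the second power of |\<xi>|.\<close>
      have V0: "0 \<in> Vs" using Vs by (simp add: csubspace_def)
      have "c0 * (norm \<xi>)\<^sup>2 * (n0 z)\<^sup>2 \<le> Re (hom \<xi> z z)" by (rule hom_coercive[OF z])
      also have "hom \<xi> z z = g 0 z - b 0 (v + z) z"
        using sol[rule_format, OF V0 z] by (simp add: limit_form_Pair eq_diff_eq)
      also have "Re (g 0 z - b 0 (v + z) z) \<le> cmod (g 0 z) + cmod (b 0 (v + z) z)"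
        by (rule order_trans[OF complex_Re_le_cmod norm_triangle_ineq4])
      also have "\<dots> \<le> D * ((1 + K) * n0 z) + C1 * D * n0 z"
      proof (rule add_mono)
        show "cmod (g 0 z) \<le> D * ((1 + K) * n0 z)"
          using g[rule_format, OF V0 z] fnorm_zero[OF nf_ip[OF zero_in]] by simp
        show "cmod (b 0 (v + z) z) \<le> C1 * D * n0 z"
          by (rule order_trans[OF b_le_nn[OF zero_in] mult_right_mono[OF s]]) simp
      qed
      also have "\<dots> = (1 + K + C1) * D * n0 z" by (simp add: algebra_simps)
      finally have "c0 * (norm \<xi>)\<^sup>2 * (n0 z)\<^sup>2 \<le> (1 + K + C1) * D * n0 z" .
      then have "((norm \<xi>)\<^sup>2 * n0 z) * n0 z \<le> (C3 * D) * n0 z"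
        using c0_pos by (simp add: C3_def field_simps power2_eq_square)
      then show ?thesis
        using pos D n0_nonneg[of z] by (cases "n0 z = 0") auto
    qed
    moreover have "\<kappa> * (C1 * D) \<le> C * D" "C2 * D \<le> C * D" "C3 * D \<le> C * D"
      unfolding mult.assoc[symmetric] using pos D by (intro mult_right_mono; simp add: C_def)+
    ultimately show ?thesis by linarith
  qed
  moreover have "C \<ge> 0" using pos by (simp add: C_def)
  ultimately show ?thesis by blast
qed

section \<open>The full problem and its energy norm\<close>

lemma nf_full: "\<theta> \<in> \<Theta> \<Longrightarrow> nonneg_form (full_form a b \<epsilon> \<theta>)"
  by (intro full_form_nonneg nf_a nf_b)

lemma diag_full: "diag (full_form a b \<epsilon> \<theta>) u = diag (a \<theta>) u / \<epsilon>\<^sup>2 + diag (b \<theta>) u"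
  by (simp add: diag_def full_form_def)

text \<open>The second bound is the source of the rate: whatever part of a test vector is controlled
  by a_\<theta> is of order \<epsilon> in the energy norm.\<close>

lemma fnorm_le_full:
  assumes \<theta>: "\<theta> \<in> \<Theta>" and \<epsilon>: "0 < \<epsilon>" "\<epsilon> < 1"
  shows "fnorm (b \<theta>) w \<le> fnorm (full_form a b \<epsilon> \<theta>) w"
    and "fnorm (a \<theta>) w \<le> \<epsilon> * fnorm (full_form a b \<epsilon> \<theta>) w"
    and "nn \<theta> w \<le> fnorm (full_form a b \<epsilon> \<theta>) w"
proof -
  have a: "0 \<le> diag (a \<theta>) w" and b: "0 \<le> diag (b \<theta>) w"
    by (intro nonneg_form_diag_nonneg nf_a nf_b \<theta>)+
  show "fnorm (b \<theta>) w \<le> fnorm (full_form a b \<epsilon> \<theta>) w"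
    unfolding fnorm_def diag_full using a by simp
  have "\<epsilon>\<^sup>2 \<le> 1" using \<epsilon> by (simp add: power_le_one)
  then have "diag (a \<theta>) w \<le> diag (a \<theta>) w / \<epsilon>\<^sup>2"
    using a \<epsilon> by (simp add: le_divide_eq mult_left_le)
  then show "nn \<theta> w \<le> fnorm (full_form a b \<epsilon> \<theta>) w"
    unfolding fnorm_def diag_full diag_ip by simp
  show "fnorm (a \<theta>) w \<le> \<epsilon> * fnorm (full_form a b \<epsilon> \<theta>) w"
  proof (rule power2_le_imp_le)
    show "(fnorm (a \<theta>) w)\<^sup>2 \<le> (\<epsilon> * fnorm (full_form a b \<epsilon> \<theta>) w)\<^sup>2"
      using b \<epsilon> by (simp add: power_mult_distrib fnorm_square[OF nf_a[OF \<theta>]]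
          fnorm_square[OF nf_full[OF \<theta>]] diag_full distrib_left)
    show "0 \<le> \<epsilon> * fnorm (full_form a b \<epsilon> \<theta>) w"
      using \<epsilon> fnorm_nonneg[OF nf_full[OF \<theta>]] by simp
  qed
qed

lemma full_problem_solvable:
  assumes \<theta>: "\<theta> \<in> \<Theta>" and \<epsilon>: "0 < \<epsilon>" "\<epsilon> < 1" and f: "f \<in> antidual"
  shows "\<exists>!u. solves_full a b \<epsilon> \<theta> f u"
proof (rule ex_ex1I)
  let ?s = "full_form a b \<epsilon> \<theta>"
  note nf = nf_full[OF \<theta>, of \<epsilon>]
  obtain C where C: "C > 0" "\<And>u. nn \<theta> u \<le> C * norm u" "\<And>u. norm u \<le> C * nn \<theta> u"
    using norm_compare[OF \<theta>] by blast
  obtain F where F: "F \<ge> 0" "\<And>u. cmod (f u) \<le> F * norm u"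
    using antidual_bounded[OF f] by blast
  have f_add: "f (u + w) = f u + f w" and f_scale: "f (c *\<^sub>C u) = cnj c * f u" for u w c
    using f by (auto simp: antidual_def)
  have "\<exists>u\<in>UNIV. \<forall>w\<in>UNIV. ?s u w = f w"
  proof (rule coercive_form_representation[where C = "(1 / \<epsilon>\<^sup>2 + 1) * C\<^sup>2"
        and c = "1 / C\<^sup>2" and F = F and I = "\<lambda>w. \<i> *\<^sub>C w"])
    show "cmod (?s u w) \<le> (1 / \<epsilon>\<^sup>2 + 1) * C\<^sup>2 * norm u * norm w" for u w
    proof -
      have "cmod (?s u w) \<le> 1 / \<epsilon>\<^sup>2 * cmod (a \<theta> u w) + cmod (b \<theta> u w)"
        unfolding full_form_def by (rule order_trans[OF norm_triangle_ineq]) (simp add: norm_divide norm_power)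
      also have "\<dots> \<le> 1 / \<epsilon>\<^sup>2 * (nn \<theta> u * nn \<theta> w) + nn \<theta> u * nn \<theta> w"
        by (intro add_mono mult_left_mono a_le_nn b_le_nn \<theta>) auto
      also have "\<dots> = (1 / \<epsilon>\<^sup>2 + 1) * (nn \<theta> u * nn \<theta> w)" by (simp add: algebra_simps)
      also have "\<dots> \<le> (1 / \<epsilon>\<^sup>2 + 1) * ((C * norm u) * (C * norm w))"
        using C(1) by (intro mult_left_mono mult_mono C nn_nonneg \<theta>) auto
      finally show ?thesis by (simp add: power2_eq_square mult_ac)
    qed
    show "1 / C\<^sup>2 * (norm u)\<^sup>2 \<le> Re (?s u u)" for u
    proof -
      have "(norm u)\<^sup>2 \<le> (C * nn \<theta> u)\<^sup>2" by (intro power_mono C) auto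
      then have "1 / C\<^sup>2 * (norm u)\<^sup>2 \<le> (nn \<theta> u)\<^sup>2"
        using C(1) by (simp add: power_mult_distrib field_simps)
      also have "\<dots> \<le> (fnorm ?s u)\<^sup>2"
        by (intro power_mono fnorm_le_full nn_nonneg \<theta> \<epsilon>)
      finally show ?thesis by (simp add: fnorm_square[OF nf] diag_def)
    qed
    show "?s u w = cnj (?s w u)" for u w by (rule nonneg_form_commute[OF nf])
    show "f (t *\<^sub>R u) = complex_of_real t * f u" for t u
      by (simp add: scaleR_scaleC f_scale)
  qed (use C F f_add f_scale in \<open>auto simp: nonneg_form_add_left[OF nf] nonneg_form_scaleR_left[OF nf]
      nonneg_form_scaleC_right[OF nf]\<close>)
  then show "\<exists>u. solves_full a b \<epsilon> \<theta> f u" by (simp add: solves_full_def)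
next
  fix u u' assume "solves_full a b \<epsilon> \<theta> f u" "solves_full a b \<epsilon> \<theta> f u'"
  then have "full_form a b \<epsilon> \<theta> (u - u') (u - u') = 0"
    by (subst nonneg_form_diff_left[OF nf_full[OF \<theta>]]) (simp add: solves_full_def)
  then have "fnorm (full_form a b \<epsilon> \<theta>) (u - u') = 0" by (simp add: fnorm_def diag_def)
  then have "nn \<theta> (u - u') = 0"
    using fnorm_le_full(3)[OF \<theta> \<epsilon>, of "u - u'"] nn_nonneg[OF \<theta>, of "u - u'"] by simp
  then show "u = u'" using nn_eq_0[OF \<theta>] by simp
qed

end

section \<open>Comparison of the two problems\<close>

locale transfer_family = degenerate_family \<Theta> a b a' a'' Vs Z K KZ \<gamma> r M La \<nu> Ls K1 K2 Lb
  for \<Theta> :: "(real^'n::finite) set"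
    and a b :: "real^'n \<Rightarrow> 'h::complex_hilbert \<Rightarrow> 'h \<Rightarrow> complex"
    and a' :: "'h \<Rightarrow> 'h \<Rightarrow> complex^'n"
    and a'' :: "'h \<Rightarrow> 'h \<Rightarrow> complex^'n^'n"
    and Vs Z :: "'h set"
    and K KZ \<gamma> r M La \<nu> Ls K1 K2 Lb :: real +
  fixes E :: "real^'n \<Rightarrow> 'h \<Rightarrow> 'h" and Kb :: real
  assumes E_linear: "\<And>\<theta>. \<theta> \<in> \<Theta> \<Longrightarrow> clinear_on Vs (E \<theta>)"
    and E_bij: "\<And>\<theta>. \<theta> \<in> \<Theta> \<Longrightarrow> bij_betw (E \<theta>) Vs (V_reg a Vs \<theta>)"
    and E_b: "\<And>\<theta> v w. \<lbrakk>\<theta> \<in> \<Theta>; v \<in> Vs; w \<in> Vs\<rbrakk> \<Longrightarrow> b \<theta> (E \<theta> v) (E \<theta> w) = b 0 v w"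
    and Kb_nonneg: "0 \<le> Kb"
    and E_Z: "\<And>\<theta> v z. \<lbrakk>\<theta> \<in> \<Theta>; v \<in> Vs; z \<in> Z\<rbrakk> \<Longrightarrow>
      cmod (b \<theta> (E \<theta> v) z - b 0 v z) \<le> Kb * norm \<theta> * n0 v * n0 z"
begin

lemma E_in: "\<lbrakk>\<theta> \<in> \<Theta>; v \<in> Vs\<rbrakk> \<Longrightarrow> E \<theta> v \<in> V_space a \<theta>"
  using E_bij[of \<theta>] V_reg_subset[of \<theta>] by (auto simp: bij_betw_def)

lemma E_add: "\<lbrakk>\<theta> \<in> \<Theta>; v \<in> Vs; w \<in> Vs\<rbrakk> \<Longrightarrow> E \<theta> (v + w) = E \<theta> v + E \<theta> w"
  and E_scaleC: "\<lbrakk>\<theta> \<in> \<Theta>; v \<in> Vs\<rbrakk> \<Longrightarrow> E \<theta> (c *\<^sub>C v) = c *\<^sub>C E \<theta> v"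
  using E_linear[of \<theta>] by (auto simp: clinear_on_def)

text \<open>The forms a_\<theta> and a_0 vanish on the range and on the domain of
  \<open>E \<theta>\<close>, and b is preserved, so \<open>E \<theta>\<close> is an
  isometry.\<close>

lemma nn_E:
  assumes "\<theta> \<in> \<Theta>" "v \<in> Vs"
  shows "nn \<theta> (E \<theta> v) = n0 v"
proof -
  have "diag (ip a b \<theta>) (E \<theta> v) = diag (b 0) v"
    using V_left[OF assms(1) E_in[OF assms]] E_b[OF assms assms(2)] by (simp add: diag_ip) (simp add: diag_def)
  moreover have "n0 v = fnorm (b 0) v"
    using assms(2) Vs_subset by (intro n0_b) blast
  ultimately show ?thesis by (simp add: fnorm_def)
qed

lemma nn_E_sum:
  assumes "\<theta> \<in> \<Theta>" "v \<in> Vs"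
  shows "nn \<theta> (E \<theta> v + z) \<le> n0 v + K * n0 z" "nn \<theta> (E \<theta> v + z) \<le> (1 + K) * (n0 v + n0 z)"
proof -
  show *: "nn \<theta> (E \<theta> v + z) \<le> n0 v + K * n0 z"
    using fnorm_triangle[OF nf_ip[OF assms(1)], of "E \<theta> v" z] nn_E[OF assms] nn_le[OF assms(1), of z]
    by linarith
  have "n0 v + K * n0 z \<le> (1 + K) * (n0 v + n0 z)"
    using K_pos mult_nonneg_nonneg[of K "n0 v"] by (simp add: algebra_simps)
  then show "nn \<theta> (E \<theta> v + z) \<le> (1 + K) * (n0 v + n0 z)" using * by linarith
qed

text \<open>The contributions with both arguments from \<open>Vs\<close> cancel exactly. Each
  remaining error has the factor |\<theta>| and at least one \<open>Z\<close> component, a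
  combination that is of order \<epsilon> for the solution as well as for the test vector.\<close>

lemma b_transfer:
  assumes \<theta>: "\<theta> \<in> \<Theta>" and v: "v \<in> Vs" "w \<in> Vs" and z: "z \<in> Z" "x \<in> Z"
  shows "cmod (b \<theta> (E \<theta> v + z) (E \<theta> w + x) - b 0 (v + z) (w + x)) \<le>
    Kb * norm \<theta> * n0 v * n0 x + Kb * norm \<theta> * n0 w * n0 z + Lb * norm \<theta> * n0 z * (K * n0 x)"
proof -
  have z0: "z \<in> V\<^sub>0" "x \<in> V\<^sub>0" using z Z_subset by auto
  let ?X1 = "b \<theta> (E \<theta> v) x - b 0 v x" and ?X2 = "b \<theta> z (E \<theta> w) - b 0 z w"
    and ?X3 = "b \<theta> z x - b 0 z x"
  have "b \<theta> (E \<theta> v + z) (E \<theta> w + x) - b 0 (v + z) (w + x) = ?X1 + ?X2 + ?X3"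
    by (simp add: b_linear \<theta> zero_in E_b v)
  moreover have "cmod (?X1 + ?X2 + ?X3) \<le> cmod ?X1 + cmod ?X2 + cmod ?X3"
    by (rule order_trans[OF norm_triangle_ineq add_right_mono[OF norm_triangle_ineq]])
  moreover have "cmod ?X1 \<le> Kb * norm \<theta> * n0 v * n0 x" by (rule E_Z[OF \<theta> v(1) z(2)])
  moreover have "cmod ?X2 \<le> Kb * norm \<theta> * n0 w * n0 z"
  proof -
    have "?X2 = cnj (b \<theta> (E \<theta> w) z - b 0 w z)"
      using nonneg_form_commute[OF nf_b[OF \<theta>], of z "E \<theta> w"]
        nonneg_form_commute[OF nf_b[OF zero_in], of z w] by simp
    then show ?thesis using E_Z[OF \<theta> v(2) z(1)] by (simp only: complex_mod_cnj)
  qed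
  moreover have "cmod ?X3 \<le> Lb * norm \<theta> * n0 z * (K * n0 x)"
    using Lb_nonneg by (intro order_trans[OF b_approx[OF z0 \<theta>]] mult_left_mono nn_le \<theta>) auto
  ultimately show ?thesis by simp
qed

text \<open>Uniformity in \<open>\<theta>\<close> needs the bound \<open>\<bar>\<theta>\<bar>\<^sup>2 \<parallel>z\<parallel> = O(\<epsilon>\<^sup>2)\<close>: the remainder \<open>\<bar>\<theta>\<bar>\<^sup>3 \<parallel>z\<parallel> \<parallel>z'\<parallel> / \<epsilon>\<^sup>2\<close>
  would only be \<open>O(\<bar>\<theta>\<bar>)\<close> if both factors were estimated by \<open>\<bar>\<theta>\<bar> \<parallel>z\<parallel> = O(\<epsilon>)\<close>.\<close>

lemma residual_estimate:
  "\<exists>C\<ge>0. \<forall>\<theta>\<in>\<Theta>. \<forall>\<epsilon> f D v z w. 0 < \<epsilon> \<longrightarrow> \<epsilon> < 1 \<longrightarrow> 0 \<le> D \<longrightarrow>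
    (\<forall>w. cmod (f w) \<le> D * nn \<theta> w) \<longrightarrow> (\<forall>u w. f (u + w) = f u + f w) \<longrightarrow>
    solves_limit a b a' a'' Vs Z E \<epsilon> \<theta> f (v, z) \<longrightarrow>
    cmod (f w - full_form a b \<epsilon> \<theta> (E \<theta> v + z + N \<theta> z) w) \<le>
      C * \<epsilon> * D * fnorm (full_form a b \<epsilon> \<theta>) w \<and>
    norm \<theta> * n0 z \<le> C * \<epsilon> * D"
proof -
  obtain c1 where c1: "c1 \<ge> 0" and lim: "\<And>\<xi> g D v z. \<lbrakk>v \<in> Vs; z \<in> Z; 0 \<le> D;
      \<forall>v'\<in>Vs. \<forall>z'\<in>Z. S \<xi> (v, z) (v', z') = g v' z';
      \<forall>v'\<in>Vs. \<forall>z'\<in>Z. cmod (g v' z') \<le> D * ((1 + K) * (n0 v' + n0 z'))\<rbrakk> \<Longrightarrow>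
      n0 v \<le> c1 * D \<and> n0 z \<le> c1 * D \<and> norm \<xi> * n0 z \<le> c1 * D \<and> (norm \<xi>)\<^sup>2 * n0 z \<le> c1 * D"
    using limit_estimate by blast
  obtain cd where cd: "cd \<ge> 0" and decomp: "\<And>\<theta> w. \<theta> \<in> \<Theta> \<Longrightarrow>
      \<exists>v\<in>V_reg a Vs \<theta>. \<exists>z\<in>Z. \<exists>x. w = v + z + x \<and>
      n0 v \<le> cd * nn \<theta> w \<and> n0 z \<le> cd * nn \<theta> w \<and>
      norm \<theta> * n0 z \<le> cd * fnorm (a \<theta>) w \<and> n0 x \<le> cd * fnorm (a \<theta>) w"
    using test_decomposition by blast
  define c2 where "c2 = cd * (1 + K)"
  have c2: "c2 \<ge> 0" "cd \<le> c2" "K * cd \<le> c2"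
    using cd K_pos by (auto simp: c2_def algebra_simps)
  \<comment> \<open>One summand for \<open>f x\<close> and for each of the residual terms
    \<open>R1\<close> to \<open>R5\<close> below, where \<open>R3\<close> contributes three; the
    last summand \<open>c1\<close> covers the bound on |\<theta>| \<open>n0 z\<close>.\<close>
  define C where "C = K * c2 + A5 * (c1 * c2) + A4 * (c1 * c2) + Kb * (c1 * c2) + Kb * (c2 * c1)
    + Lb * K * (c1 * c2) + (1 + K) * c1 * (2 * K * c2) + K * A3 * c1 + c1"
  have "C \<ge> c1" "C \<ge> 0"
    using c1 c2 K_pos A3_pos A4_nonneg A5_nonneg Kb_nonneg Lb_nonneg by (auto simp: C_def)
  have main: "cmod (f w - full_form a b \<epsilon> \<theta> (E \<theta> v + z + N \<theta> z) w) \<le>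
      C * \<epsilon> * D * fnorm (full_form a b \<epsilon> \<theta>) w \<and> norm \<theta> * n0 z \<le> C * \<epsilon> * D"
    if \<theta>: "\<theta> \<in> \<Theta>" and \<epsilon>: "0 < \<epsilon>" "\<epsilon> < 1" and D: "0 \<le> D"
      and f_bound: "\<forall>w. cmod (f w) \<le> D * nn \<theta> w" and f_add: "\<forall>u w. f (u + w) = f u + f w"
      and sol: "solves_limit a b a' a'' Vs Z E \<epsilon> \<theta> f (v, z)" for \<theta> \<epsilon> f D v z w
  proof -
    let ?t = "norm \<theta>" and ?e = "fnorm (full_form a b \<epsilon> \<theta>) w"
    define \<xi> where "\<xi> = (1 / \<epsilon>) *\<^sub>R \<theta>"
    have v: "v \<in> Vs" and z: "z \<in> Z" using sol by (auto simp: solves_limit_def)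
    have z0: "z \<in> V\<^sub>0" using z Z_subset by blast
    have sol': "\<forall>v'\<in>Vs. \<forall>z'\<in>Z. S \<xi> (v, z) (v', z') = f (E \<theta> v' + z')"
      using sol by (simp add: solves_limit_def \<xi>_def)
    have "\<forall>v'\<in>Vs. \<forall>z'\<in>Z. cmod (f (E \<theta> v' + z')) \<le> D * ((1 + K) * (n0 v' + n0 z'))"
      by (intro ballI order_trans[OF f_bound[rule_format]] mult_left_mono nn_E_sum(2) \<theta> D)
    from lim[OF v z D sol' this]
    have nv: "n0 v \<le> c1 * D" and nz: "n0 z \<le> c1 * D" and "norm \<xi> * n0 z \<le> c1 * D"
      and "(norm \<xi>)\<^sup>2 * n0 z \<le> c1 * D" by blast+
    then have tz: "?t * n0 z \<le> \<epsilon> * (c1 * D)" and ttz: "?t\<^sup>2 * n0 z \<le> \<epsilon>\<^sup>2 * (c1 * D)"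
      using \<epsilon> by (simp_all add: \<xi>_def power_divide field_simps)
    have e: "?e \<ge> 0" by (rule fnorm_nonneg[OF nf_full[OF \<theta>]])
    have nw: "nn \<theta> w \<le> ?e" and aw: "fnorm (a \<theta>) w \<le> \<epsilon> * ?e"
      using fnorm_le_full[OF \<theta> \<epsilon>] by auto
    obtain vh zt x where d: "vh \<in> V_reg a Vs \<theta>" "zt \<in> Z" "w = vh + zt + x"
      "n0 vh \<le> cd * nn \<theta> w" "n0 zt \<le> cd * nn \<theta> w"
      "?t * n0 zt \<le> cd * fnorm (a \<theta>) w" "n0 x \<le> cd * fnorm (a \<theta>) w"
      using decomp[OF \<theta>, of w] by blast
    \<comment> \<open>Pulling the \<open>V_reg\<close> component back through the bijection
      \<open>E \<theta>\<close> makes (vt, zt) an admissible test pair for the limit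
      problem.\<close>
    obtain vt where vt: "vt \<in> Vs" "vh = E \<theta> vt"
      using d(1) E_bij[OF \<theta>] by (auto simp: bij_betw_def)
    have zt0: "zt \<in> V\<^sub>0" using d(2) Z_subset by blast
    have "cd * nn \<theta> w \<le> c2 * ?e" using c2 cd nw e nn_nonneg[OF \<theta>] by (intro mult_mono) auto
    then have nzt: "n0 zt \<le> c2 * ?e" using d(5) by linarith
    have "n0 vt = nn \<theta> vh" using nn_E[OF \<theta> vt(1)] vt(2) by simp
    also have "\<dots> \<le> K * (cd * nn \<theta> w)"
      using K_pos by (intro order_trans[OF nn_le[OF \<theta>]] mult_left_mono d) auto
    also have "\<dots> = (K * cd) * nn \<theta> w" by simp
    also have "\<dots> \<le> c2 * ?e" using c2 cd nw e nn_nonneg[OF \<theta>] by (intro mult_mono) auto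
    finally have nvt: "n0 vt \<le> c2 * ?e" .
    have "cd * fnorm (a \<theta>) w \<le> c2 * (\<epsilon> * ?e)"
      using c2 aw e \<epsilon> fnorm_nonneg[OF nf_a[OF \<theta>]] by (intro mult_mono) auto
    then have tzt: "?t * n0 zt \<le> c2 * (\<epsilon> * ?e)" and nx: "n0 x \<le> c2 * (\<epsilon> * ?e)"
      using d(6,7) by linarith+
    define Q where "Q = \<epsilon> * D * ?e"
    have Q: "Q \<ge> 0" using \<epsilon> D e by (simp add: Q_def)
    have nnx: "nn \<theta> x \<le> K * (c2 * (\<epsilon> * ?e))"
      using K_pos by (intro order_trans[OF nn_le[OF \<theta>]] mult_left_mono nx) auto
    \<comment> \<open>\<open>R1\<close> is the error of the homogenised form and \<open>R3\<close>
      that of transferring b; \<open>R2\<close> and \<open>R4\<close> come from the remainder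
      \<open>x\<close> of the test vector, and \<open>R5\<close> from the corrector in b. In
      \<open>R4\<close> the factor \<epsilon> is supplied by \<open>x\<close> alone, in
      \<open>R5\<close> by |\<theta>| \<open>n0 z\<close>.\<close>
    define R1 where "R1 = a \<theta> (z + N \<theta> z) zt - hom \<theta> z zt"
    define R2 where "R2 = a \<theta> (z + N \<theta> z) x"
    define R3 where "R3 = b \<theta> (E \<theta> v + z) (E \<theta> vt + zt) - b 0 (v + z) (vt + zt)"
    define R4 where "R4 = b \<theta> (E \<theta> v + z) x"
    define R5 where "R5 = b \<theta> (N \<theta> z) w"
    have "a \<theta> (E \<theta> v + z + N \<theta> z) w = a \<theta> (z + N \<theta> z) zt + a \<theta> (z + N \<theta> z) x"
    proof -
      have "a \<theta> (E \<theta> v + z + N \<theta> z) w = a \<theta> (z + N \<theta> z) w"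
        using V_left[OF \<theta> E_in[OF \<theta> v]] by (simp add: a_linear \<theta>)
      also have "\<dots> = a \<theta> (z + N \<theta> z) zt + a \<theta> (z + N \<theta> z) x"
        unfolding d(3) vt(2) using V_right[OF \<theta> E_in[OF \<theta> vt(1)]]
        by (simp only: nonneg_form_add_right[OF nf_a[OF \<theta>]]) simp
      finally show ?thesis .
    qed
    then have aU: "a \<theta> (E \<theta> v + z + N \<theta> z) w = hom \<theta> z zt + R1 + R2"
      by (simp add: R1_def R2_def)
    have bU: "b \<theta> (E \<theta> v + z + N \<theta> z) w = b 0 (v + z) (vt + zt) + R3 + R4 + R5"
    proof -
      have "b \<theta> (E \<theta> v + z + N \<theta> z) w = b \<theta> (E \<theta> v + z) (E \<theta> vt + zt + x) + b \<theta> (N \<theta> z) w"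
        using d(3) vt(2) by (simp only: nonneg_form_add_left[OF nf_b[OF \<theta>]])
      also have "b \<theta> (E \<theta> v + z) (E \<theta> vt + zt + x) = b \<theta> (E \<theta> v + z) (E \<theta> vt + zt) + R4"
        unfolding R4_def by (rule nonneg_form_add_right[OF nf_b[OF \<theta>]])
      finally show ?thesis by (simp add: R3_def R5_def)
    qed
    \<comment> \<open>The limit equation tested with (vt, zt) reproduces the leading terms of both
      forms, since the homogenised form at \<theta> / \<epsilon> is \<epsilon>^-2 times the one at
      \<theta>; only \<open>f x\<close> and the residual terms survive.\<close>
    have "f w = f (E \<theta> vt + zt) + f x" using f_add d(3) vt(2) by simp
    also have "f (E \<theta> vt + zt) = hom \<xi> z zt + b 0 (v + z) (vt + zt)"
      using sol' vt(1) d(2) by (simp add: limit_form_Pair)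
    also have "hom \<xi> z zt = complex_of_real (1 / \<epsilon>\<^sup>2) * hom \<theta> z zt"
      unfolding \<xi>_def by (subst hom_scale_param[OF z0 zt0]) (simp add: power_divide)
    finally have "f w - full_form a b \<epsilon> \<theta> (E \<theta> v + z + N \<theta> z) w =
        f x - complex_of_real (1 / \<epsilon>\<^sup>2) * R1 - complex_of_real (1 / \<epsilon>\<^sup>2) * R2 - R3 - R4 - R5"
      unfolding full_form_def aU bU by (simp add: algebra_simps)
    also have "cmod \<dots> \<le> cmod (f x) + 1 / \<epsilon>\<^sup>2 * cmod R1 + 1 / \<epsilon>\<^sup>2 * cmod R2 + cmod R3 + cmod R4 + cmod R5"
    proof -
      have "cmod (p1 - p2 - p3 - p4 - p5 - p6) \<le> cmod p1 + cmod p2 + cmod p3 + cmod p4 + cmod p5 + cmod p6"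
        for p1 p2 p3 p4 p5 p6 by norm
      from this[of "f x" "complex_of_real (1 / \<epsilon>\<^sup>2) * R1" "complex_of_real (1 / \<epsilon>\<^sup>2) * R2" R3 R4 R5]
      show ?thesis by (simp add: norm_mult norm_divide norm_power)
    qed
    finally have res: "cmod (f w - full_form a b \<epsilon> \<theta> (E \<theta> v + z + N \<theta> z) w) \<le>
      cmod (f x) + 1 / \<epsilon>\<^sup>2 * cmod R1 + 1 / \<epsilon>\<^sup>2 * cmod R2 + cmod R3 + cmod R4 + cmod R5" .
    have "cmod (f x) \<le> D * (K * (c2 * (\<epsilon> * ?e)))"
      by (rule order_trans[OF f_bound[rule_format] mult_left_mono[OF nnx D]])
    then have 0: "cmod (f x) \<le> K * c2 * Q" by (simp add: Q_def mult_ac)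
    have "cmod R1 \<le> A5 * ((?t\<^sup>2 * n0 z) * (?t * n0 zt))"
      using corrected_hom[OF z0 zt0 \<theta>] by (simp add: R1_def power2_eq_square power3_eq_cube mult_ac)
    also have "\<dots> \<le> A5 * ((\<epsilon>\<^sup>2 * (c1 * D)) * (c2 * (\<epsilon> * ?e)))"
      using A5_nonneg c1 D by (intro mult_left_mono mult_mono ttz tzt) auto
    finally have 1: "1 / \<epsilon>\<^sup>2 * cmod R1 \<le> A5 * (c1 * c2) * Q"
      using \<epsilon> by (simp add: Q_def field_simps)
    have "cmod R2 \<le> A4 * ((?t\<^sup>2 * n0 z) * n0 x)"
      using corrected_bound[OF z0 \<theta>, of x] by (simp add: R2_def mult_ac)
    also have "\<dots> \<le> A4 * ((\<epsilon>\<^sup>2 * (c1 * D)) * (c2 * (\<epsilon> * ?e)))"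
      using A4_nonneg c1 D by (intro mult_left_mono mult_mono ttz nx) auto
    finally have 2: "1 / \<epsilon>\<^sup>2 * cmod R2 \<le> A4 * (c1 * c2) * Q"
      using \<epsilon> by (simp add: Q_def field_simps)
    have "n0 v * (?t * n0 zt) \<le> (c1 * D) * (c2 * (\<epsilon> * ?e))" using c1 D by (intro mult_mono nv tzt) auto
    then have 31: "Kb * (n0 v * (?t * n0 zt)) \<le> Kb * ((c1 * D) * (c2 * (\<epsilon> * ?e)))"
      using Kb_nonneg by (rule mult_left_mono)
    have "n0 vt * (?t * n0 z) \<le> (c2 * ?e) * (\<epsilon> * (c1 * D))" using c2 e by (intro mult_mono nvt tz) auto
    then have 32: "Kb * (n0 vt * (?t * n0 z)) \<le> Kb * ((c2 * ?e) * (\<epsilon> * (c1 * D)))"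
      using Kb_nonneg by (rule mult_left_mono)
    have "(?t * n0 z) * n0 zt \<le> (\<epsilon> * (c1 * D)) * (c2 * ?e)" using c1 D \<epsilon> by (intro mult_mono tz nzt) auto
    then have 33: "Lb * K * ((?t * n0 z) * n0 zt) \<le> Lb * K * ((\<epsilon> * (c1 * D)) * (c2 * ?e))"
      using Lb_nonneg K_pos by (intro mult_left_mono) auto
    have "cmod R3 \<le> Kb * (n0 v * (?t * n0 zt)) + Kb * (n0 vt * (?t * n0 z)) + Lb * K * ((?t * n0 z) * n0 zt)"
      using b_transfer[OF \<theta> v vt(1) z d(2)] by (simp add: R3_def mult_ac)
    also have "\<dots> \<le> Kb * ((c1 * D) * (c2 * (\<epsilon> * ?e))) + Kb * ((c2 * ?e) * (\<epsilon> * (c1 * D)))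
        + Lb * K * ((\<epsilon> * (c1 * D)) * (c2 * ?e))"
      by (intro add_mono 31 32 33)
    finally have 3: "cmod R3 \<le> (Kb * (c1 * c2) + Kb * (c2 * c1) + Lb * K * (c1 * c2)) * Q"
      by (simp add: Q_def algebra_simps)
    have "cmod R4 \<le> nn \<theta> (E \<theta> v + z) * nn \<theta> x" unfolding R4_def by (rule b_le_nn[OF \<theta>])
    also have "\<dots> \<le> ((1 + K) * (c1 * D + c1 * D)) * (K * (c2 * (\<epsilon> * ?e)))"
    proof (rule mult_mono)
      show "nn \<theta> (E \<theta> v + z) \<le> (1 + K) * (c1 * D + c1 * D)"
        using K_pos by (intro order_trans[OF nn_E_sum(2)[OF \<theta> v]] mult_left_mono add_mono nv nz) auto
    qed (use nnx K_pos c1 D nn_nonneg[OF \<theta>] in auto)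
    finally have 4: "cmod R4 \<le> (1 + K) * c1 * (2 * K * c2) * Q" by (simp add: Q_def mult_ac)
    have "cmod R5 \<le> nn \<theta> (N \<theta> z) * nn \<theta> w" unfolding R5_def by (rule b_le_nn[OF \<theta>])
    also have "\<dots> \<le> (K * (A3 * (\<epsilon> * (c1 * D)))) * ?e"
    proof (rule mult_mono)
      have "n0 (N \<theta> z) \<le> A3 * (\<epsilon> * (c1 * D))"
        by (rule order_trans[OF N_bound[OF z0, of \<theta>, unfolded mult.assoc]
            mult_left_mono[OF tz less_imp_le[OF A3_pos]]])
      then show "nn \<theta> (N \<theta> z) \<le> K * (A3 * (\<epsilon> * (c1 * D)))"
        using K_pos by (intro order_trans[OF nn_le[OF \<theta>]] mult_left_mono) auto
    qed (use nw K_pos A3_pos \<epsilon> c1 D nn_nonneg[OF \<theta>] in auto)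
    finally have 5: "cmod R5 \<le> K * A3 * c1 * Q" by (simp add: Q_def mult_ac)
    have "cmod (f w - full_form a b \<epsilon> \<theta> (E \<theta> v + z + N \<theta> z) w) \<le> K * c2 * Q + A5 * (c1 * c2) * Q
        + A4 * (c1 * c2) * Q + (Kb * (c1 * c2) + Kb * (c2 * c1) + Lb * K * (c1 * c2)) * Q
        + (1 + K) * c1 * (2 * K * c2) * Q + K * A3 * c1 * Q"
      using res 0 1 2 3 4 5 by linarith
    also have "\<dots> = (C - c1) * Q" unfolding C_def distrib_right left_diff_distrib by simp
    also have "\<dots> \<le> C * Q" using c1 Q by (intro mult_right_mono) auto
    finally have "cmod (f w - full_form a b \<epsilon> \<theta> (E \<theta> v + z + N \<theta> z) w) \<le> C * Q" .
    moreover have "\<epsilon> * (c1 * D) \<le> C * \<epsilon> * D"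
      using mult_right_mono[OF \<open>C \<ge> c1\<close>, of "\<epsilon> * D"] \<epsilon> D by (simp add: mult_ac)
    ultimately show ?thesis using tz by (simp add: Q_def mult.assoc)
  qed
  show ?thesis by (intro exI[of _ C] conjI[OF \<open>C \<ge> 0\<close>]) (use main in blast)
qed

text \<open>The residual is tested with the error u - U itself, U being the trial vector; one factor
  of the energy norm cancels. The corrector belongs to U but not to the claimed approximation, and
  dropping it costs a multiple of |\<theta>| \<open>n0 z\<close>.\<close>

lemma main_estimate:
  "\<exists>C\<ge>0. \<forall>\<theta>\<in>\<Theta>. \<forall>\<epsilon> f D u v z. 0 < \<epsilon> \<longrightarrow> \<epsilon> < 1 \<longrightarrow> 0 \<le> D \<longrightarrow>
    (\<forall>w. cmod (f w) \<le> D * nn \<theta> w) \<longrightarrow> (\<forall>u w. f (u + w) = f u + f w) \<longrightarrow>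
    solves_full a b \<epsilon> \<theta> f u \<longrightarrow> solves_limit a b a' a'' Vs Z E \<epsilon> \<theta> f (v, z) \<longrightarrow>
    fnorm (b \<theta>) (u - (E \<theta> v + z)) \<le> C * \<epsilon> * D"
proof -
  obtain C where C: "C \<ge> 0" and res: "\<And>\<theta> \<epsilon> f D v z w. \<lbrakk>\<theta> \<in> \<Theta>; 0 < \<epsilon>; \<epsilon> < 1; 0 \<le> D;
      \<forall>w. cmod (f w) \<le> D * nn \<theta> w; \<forall>u w. f (u + w) = f u + f w;
      solves_limit a b a' a'' Vs Z E \<epsilon> \<theta> f (v, z)\<rbrakk> \<Longrightarrow>
      cmod (f w - full_form a b \<epsilon> \<theta> (E \<theta> v + z + N \<theta> z) w) \<le> C * \<epsilon> * D * fnorm (full_form a b \<epsilon> \<theta>) w \<and>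
      norm \<theta> * n0 z \<le> C * \<epsilon> * D"
    using residual_estimate by blast
  have main: "fnorm (b \<theta>) (u - (E \<theta> v + z)) \<le> (C + K * A3 * C) * \<epsilon> * D"
    if h: "\<theta> \<in> \<Theta>" "0 < \<epsilon>" "\<epsilon> < 1" "0 \<le> D" "\<forall>w. cmod (f w) \<le> D * nn \<theta> w"
      "\<forall>u w. f (u + w) = f u + f w"
      and u: "solves_full a b \<epsilon> \<theta> f u" and vz: "solves_limit a b a' a'' Vs Z E \<epsilon> \<theta> f (v, z)"
    for \<theta> \<epsilon> f D u v z
  proof -
    let ?F = "full_form a b \<epsilon> \<theta>" and ?U = "E \<theta> v + z + N \<theta> z"
    note nf = nf_full[OF h(1), of \<epsilon>]
    define w where "w = u - ?U"
    have z0: "z \<in> V\<^sub>0" using vz Z_subset by (auto simp: solves_limit_def)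
    have "?F w w = f w - ?F ?U w"
      using u unfolding w_def solves_full_def by (subst nonneg_form_diff_left[OF nf]) simp
    then have "(fnorm ?F w)\<^sup>2 \<le> C * \<epsilon> * D * fnorm ?F w"
      using res[OF h vz, of w] complex_Re_le_cmod[of "?F w w"]
      by (simp add: fnorm_square[OF nf] diag_def)
    then have w: "fnorm ?F w \<le> C * \<epsilon> * D"
      by (rule le_if_power2_le_mult) (use fnorm_nonneg[OF nf] C h in auto)
    have tz: "norm \<theta> * n0 z \<le> C * \<epsilon> * D" using res[OF h vz] by blast
    have "fnorm (b \<theta>) (w + N \<theta> z) \<le> fnorm (b \<theta>) w + fnorm (b \<theta>) (N \<theta> z)"
      by (rule fnorm_triangle[OF nf_b[OF h(1)]])
    also have "fnorm (b \<theta>) w \<le> C * \<epsilon> * D" using fnorm_le_full(1)[OF h(1-3)] w by (rule order_trans)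
    also have "fnorm (b \<theta>) (N \<theta> z) \<le> K * (A3 * (C * \<epsilon> * D))"
    proof -
      have "n0 (N \<theta> z) \<le> A3 * (C * \<epsilon> * D)"
        by (rule order_trans[OF N_bound[OF z0, of \<theta>, unfolded mult.assoc]
            mult_left_mono[OF tz less_imp_le[OF A3_pos]]])
      then have "K * n0 (N \<theta> z) \<le> K * (A3 * (C * \<epsilon> * D))" using K_pos by simp
      then show ?thesis using fnorm_b_le[OF h(1), of "N \<theta> z"] nn_le[OF h(1), of "N \<theta> z"] by linarith
    qed
    also have "w + N \<theta> z = u - (E \<theta> v + z)" by (simp add: w_def)
    finally show ?thesis by (simp add: algebra_simps)
  qed
  have "C + K * A3 * C \<ge> 0" using C K_pos A3_pos by simp
  then show ?thesis by (intro exI[of _ "C + K * A3 * C"] conjI) (use main in blast)+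
qed

lemma limit_problem_solvable_E:
  assumes \<theta>: "\<theta> \<in> \<Theta>" and D: "0 \<le> D" and f: "\<And>w. cmod (f w) \<le> D * nn \<theta> w"
    "\<And>u w. f (u + w) = f u + f w" "\<And>c u. f (c *\<^sub>C u) = cnj c * f u"
  shows "\<exists>!p. solves_limit a b a' a'' Vs Z E \<epsilon> \<theta> f p"
proof -
  define g where "g p = f (E \<theta> (fst p) + snd p)" for p
  have "\<exists>!p. p \<in> Vs \<times> Z \<and> (\<forall>v\<in>Vs. \<forall>z\<in>Z. S ((1 / \<epsilon>) *\<^sub>R \<theta>) p (v, z) = g (v, z))"
  proof (rule limit_problem_solvable)
    show "g (p + q) = g p + g q" if "p \<in> Vs \<times> Z" "q \<in> Vs \<times> Z" for p q
    proof -
      have "E \<theta> (fst p + fst q) + (snd p + snd q) = (E \<theta> (fst p) + snd p) + (E \<theta> (fst q) + snd q)"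
        using that by (subst E_add[OF \<theta>]) auto
      then show ?thesis by (simp add: g_def f)
    qed
    show "g (c *\<^sub>C v, c *\<^sub>C z) = cnj c * g (v, z)" if "v \<in> Vs" "z \<in> Z" for c v z
      using that by (simp add: g_def E_scaleC \<theta> flip: scaleC_add_right f(3))
    show "cmod (g (v, z)) \<le> D * (1 + K) * (n0 v + n0 z)" if "v \<in> Vs" "z \<in> Z" for v z
      using order_trans[OF f(1) mult_left_mono[OF nn_E_sum(2)[OF \<theta> that(1)] D]]
      by (simp add: g_def mult.assoc)
    show "0 \<le> D * (1 + K)" using D K_pos by simp
  qed
  then show ?thesis by (simp add: solves_limit_def g_def)
qed

end

section \<open>The ambient space\<close>

lemma csubspace_image:
  assumes S: "csubspace S" and f: "clinear_on UNIV f"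
  shows "csubspace (f ` S)"
proof -
  have add: "f (x + y) = f x + f y" and scale: "f (c *\<^sub>C x) = c *\<^sub>C f x" for x y c
    using f by (auto simp: clinear_on_def)
  have "f 0 = 0" using add[of 0 0] by simp
  then show ?thesis
    using S unfolding csubspace_def by (auto simp flip: add scale)
qed

text \<open>At u = 0 the quotient is 0 whatever \<open>T 0\<close> is, because division by zero
  yields 0; the condition \<open>T 0 = 0\<close> covers that point.\<close>

lemma opnorm_leD:
  assumes p: "equiv_inner_product p" and q: "equiv_inner_product q"
    and T: "opnorm p q T \<le> ereal c" "T 0 = 0"
  shows "fnorm q (T u) \<le> c * fnorm p u"
proof (cases "fnorm p u = 0")
  case True
  then have "u = 0" using equiv_inner_product_fnorm_eq_0[OF p] by blast
  then show ?thesis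
    using True T(2) fnorm_zero[OF equiv_inner_product_nonneg_form[OF q]] by simp
next
  case False
  then have "fnorm p u > 0"
    using fnorm_nonneg[OF equiv_inner_product_nonneg_form[OF p], of u] by simp
  moreover have "ereal (fnorm q (T u) / fnorm p u) \<le> ereal c"
    using T(1) unfolding opnorm_def by (rule order_trans[OF SUP_upper[OF UNIV_I]])
  ultimately show ?thesis by (simp add: pos_divide_le_eq)
qed

lemma opnorm_leI:
  assumes p: "equiv_inner_product p" and c: "0 \<le> c" and T: "\<And>u. fnorm q (T u) \<le> c * fnorm p u"
  shows "opnorm p q T \<le> ereal c"
  unfolding opnorm_def
proof (rule SUP_least)
  fix u
  show "ereal (fnorm q (T u) / fnorm p u) \<le> ereal c"
  proof (cases "fnorm p u = 0")
    case False
    then have "fnorm p u > 0"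
      using fnorm_nonneg[OF equiv_inner_product_nonneg_form[OF p], of u] by simp
    then show ?thesis using T[of u] by (simp add: pos_divide_le_eq)
  qed (use c in simp)
qed

lemma orth_proj_properties:
  fixes p :: "'a::complex_hilbert \<Rightarrow> 'a \<Rightarrow> complex"
  assumes p: "equiv_inner_product p" and X: "csubspace X" "closed X"
  shows "orth_proj p X u \<in> X" "y \<in> X \<Longrightarrow> p (orth_proj p X u) y = p u y"
proof -
  note nf = equiv_inner_product_nonneg_form[OF p]
  have "\<exists>!x. x \<in> X \<and> (\<forall>y\<in>X. p (u - x) y = 0)"
  proof (rule ex_ex1I)
    show "\<exists>x. x \<in> X \<and> (\<forall>y\<in>X. p (u - x) y = 0)"
      using orthogonal_decomposition[OF p X] by blast
    fix x x' assume x: "x \<in> X \<and> (\<forall>y\<in>X. p (u - x) y = 0)" and x': "x' \<in> X \<and> (\<forall>y\<in>X. p (u - x') y = 0)"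
    then have "x - x' \<in> X" using X(1) csubspace_imp_subspace subspace_diff by blast
    then have "p (u - x') (x - x') - p (u - x) (x - x') = 0" using x x' by simp
    then have "p (x - x') (x - x') = 0"
      by (simp flip: nonneg_form_diff_left[OF nf])
    then have "fnorm p (x - x') = 0" by (simp add: fnorm_def diag_def)
    then show "x = x'" using equiv_inner_product_fnorm_eq_0[OF p] by simp
  qed
  from theI'[OF this] show "orth_proj p X u \<in> X" "y \<in> X \<Longrightarrow> p (orth_proj p X u) y = p u y"
    unfolding orth_proj_def[symmetric] by (auto simp: nonneg_form_diff_left[OF nf])
qed

locale ambient_family = transfer_family \<Theta> a b a' a'' Vs Z K KZ \<gamma> r M La \<nu> Ls K1 K2 Lb E Kb
  for \<Theta> :: "(real^'n::finite) set"
    and a b :: "real^'n \<Rightarrow> 'h::complex_hilbert \<Rightarrow> 'h \<Rightarrow> complex"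
    and a' :: "'h \<Rightarrow> 'h \<Rightarrow> complex^'n"
    and a'' :: "'h \<Rightarrow> 'h \<Rightarrow> complex^'n^'n"
    and Vs Z :: "'h set"
    and K KZ \<gamma> r M La \<nu> Ls K1 K2 Lb :: real
    and E :: "real^'n \<Rightarrow> 'h \<Rightarrow> 'h" and Kb :: real +
  fixes J :: "'h \<Rightarrow> 'k::complex_hilbert" and d :: "real^'n \<Rightarrow> 'k \<Rightarrow> 'k \<Rightarrow> complex"
    and EE :: "real^'n \<Rightarrow> 'k \<Rightarrow> 'k" and Ke :: real
  assumes J_linear: "clinear_on UNIV J"
    and d_ip: "\<And>\<theta>. \<theta> \<in> \<Theta> \<Longrightarrow> equiv_inner_product (d \<theta>)"
    and d_le_b: "\<And>\<theta> u. \<theta> \<in> \<Theta> \<Longrightarrow> diag (d \<theta>) (J u) \<le> diag (b \<theta>) u"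
    and EE_bij: "\<And>\<theta>. \<theta> \<in> \<Theta> \<Longrightarrow> bij (EE \<theta>)"
    and EE_J: "\<And>\<theta> v. \<lbrakk>\<theta> \<in> \<Theta>; v \<in> Vs\<rbrakk> \<Longrightarrow> EE \<theta> (J v) = J (E \<theta> v)"
    and EE_d: "\<And>\<theta> u w. \<theta> \<in> \<Theta> \<Longrightarrow> d \<theta> (EE \<theta> u) (EE \<theta> w) = d 0 u w"
    and EE_0: "EE 0 = id"
    and Ke_nonneg: "0 \<le> Ke"
    and EE_opnorm: "\<And>\<theta>1 \<theta>2. \<lbrakk>\<theta>1 \<in> \<Theta>; \<theta>2 \<in> \<Theta>\<rbrakk> \<Longrightarrow>
      opnorm (d 0) (d \<theta>1) (\<lambda>u. EE \<theta>1 u - EE \<theta>2 u) \<le> ereal (Ke * norm (\<theta>1 - \<theta>2))"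
begin

lemma nf_d: "\<theta> \<in> \<Theta> \<Longrightarrow> nonneg_form (d \<theta>)"
  by (rule equiv_inner_product_nonneg_form[OF d_ip])

lemmas d_linear = nonneg_form_add_left[OF nf_d] nonneg_form_add_right[OF nf_d]
  nonneg_form_diff_left[OF nf_d] nonneg_form_diff_right[OF nf_d]
  nonneg_form_scaleC_left[OF nf_d] nonneg_form_scaleC_right[OF nf_d]

lemma J_add: "J (u + w) = J u + J w" and J_scaleC: "J (c *\<^sub>C u) = c *\<^sub>C J u"
  using J_linear by (auto simp: clinear_on_def)

lemma J_diff: "J (u - w) = J u - J w"
  using J_add[of "u - w" w] by (simp add: algebra_simps)

lemma fnorm_J: "\<theta> \<in> \<Theta> \<Longrightarrow> fnorm (d \<theta>) (J u) \<le> fnorm (b \<theta>) u"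
  using d_le_b by (simp add: fnorm_def)

lemma fnorm_J_nn: "\<theta> \<in> \<Theta> \<Longrightarrow> fnorm (d \<theta>) (J u) \<le> nn \<theta> u"
  using fnorm_J fnorm_b_le order_trans by blast

lemma EE_fnorm: "\<theta> \<in> \<Theta> \<Longrightarrow> fnorm (d \<theta>) (EE \<theta> u) = fnorm (d 0) u"
  by (simp add: fnorm_def diag_def EE_d)

text \<open>Linearity of \<open>EE\<close> is not assumed: the defect of additivity is orthogonal to the range, which
  is the whole space.\<close>

lemma EE_add:
  assumes \<theta>: "\<theta> \<in> \<Theta>"
  shows "EE \<theta> (u + w) = EE \<theta> u + EE \<theta> w"
proof -
  define x where "x = EE \<theta> (u + w) - EE \<theta> u - EE \<theta> w"
  have "d \<theta> x (EE \<theta> q) = 0" for q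
    by (simp add: x_def d_linear EE_d \<theta> zero_in)
  then have "d \<theta> x x = 0" using EE_bij[OF \<theta>] by (metis bij_pointE)
  then have "fnorm (d \<theta>) x = 0" by (simp add: fnorm_def diag_def)
  then have "x = 0" using equiv_inner_product_fnorm_eq_0[OF d_ip[OF \<theta>]] by blast
  then show ?thesis by (simp add: x_def algebra_simps)
qed

lemma EE_close:
  assumes \<theta>: "\<theta> \<in> \<Theta>"
  shows "fnorm (d \<theta>) (EE \<theta> u - u) \<le> Ke * norm \<theta> * fnorm (d 0) u"
proof -
  have "EE \<theta> 0 = 0" using EE_add[OF \<theta>, of 0 0] by simp
  then show ?thesis
    using opnorm_leD[OF d_ip[OF zero_in] d_ip[OF \<theta>] EE_opnorm[OF \<theta> zero_in]] by (simp add: EE_0)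
qed

lemma functional_bound:
  assumes \<theta>: "\<theta> \<in> \<Theta>"
  shows "cmod (d \<theta> g (J w)) \<le> fnorm (d \<theta>) g * nn \<theta> w"
  by (rule order_trans[OF nonneg_form_Cauchy_Schwarz[OF nf_d[OF \<theta>]]
        mult_left_mono[OF fnorm_J_nn[OF \<theta>] fnorm_nonneg[OF nf_d[OF \<theta>]]]])

lemma functional_antidual:
  assumes \<theta>: "\<theta> \<in> \<Theta>"
  shows "(\<lambda>w. d \<theta> g (J w)) \<in> antidual"
proof -
  obtain C where C: "\<And>u. nn \<theta> u \<le> C * norm u" using norm_compare[OF \<theta>] by blast
  have "bounded_linear (\<lambda>w. d \<theta> g (J w))"
  proof (rule bounded_linear_intro[where K = "fnorm (d \<theta>) g * C"])
    show "cmod (d \<theta> g (J w)) \<le> norm w * (fnorm (d \<theta>) g * C)" for w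
      using order_trans[OF functional_bound[OF \<theta>] mult_left_mono[OF C fnorm_nonneg[OF nf_d[OF \<theta>]]]]
      by (simp add: mult_ac)
    show "d \<theta> g (J (t *\<^sub>R w)) = t *\<^sub>R d \<theta> g (J w)" for t w
      by (simp add: scaleR_scaleC J_scaleC d_linear \<theta> scaleR_conv_of_real)
  qed (simp add: J_add d_linear \<theta>)
  then show ?thesis
    by (simp add: antidual_def J_add J_scaleC d_linear \<theta> linear_continuous_on)
qed

section \<open>Inverses of the two operators as solution maps\<close>

lemma H0_csubspace: "csubspace (H0_space Vs Z J)"
proof -
  have "csubspace (J ` {v + z |v z. v \<in> Vs \<and> z \<in> Z})"
    by (rule csubspace_image[OF csubspace_sum[OF Vs(1) Z(1)] J_linear])
  then show ?thesis unfolding H0_space_def by (rule csubspace_closure)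
qed

lemma J_in_H0: "\<lbrakk>v \<in> Vs; z \<in> Z\<rbrakk> \<Longrightarrow> J (v + z) \<in> H0_space Vs Z J"
  unfolding H0_space_def by (rule subsetD[OF closure_subset]) blast

text \<open>Inverting the operator at g means solving the full problem with the functional given by
  d_\<theta>(g, J w); unique solvability makes the description in \<open>op_inverse\<close> well
  defined.\<close>

lemma op_inverse_L:
  assumes \<theta>: "\<theta> \<in> \<Theta>" and \<epsilon>: "0 < \<epsilon>" "\<epsilon> < 1"
    and u: "solves_full a b \<epsilon> \<theta> (\<lambda>w. d \<theta> g (J w)) u"
  shows "op_inverse (L_op a b J d \<epsilon> \<theta>) g = J u"
  unfolding op_inverse_def
proof (rule the_equality)
  show "(J u, g) \<in> L_op a b J d \<epsilon> \<theta>"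
    using u by (auto simp: L_op_def form_operator_def solves_full_def)
  fix x assume "(x, g) \<in> L_op a b J d \<epsilon> \<theta>"
  then obtain u' where "x = J u'" "solves_full a b \<epsilon> \<theta> (\<lambda>w. d \<theta> g (J w)) u'"
    by (auto simp: L_op_def form_operator_def solves_full_def)
  then show "x = J u"
    using full_problem_solvable[OF \<theta> \<epsilon> functional_antidual[OF \<theta>]] u by blast
qed

lemma limit_problem_solvable_d:
  "\<exists>!p. p \<in> Vs \<times> Z \<and> (\<forall>v\<in>Vs. \<forall>z\<in>Z. S \<xi> p (v, z) = d 0 g (J (v + z)))"
proof -
  define h where "h p = d 0 g (J (fst p + snd p))" for p
  have "\<exists>!p. p \<in> Vs \<times> Z \<and> (\<forall>v\<in>Vs. \<forall>z\<in>Z. S \<xi> p (v, z) = h (v, z))"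
  proof (rule limit_problem_solvable)
    show "h (p + q) = h p + h q" for p q
    proof -
      have "fst (p + q) + snd (p + q) = (fst p + snd p) + (fst q + snd q)" by (simp add: algebra_simps)
      then show ?thesis unfolding h_def by (simp only: J_add d_linear zero_in)
    qed
    show "h (c *\<^sub>C v, c *\<^sub>C z) = cnj c * h (v, z)" for c v z
      by (simp add: h_def J_scaleC d_linear zero_in flip: scaleC_add_right)
    show "cmod (h (v, z)) \<le> fnorm (d 0) g * (n0 v + n0 z)" for v z
      using order_trans[OF functional_bound[OF zero_in] mult_left_mono[OF n0_triangle]]
        fnorm_nonneg[OF nf_d[OF zero_in]] by (simp add: h_def)
  qed (rule fnorm_nonneg[OF nf_d[OF zero_in]])
  then show ?thesis by (simp add: h_def)
qed

text \<open>The test vectors J(v + z) lie in \<open>H0_space\<close>, so g and its projection define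
  the same functional on them and the projection disappears from the variational problem.\<close>

lemma op_inverse_LL:
  assumes p: "p \<in> Vs \<times> Z" "\<forall>v\<in>Vs. \<forall>z\<in>Z. S \<xi> p (v, z) = d 0 g (J (v + z))"
  shows "op_inverse (LL_op a b a' a'' Vs Z J d \<xi>) (orth_proj (d 0) (H0_space Vs Z J) g) =
    J (fst p + snd p)"
proof -
  have cl: "closed (H0_space Vs Z J)" by (simp add: H0_space_def)
  note P = orth_proj_properties[OF d_ip[OF zero_in] H0_csubspace cl, where u = g]
  let ?P = "orth_proj (d 0) (H0_space Vs Z J) g"
  have eq: "d 0 ?P (J (v + z)) = d 0 g (J (v + z))" if "v \<in> Vs" "z \<in> Z" for v z
    by (rule P(2)[OF J_in_H0[OF that]])
  show ?thesis
    unfolding op_inverse_def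
  proof (rule the_equality)
    show "(J (fst p + snd p), ?P) \<in> LL_op a b a' a'' Vs Z J d \<xi>"
      unfolding LL_op_def form_operator_def using p P(1) eq
      by (intro CollectI exI[of _ p] exI[of _ ?P]) (auto split: prod.splits)
    fix x assume "(x, ?P) \<in> LL_op a b a' a'' Vs Z J d \<xi>"
    then obtain q where q: "q \<in> Vs \<times> Z" "x = J (fst q + snd q)"
        "\<forall>w\<in>Vs \<times> Z. S \<xi> q w = d 0 ?P (J (fst w + snd w))"
      unfolding LL_op_def form_operator_def by (auto split: prod.splits)
    then have "\<forall>v\<in>Vs. \<forall>z\<in>Z. S \<xi> q (v, z) = d 0 g (J (v + z))" using eq by auto
    then have "q = p" using limit_problem_solvable_d[of \<xi> g] p q(1) by blast
    then show "x = J (fst p + snd p)" using q(2) by simp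
  qed
qed

lemma operator_estimate:
  "\<exists>C\<ge>0. \<forall>\<theta>\<in>\<Theta>. \<forall>\<epsilon>. 0 < \<epsilon> \<longrightarrow> \<epsilon> < 1 \<longrightarrow> (\<forall>g.
    fnorm (d \<theta>) (op_inverse (L_op a b J d \<epsilon> \<theta>) g -
      EE \<theta> (op_inverse (LL_op a b a' a'' Vs Z J d ((1 / \<epsilon>) *\<^sub>R \<theta>))
        (orth_proj (d 0) (H0_space Vs Z J) (inv (EE \<theta>) g)))) \<le> C * \<epsilon> * fnorm (d \<theta>) g)"
proof -
  obtain c1 where c1: "c1 \<ge> 0" and lim: "\<And>\<xi> g D v z. \<lbrakk>v \<in> Vs; z \<in> Z; 0 \<le> D;
      \<forall>v'\<in>Vs. \<forall>z'\<in>Z. S \<xi> (v, z) (v', z') = g v' z';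
      \<forall>v'\<in>Vs. \<forall>z'\<in>Z. cmod (g v' z') \<le> D * ((1 + K) * (n0 v' + n0 z'))\<rbrakk> \<Longrightarrow>
      n0 v \<le> c1 * D \<and> n0 z \<le> c1 * D \<and> norm \<xi> * n0 z \<le> c1 * D \<and> (norm \<xi>)\<^sup>2 * n0 z \<le> c1 * D"
    using limit_estimate by blast
  obtain c2 where c2: "c2 \<ge> 0" and main: "\<And>\<theta> \<epsilon> f D u v z. \<lbrakk>\<theta> \<in> \<Theta>; 0 < \<epsilon>; \<epsilon> < 1; 0 \<le> D;
      \<forall>w. cmod (f w) \<le> D * nn \<theta> w; \<forall>u w. f (u + w) = f u + f w;
      solves_full a b \<epsilon> \<theta> f u; solves_limit a b a' a'' Vs Z E \<epsilon> \<theta> f (v, z)\<rbrakk> \<Longrightarrow>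
      fnorm (b \<theta>) (u - (E \<theta> v + z)) \<le> c2 * \<epsilon> * D"
    using main_estimate by blast
  \<comment> \<open>The summands belong to \<open>T1\<close>, \<open>T2\<close> and
    \<open>T3\<close> below: the error of the first estimate, the difference of the two limit
    solutions, and the action of \<open>EE \<theta>\<close> on the \<open>Z\<close>
    component.\<close>
  define C where "C = c2 + (1 + K) * (2 * \<kappa> * (Ke / sqrt c0)) + Ke * c1"
  have C: "C \<ge> 0" using c1 c2 K_pos \<kappa>_pos c0_pos Ke_nonneg by (simp add: C_def)
  have "fnorm (d \<theta>) (op_inverse (L_op a b J d \<epsilon> \<theta>) g -
      EE \<theta> (op_inverse (LL_op a b a' a'' Vs Z J d ((1 / \<epsilon>) *\<^sub>R \<theta>))
        (orth_proj (d 0) (H0_space Vs Z J) (inv (EE \<theta>) g)))) \<le> C * \<epsilon> * fnorm (d \<theta>) g"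
    if \<theta>: "\<theta> \<in> \<Theta>" and \<epsilon>: "0 < \<epsilon>" "\<epsilon> < 1" for \<theta> \<epsilon> g
  proof -
    define D where "D = fnorm (d \<theta>) g"
    have D: "D \<ge> 0" unfolding D_def by (rule fnorm_nonneg[OF nf_d[OF \<theta>]])
    define g' where "g' = inv (EE \<theta>) g"
    have g: "EE \<theta> g' = g"
      using EE_bij[OF \<theta>] by (simp add: g'_def bij_is_surj surj_f_inv_f)
    have D': "fnorm (d 0) g' = D" using EE_fnorm[OF \<theta>, of g'] g by (simp add: D_def)
    define \<xi> where "\<xi> = (1 / \<epsilon>) *\<^sub>R \<theta>"
    have t: "norm \<theta> = \<epsilon> * norm \<xi>" using \<epsilon> by (simp add: \<xi>_def)
    let ?f = "\<lambda>w. d \<theta> g (J w)"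
    have f: "\<And>w. cmod (?f w) \<le> D * nn \<theta> w" "\<And>u w. ?f (u + w) = ?f u + ?f w"
        "\<And>c u. ?f (c *\<^sub>C u) = cnj c * ?f u"
      by (simp_all add: D_def functional_bound \<theta> J_add J_scaleC d_linear)
    obtain u where u: "solves_full a b \<epsilon> \<theta> ?f u"
      using full_problem_solvable[OF \<theta> \<epsilon> functional_antidual[OF \<theta>]] by blast
    obtain v z where vz: "solves_limit a b a' a'' Vs Z E \<epsilon> \<theta> ?f (v, z)"
      using limit_problem_solvable_E[OF \<theta> D f] by (metis surj_pair)
    obtain v' z' where vz': "v' \<in> Vs" "z' \<in> Z"
        "\<forall>x\<in>Vs. \<forall>y\<in>Z. S \<xi> (v', z') (x, y) = d 0 g' (J (x + y))"
      using limit_problem_solvable_d[of \<xi> g'] by auto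
    have v: "v \<in> Vs" and z: "z \<in> Z" using vz by (auto simp: solves_limit_def)
    have sol: "S \<xi> (v, z) (x, y) = ?f (E \<theta> x + y)" if "x \<in> Vs" "y \<in> Z" for x y
      using vz that by (simp add: solves_limit_def \<xi>_def)
    define dv where "dv = v - v'"
    define dz where "dz = z - z'"
    have dv: "dv \<in> Vs" "v = v' + dv" and dz: "dz \<in> Z" "z = z' + dz"
      using subspace_diff[OF csubspace_imp_subspace[OF Vs(1)] v vz'(1)]
        subspace_diff[OF csubspace_imp_subspace[OF Z(1)] z vz'(2)] by (simp_all add: dv_def dz_def)
    have "S \<xi> (v, z) (dv, dz) = S \<xi> (v', z') (dv, dz) + S \<xi> (dv, dz) (dv, dz)"
      using limit_form_add_left[of "(v', z')" "(dv, dz)" "(dv, dz)" \<xi>] vz' dv dz by simp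
    then have "S \<xi> (dv, dz) (dv, dz) = ?f (E \<theta> dv + dz) - d 0 g' (J (dv + dz))"
      using sol[OF dv(1) dz(1)] vz'(3) dv(1) dz(1) by simp
    \<comment> \<open>Unitarity writes the second functional as d_\<theta>(g, EE_\<theta> J w). On
      \<open>Vs\<close> the map \<open>EE \<theta>\<close> is \<open>E \<theta>\<close>, so the
      \<open>Vs\<close> parts cancel and only \<open>EE \<theta>\<close> minus the identity on the
      \<open>Z\<close> part remains.\<close>
    also have "d 0 g' (J (dv + dz)) = d \<theta> g (J (E \<theta> dv)) + d \<theta> g (EE \<theta> (J dz))"
      using EE_d[OF \<theta>, of g' "J dv"] EE_d[OF \<theta>, of g' "J dz"] EE_J[OF \<theta> dv(1)]
      by (simp add: g J_add d_linear zero_in)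
    also have "?f (E \<theta> dv + dz) - (d \<theta> g (J (E \<theta> dv)) + d \<theta> g (EE \<theta> (J dz))) =
        - d \<theta> g (EE \<theta> (J dz) - J dz)"
      by (simp add: J_add d_linear \<theta>)
    finally have "Re (S \<xi> (dv, dz) (dv, dz)) \<le> cmod (d \<theta> g (EE \<theta> (J dz) - J dz))"
      by (metis complex_Re_le_cmod norm_minus_cancel)
    also have "\<dots> \<le> D * fnorm (d \<theta>) (EE \<theta> (J dz) - J dz)"
      unfolding D_def by (rule nonneg_form_Cauchy_Schwarz[OF nf_d[OF \<theta>]])
    also have "\<dots> \<le> D * (Ke * norm \<theta> * n0 dz)"
    proof (rule mult_left_mono[OF _ D])
      show "fnorm (d \<theta>) (EE \<theta> (J dz) - J dz) \<le> Ke * norm \<theta> * n0 dz"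
        using Ke_nonneg
        by (intro order_trans[OF EE_close[OF \<theta>]] mult_left_mono fnorm_J_nn zero_in) auto
    qed
    also have "\<dots> = (Ke * \<epsilon> * D) * (norm \<xi> * n0 dz)" by (simp add: t mult_ac)
    finally have Re_le: "Re (S \<xi> (dv, dz) (dv, dz)) \<le> (Ke * \<epsilon> * D) * (norm \<xi> * n0 dz)" .
    let ?y = "norm \<xi> * n0 dz" and ?s = "n0 (dv + dz)" and ?q = "Ke * \<epsilon> * D"
    \<comment> \<open>Writing |\<theta>| as \<epsilon> |\<xi>| puts \<epsilon> into
      \<open>?q\<close> and |\<xi>| into \<open>?y\<close>. The right-hand side is linear in
      \<open>?y\<close>, so the quadratic term first bounds \<open>?y\<close> by q / c0, and then
      \<open>?s\<close> squared is at most q^2 / c0.\<close>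
    have en: "c0 * ?y\<^sup>2 + ?s\<^sup>2 \<le> ?q * ?y"
      using order_trans[OF limit_form_coercive[OF dv(1) dz(1), of \<xi>] Re_le]
      by (simp add: power_mult_distrib mult.assoc)
    have q: "?q \<ge> 0" using Ke_nonneg \<epsilon> D by simp
    have "?y \<le> ?q / c0"
    proof (rule le_if_power2_le_mult)
      have "c0 * ?y\<^sup>2 \<le> ?q * ?y" using en zero_le_power2[of ?s] by linarith
      then show "?y\<^sup>2 \<le> ?q / c0 * ?y" using c0_pos by (simp add: field_simps)
    qed (use q c0_pos in auto)
    then have "?q * ?y \<le> ?q * (?q / c0)" using q by (intro mult_left_mono)
    moreover have "0 \<le> c0 * ?y\<^sup>2" using c0_pos by simp
    ultimately have "?s\<^sup>2 \<le> ?q * (?q / c0)" using en by linarith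
    also have "\<dots> = (?q / sqrt c0)\<^sup>2" using c0_pos by (simp add: power_divide power2_eq_square)
    finally have s: "?s \<le> ?q / sqrt c0"
      by (rule power2_le_imp_le) (use q c0_pos in simp)
    have "n0 dv + n0 dz \<le> 2 * \<kappa> * ?s" using sum_lower[OF dv(1) dz(1)] by simp
    also have "\<dots> \<le> 2 * \<kappa> * (?q / sqrt c0)" using s \<kappa>_pos by (intro mult_left_mono) auto
    finally have "(1 + K) * (n0 dv + n0 dz) \<le> (1 + K) * (2 * \<kappa> * (?q / sqrt c0))"
      using K_pos by (intro mult_left_mono) auto
    then have T2: "fnorm (d \<theta>) (J (E \<theta> dv + dz)) \<le> (1 + K) * (2 * \<kappa> * (?q / sqrt c0))"
      using fnorm_J_nn[OF \<theta>, of "E \<theta> dv + dz"] nn_E_sum(2)[OF \<theta> dv(1), of dz] by linarith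
    have "\<forall>x\<in>Vs. \<forall>y\<in>Z. cmod (d 0 g' (J (x + y))) \<le> D * ((1 + K) * (n0 x + n0 y))"
    proof (intro ballI)
      fix x y assume "x \<in> Vs" "y \<in> Z"
      have "cmod (d 0 g' (J (x + y))) \<le> D * n0 (x + y)"
        using functional_bound[OF zero_in, of g'] D' by simp
      also have "\<dots> \<le> D * ((1 + K) * (n0 x + n0 y))"
      proof (rule mult_left_mono[OF _ D])
        have "0 \<le> K * (n0 x + n0 y)" using K_pos by simp
        then show "n0 (x + y) \<le> (1 + K) * (n0 x + n0 y)"
          using n0_triangle[of x y] by (simp add: distrib_right)
      qed
      finally show "cmod (d 0 g' (J (x + y))) \<le> D * ((1 + K) * (n0 x + n0 y))" .
    qed
    from lim[OF vz'(1,2) D vz'(3) this] have "norm \<xi> * n0 z' \<le> c1 * D" by blast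
    then have tz': "norm \<theta> * n0 z' \<le> \<epsilon> * (c1 * D)" using \<epsilon> by (simp add: t)
    have T3: "fnorm (d \<theta>) (EE \<theta> (J z') - J z') \<le> Ke * (\<epsilon> * (c1 * D))"
    proof (rule order_trans[OF EE_close[OF \<theta>]])
      have "Ke * norm \<theta> * fnorm (d 0) (J z') \<le> Ke * (norm \<theta> * n0 z')"
        unfolding mult.assoc using Ke_nonneg by (intro mult_left_mono fnorm_J_nn zero_in) auto
      also have "\<dots> \<le> Ke * (\<epsilon> * (c1 * D))" using Ke_nonneg tz' by (intro mult_left_mono)
      finally show "Ke * norm \<theta> * fnorm (d 0) (J z') \<le> Ke * (\<epsilon> * (c1 * D))" .
    qed
    have T1: "fnorm (d \<theta>) (J (u - (E \<theta> v + z))) \<le> c2 * \<epsilon> * D"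
      using main[OF \<theta> \<epsilon> D _ _ u vz] f by (intro order_trans[OF fnorm_J[OF \<theta>]]) auto
    \<comment> \<open>The operator difference applies \<open>EE \<theta>\<close> to J z' as well,
      whereas the approximation of the first estimate leaves z as it is; the last bracket corrects
      this.\<close>
    have "J u - EE \<theta> (J (v' + z')) = J (u - (E \<theta> v + z)) + J (E \<theta> dv + dz) - (EE \<theta> (J z') - J z')"
    proof -
      have "EE \<theta> (J (v' + z')) = J (E \<theta> v') + EE \<theta> (J z')"
        using EE_J[OF \<theta> vz'(1)] by (simp add: J_add EE_add[OF \<theta>])
      moreover have "E \<theta> v = E \<theta> v' + E \<theta> dv" unfolding dv(2) by (rule E_add[OF \<theta> vz'(1) dv(1)])
      ultimately show ?thesis by (simp add: J_add J_diff dz(2))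
    qed
    moreover have "op_inverse (L_op a b J d \<epsilon> \<theta>) g = J u"
      by (rule op_inverse_L[OF \<theta> \<epsilon> u])
    moreover have "op_inverse (LL_op a b a' a'' Vs Z J d \<xi>) (orth_proj (d 0) (H0_space Vs Z J) g') =
        J (v' + z')"
      using op_inverse_LL[of "(v', z')" \<xi> g'] vz' by simp
    ultimately have "fnorm (d \<theta>) (op_inverse (L_op a b J d \<epsilon> \<theta>) g -
        EE \<theta> (op_inverse (LL_op a b a' a'' Vs Z J d \<xi>) (orth_proj (d 0) (H0_space Vs Z J) g'))) =
        fnorm (d \<theta>) (J (u - (E \<theta> v + z)) + J (E \<theta> dv + dz) - (EE \<theta> (J z') - J z'))"
      by simp
    also have "\<dots> \<le> c2 * \<epsilon> * D + (1 + K) * (2 * \<kappa> * (?q / sqrt c0)) + Ke * (\<epsilon> * (c1 * D))"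
      using fnorm_triangle_diff[OF nf_d[OF \<theta>], of "J (u - (E \<theta> v + z)) + J (E \<theta> dv + dz)" "EE \<theta> (J z') - J z'"]
        fnorm_triangle[OF nf_d[OF \<theta>], of "J (u - (E \<theta> v + z))" "J (E \<theta> dv + dz)"] T1 T2 T3
      by linarith
    also have "\<dots> = C * \<epsilon> * D" by (simp add: C_def algebra_simps)
    finally show ?thesis by (simp only: D_def g'_def \<xi>_def)
  qed
  then show ?thesis using C by blast
qed

end

text \<open>The infimum need not be attained. Raising Ls to Ls + 1 leaves strict room unless the
  right-hand side vanishes; then \<theta>1 = \<theta>2 or v = 0, and v itself or 0 will do.\<close>

lemma removable_singularity_attained:
  fixes a b :: "real^'n::finite \<Rightarrow> 'h::complex_inner \<Rightarrow> 'h \<Rightarrow> complex"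
  assumes a: "\<And>\<theta>. \<theta> \<in> \<Theta> \<Longrightarrow> nonneg_form (a \<theta>)"
    and ip: "\<And>\<theta>. \<theta> \<in> \<Theta> \<Longrightarrow> equiv_inner_product (ip a b \<theta>)"
    and Vs: "csubspace Vs" and Ls: "0 \<le> Ls"
    and inf: "(INF v2\<in>V_reg a Vs \<theta>2. fnorm (ip a b \<theta>2) (v - v2)) \<le>
      Ls * norm (\<theta>1 - \<theta>2) * fnorm (ip a b \<theta>1) v"
    and \<theta>: "\<theta>1 \<in> \<Theta>" "\<theta>2 \<in> \<Theta>" and v: "v \<in> V_reg a Vs \<theta>1"
  shows "\<exists>v'\<in>V_reg a Vs \<theta>2. fnorm (ip a b \<theta>2) (v - v') \<le>
    (Ls + 1) * norm (\<theta>1 - \<theta>2) * fnorm (ip a b \<theta>1) v"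
proof -
  note nf = equiv_inner_product_nonneg_form[OF ip]
  have zero: "0 \<in> V_reg a Vs \<theta>2"
    using Vs nonneg_form_zero_left[OF a[OF \<theta>(2)]] by (simp add: V_reg_def V_space_def csubspace_def)
  define X where "X = norm (\<theta>1 - \<theta>2) * fnorm (ip a b \<theta>1) v"
  have X: "X \<ge> 0" unfolding X_def using fnorm_nonneg[OF nf[OF \<theta>(1)]] by simp
  consider "\<theta>1 = \<theta>2" | "v = 0" | "X > 0"
    using X equiv_inner_product_fnorm_eq_0[OF ip[OF \<theta>(1)], of v] by (fastforce simp: X_def)
  then show ?thesis
  proof cases
    case 1
    then show ?thesis using v fnorm_zero[OF nf[OF \<theta>(2)]] by (intro bexI[of _ v]) auto
  next
    case 2
    then show ?thesis using zero fnorm_zero[OF nf[OF \<theta>(1)]] fnorm_zero[OF nf[OF \<theta>(2)]]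
      by (intro bexI[of _ 0]) auto
  next
    case 3
    show ?thesis
    proof (rule ccontr)
      assume "\<not> ?thesis"
      then have "(Ls + 1) * X \<le> fnorm (ip a b \<theta>2) (v - v')" if "v' \<in> V_reg a Vs \<theta>2" for v'
        using that by (force simp: X_def mult.assoc)
      then have "(Ls + 1) * X \<le> (INF v2\<in>V_reg a Vs \<theta>2. fnorm (ip a b \<theta>2) (v - v2))"
        using zero by (intro cINF_greatest) auto
      also have "\<dots> \<le> Ls * X" using inf by (simp add: X_def mult.assoc)
      finally show False using 3 by (simp add: distrib_right)
    qed
  qed
qed

theorem theorem6p3:
  fixes \<Theta> :: "(real^'n) set"
    and a b :: "real^'n \<Rightarrow> 'h::complex_hilbert \<Rightarrow> 'h \<Rightarrow> complex"
    and a' :: "'h \<Rightarrow> 'h \<Rightarrow> complex^'n"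
    and a'' :: "'h \<Rightarrow> 'h \<Rightarrow> complex^'n^'n"
    and Vs Z :: "'h set"
    and J :: "'h \<Rightarrow> 'k::complex_hilbert"
    and d :: "real^'n \<Rightarrow> 'k \<Rightarrow> 'k \<Rightarrow> complex"
    and E :: "real^'n \<Rightarrow> 'h \<Rightarrow> 'h"
    and EE :: "real^'n \<Rightarrow> 'k \<Rightarrow> 'k"
    and K KZ \<gamma> Ke :: real
  assumes "separable_space (euclidean :: 'h topology)"
    and "standing_assumptions \<Theta> a b K"
    and "spectral_gap \<Theta> a b"
    and "removable_singularity \<Theta> a b Vs"
    and "defect_complement a b Vs Z KZ"
    and "quadratic_degeneracy \<Theta> a b \<gamma>"
    and "a_regularity \<Theta> a b a' a''"
    and "b_regularity \<Theta> a b"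
    and "ambient_space \<Theta> b J d"
    and "unitary_transfer \<Theta> a b Vs Z J d E EE Ke"
  shows "\<exists>C10\<ge>0.
    (\<forall>\<theta>\<in>\<Theta>. \<forall>\<epsilon>. 0 < \<epsilon> \<and> \<epsilon> < 1 \<longrightarrow>
      (\<forall>f\<in>antidual.
        (\<exists>!u. solves_full a b \<epsilon> \<theta> f u) \<and>
        (\<exists>!p. solves_limit a b a' a'' Vs Z E \<epsilon> \<theta> f p) \<and>
        (\<forall>u v z. solves_full a b \<epsilon> \<theta> f u \<and> solves_limit a b a' a'' Vs Z E \<epsilon> \<theta> f (v, z) \<longrightarrow>
           diag (b \<theta>) (u - (E \<theta> v + z)) \<le> C10 * \<epsilon>\<^sup>2 * (dual_norm (ip a b \<theta>) f)\<^sup>2))) \<and>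
    (\<forall>\<theta>\<in>\<Theta>. \<forall>\<epsilon>. 0 < \<epsilon> \<and> \<epsilon> < 1 \<longrightarrow>
      opnorm (d \<theta>) (d \<theta>)
        (\<lambda>g. op_inverse (L_op a b J d \<epsilon> \<theta>) g -
             EE \<theta> (op_inverse (LL_op a b a' a'' Vs Z J d ((1 / \<epsilon>) *\<^sub>R \<theta>))
                (orth_proj (d 0) (H0_space Vs Z J) (inv (EE \<theta>) g))))
      \<le> ereal ((sqrt C10 + 1 / 2 * Ke / sqrt (\<nu>_star K KZ \<gamma>) *
                  (1 + sqrt ((1 + K\<^sup>2) / (2 * (1 - KZ))))) * \<epsilon>))"
proof -
  note standing = assms(2)[unfolded standing_assumptions_def]
  note defect = assms(5)[unfolded defect_complement_def]
  note a_reg = assms(7)[unfolded a_regularity_def]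
  note ambient = assms(9)[unfolded ambient_space_def]
  note transfer = assms(10)[unfolded unitary_transfer_def]
  have "compact \<Theta>" "0 \<in> interior \<Theta>" "0 < K"
    and forms: "\<forall>\<theta>\<in>\<Theta>. nonneg_form (a \<theta>) \<and> nonneg_form (b \<theta>) \<and> equiv_inner_product (ip a b \<theta>)"
    and compare: "\<forall>\<theta>1\<in>\<Theta>. \<forall>\<theta>2\<in>\<Theta>. \<forall>u. fnorm (ip a b \<theta>1) u \<le> K * fnorm (ip a b \<theta>2) u"
    using standing by - (elim conjE, assumption)+
  obtain La where La: "La > 0" "\<forall>\<theta>1\<in>\<Theta>. \<forall>\<theta>2\<in>\<Theta>. \<forall>u w. cmod (a \<theta>1 u w - a \<theta>2 u w) \<le>
      La * norm (\<theta>1 - \<theta>2) * fnorm (ip a b \<theta>1) u * fnorm (ip a b \<theta>1) w"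
    using standing by (elim conjE exE) (rule that)
  obtain r where r: "r > 0" "cball 0 r \<subseteq> \<Theta>"
    using \<open>0 \<in> interior \<Theta>\<close> unfolding mem_interior_cball by blast
  then have zero: "0 \<in> \<Theta>" by auto
  obtain M where M: "\<And>\<theta>. \<theta> \<in> \<Theta> \<Longrightarrow> norm \<theta> \<le> M"
    using compact_imp_bounded[OF \<open>compact \<Theta>\<close>] unfolding bounded_iff by blast
  obtain \<nu> where \<nu>: "\<nu> > 0" "\<forall>w\<in>W_space a b 0. \<nu> * (fnorm (ip a b 0) w)\<^sup>2 \<le> diag (a 0) w"
    using assms(3) zero unfolding spectral_gap_def by blast
  obtain Ls where Ls: "Ls \<ge> 0" "\<forall>\<theta>1\<in>\<Theta>. \<forall>\<theta>2\<in>\<Theta>. \<forall>v1\<in>V_reg a Vs \<theta>1.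
      (INF v2\<in>V_reg a Vs \<theta>2. fnorm (ip a b \<theta>2) (v1 - v2)) \<le>
        Ls * norm (\<theta>1 - \<theta>2) * fnorm (ip a b \<theta>1) v1"
    and Vs: "csubspace Vs" "closed Vs"
    using assms(4) unfolding removable_singularity_def by (elim conjE exE) (rule that)
  have Z: "csubspace Z" "closed Z" and V0: "V_space a 0 = {v + z | v z. v \<in> Vs \<and> z \<in> Z}"
    and KZ: "0 \<le> KZ" "KZ < 1"
    and angle: "\<forall>v\<in>Vs. \<forall>z\<in>Z. cmod (ip a b 0 v z) \<le> KZ * fnorm (ip a b 0) v * fnorm (ip a b 0) z"
    using defect by - (elim conjE, assumption)+
  have "\<gamma> > 0" and degeneracy: "\<forall>\<theta>\<in>\<Theta>. \<forall>w\<in>W_space a b \<theta>.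
      \<gamma> * (norm \<theta>)\<^sup>2 * (fnorm (ip a b \<theta>) w)\<^sup>2 \<le> diag (a \<theta>) w"
    using assms(6) unfolding quadratic_degeneracy_def by - (elim conjE, assumption)+
  have a': "\<forall>i. sesquilinear_on (V_space a 0) UNIV (\<lambda>v u. a' v u $ i)"
    and a'': "\<forall>i j. sesquilinear_on (V_space a 0) (V_space a 0) (\<lambda>v w. a'' v w $ i $ j)"
    using a_reg by - (elim conjE, assumption)+
  obtain K1 where K1: "K1 \<ge> 0" "\<forall>v\<in>V_space a 0. \<forall>u. \<forall>\<theta>\<in>\<Theta>. cmod (a \<theta> v u - cdot (a' v u) \<theta>) \<le>
      K1 * (norm \<theta>)\<^sup>2 * fnorm (ip a b 0) v * fnorm (ip a b 0) u"
    using a_reg by (elim conjE exE) (rule that)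
  obtain K2 where K2: "K2 \<ge> 0" "\<forall>v\<in>V_space a 0. \<forall>w\<in>V_space a 0. \<forall>\<theta>\<in>\<Theta>.
      cmod (a \<theta> v w - cquad (a'' v w) \<theta>) \<le> K2 * norm \<theta> ^ 3 * fnorm (ip a b 0) v * fnorm (ip a b 0) w"
    using a_reg by (elim conjE exE) (rule that)
  obtain Lb where Lb: "Lb \<ge> 0" "\<forall>v\<in>V_space a 0. \<forall>w\<in>V_space a 0. \<forall>\<theta>\<in>\<Theta>.
      cmod (b \<theta> v w - b 0 v w) \<le> Lb * norm \<theta> * fnorm (ip a b 0) v * fnorm (ip a b \<theta>) w"
    using assms(8) unfolding b_regularity_def by (elim conjE exE) (rule that)
  have J: "clinear_on UNIV J"
    and d: "\<forall>\<theta>\<in>\<Theta>. equiv_inner_product (d \<theta>)" "\<forall>\<theta>\<in>\<Theta>. \<forall>u. diag (d \<theta>) (J u) \<le> diag (b \<theta>) u"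
    using ambient by - (elim conjE, assumption)+
  have E: "\<forall>\<theta>\<in>\<Theta>. clinear_on Vs (E \<theta>) \<and> bij_betw (E \<theta>) Vs (V_reg a Vs \<theta>) \<and>
        (\<forall>v\<in>Vs. \<forall>w\<in>Vs. b \<theta> (E \<theta> v) (E \<theta> w) = b 0 v w)"
    and EE: "\<forall>\<theta>\<in>\<Theta>. bij (EE \<theta>) \<and> (\<forall>v\<in>Vs. EE \<theta> (J v) = J (E \<theta> v)) \<and>
        (\<forall>u w. d \<theta> (EE \<theta> u) (EE \<theta> w) = d 0 u w)" "EE 0 = id" "Ke \<ge> 0"
      "\<forall>\<theta>1\<in>\<Theta>. \<forall>\<theta>2\<in>\<Theta>.
        opnorm (d 0) (d \<theta>1) (\<lambda>u. EE \<theta>1 u - EE \<theta>2 u) \<le> ereal (Ke * norm (\<theta>1 - \<theta>2))"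
    using transfer by - (elim conjE, assumption)+
  obtain Kb where Kb: "Kb \<ge> 0" "\<forall>\<theta>\<in>\<Theta>. \<forall>v\<in>Vs. \<forall>z\<in>Z. cmod (b \<theta> (E \<theta> v) z - b 0 v z) \<le>
      Kb * norm \<theta> * fnorm (ip a b 0) v * fnorm (ip a b 0) z"
    using transfer by (elim conjE exE) (rule that)
  have removable: "\<exists>v'\<in>V_reg a Vs \<theta>2. fnorm (ip a b \<theta>2) (v - v') \<le>
        (Ls + 1) * norm (\<theta>1 - \<theta>2) * fnorm (ip a b \<theta>1) v"
    if "\<theta>1 \<in> \<Theta>" "\<theta>2 \<in> \<Theta>" "v \<in> V_reg a Vs \<theta>1" for \<theta>1 \<theta>2 v
    using forms Vs(1) Ls(1) Ls(2) that by (intro removable_singularity_attained[of \<Theta>]) auto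
  have "Ls + 1 \<ge> 0" using Ls(1) by simp
  interpret ambient_family \<Theta> a b a' a'' Vs Z K KZ \<gamma> r M La \<nu> "Ls + 1" K1 K2 Lb E Kb J d EE Ke
    by unfold_locales
      (rule r(2) r(1) M forms[rule_format, THEN conjunct1] forms[rule_format, THEN conjunct2, THEN conjunct1]
        forms[rule_format, THEN conjunct2, THEN conjunct2] \<open>0 < K\<close> compare[rule_format]
        La(1) La(2)[rule_format] \<nu>(1) \<nu>(2)[rule_format] Vs \<open>Ls + 1 \<ge> 0\<close> removable Z V0 KZ
        angle[rule_format] \<open>\<gamma> > 0\<close> degeneracy[rule_format] a'[rule_format] a''[rule_format]
        K1(1) K1(2)[rule_format] K2(1) K2(2)[rule_format] Lb(1) Lb(2)[rule_format]
        E[rule_format, THEN conjunct1] E[rule_format, THEN conjunct2, THEN conjunct1]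
        E[rule_format, THEN conjunct2, THEN conjunct2, rule_format] Kb(1) Kb(2)[rule_format]
        J d[rule_format] EE(1)[rule_format, THEN conjunct1]
        EE(1)[rule_format, THEN conjunct2, THEN conjunct1, rule_format]
        EE(1)[rule_format, THEN conjunct2, THEN conjunct2, rule_format] EE(2,3) EE(4)[rule_format];
        assumption)+
  obtain c1 where c1: "c1 \<ge> 0" and main: "\<And>\<theta> \<epsilon> f D u v z. \<lbrakk>\<theta> \<in> \<Theta>; 0 < \<epsilon>; \<epsilon> < 1; 0 \<le> D;
      \<forall>w. cmod (f w) \<le> D * nn \<theta> w; \<forall>u w. f (u + w) = f u + f w;
      solves_full a b \<epsilon> \<theta> f u; solves_limit a b a' a'' Vs Z E \<epsilon> \<theta> f (v, z)\<rbrakk> \<Longrightarrow>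
      fnorm (b \<theta>) (u - (E \<theta> v + z)) \<le> c1 * \<epsilon> * D"
    using main_estimate by blast
  obtain c2 where c2: "c2 \<ge> 0" and oper: "\<And>\<theta> \<epsilon> g. \<lbrakk>\<theta> \<in> \<Theta>; 0 < \<epsilon>; \<epsilon> < 1\<rbrakk> \<Longrightarrow>
      fnorm (d \<theta>) (op_inverse (L_op a b J d \<epsilon> \<theta>) g -
      EE \<theta> (op_inverse (LL_op a b a' a'' Vs Z J d ((1 / \<epsilon>) *\<^sub>R \<theta>))
        (orth_proj (d 0) (H0_space Vs Z J) (inv (EE \<theta>) g)))) \<le> c2 * \<epsilon> * fnorm (d \<theta>) g"
    using operator_estimate by blast
  text \<open>Part (ii) only asks for some \<open>C\<^sub>1\<^sub>0\<close>, so it may absorb all constants of the operator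
    estimate; the explicit second summand of \<open>C\<^sub>1\<^sub>1\<close> is then merely non-negative.\<close>
  define C10 where "C10 = (max c1 c2)\<^sup>2"
  define R where "R = 1 / 2 * Ke / sqrt (\<nu>_star K KZ \<gamma>) * (1 + sqrt ((1 + K\<^sup>2) / (2 * (1 - KZ))))"
  have R: "R \<ge> 0"
    using Ke_nonneg KZ \<gamma>_pos by (simp add: R_def \<nu>_star_def)
  have sqrt_C10: "sqrt C10 = max c1 c2" using c1 by (simp add: C10_def)
  show ?thesis
  proof (intro exI[of _ C10] conjI ballI allI impI)
    show "0 \<le> C10" by (simp add: C10_def)
    fix \<theta> \<epsilon> assume \<theta>: "\<theta> \<in> \<Theta>" and \<epsilon>: "0 < \<epsilon> \<and> (\<epsilon> :: real) < 1"
    {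
      fix f :: "'h \<Rightarrow> complex" assume f: "f \<in> antidual"
      \<comment> \<open>The estimates hold for every \<open>D\<close> that bounds \<open>f\<close>
        relative to \<open>nn \<theta>\<close>; in this part \<open>D\<close> is the dual norm,
        whereas the operator estimate took the d_\<theta>-norm of g.\<close>
      note f_bound = dual_norm_bound[OF f ip[OF \<theta>]]
      have f_add: "\<And>u w. f (u + w) = f u + f w" and f_scale: "\<And>c u. f (c *\<^sub>C u) = cnj c * f u"
        using f by (auto simp: antidual_def)
      show "\<exists>!u. solves_full a b \<epsilon> \<theta> f u"
        using \<epsilon> f by (intro full_problem_solvable \<theta>) auto
      show "\<exists>!p. solves_limit a b a' a'' Vs Z E \<epsilon> \<theta> f p"
        by (rule limit_problem_solvable_E[OF \<theta> f_bound(2,1) f_add f_scale])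
      fix u v z
      assume uvz: "solves_full a b \<epsilon> \<theta> f u \<and> solves_limit a b a' a'' Vs Z E \<epsilon> \<theta> f (v, z)"
      let ?D = "dual_norm (ip a b \<theta>) f"
      have "fnorm (b \<theta>) (u - (E \<theta> v + z)) \<le> c1 * \<epsilon> * ?D"
        using main[OF \<theta> _ _ f_bound(2)] \<epsilon> f_bound(1) f_add uvz by blast
      also have "\<dots> \<le> max c1 c2 * \<epsilon> * ?D"
        using \<epsilon> f_bound(2) by (intro mult_right_mono) auto
      finally have "(fnorm (b \<theta>) (u - (E \<theta> v + z)))\<^sup>2 \<le> (max c1 c2 * \<epsilon> * ?D)\<^sup>2"
        by (intro power_mono fnorm_nonneg nf_b \<theta>)
      then show "diag (b \<theta>) (u - (E \<theta> v + z)) \<le> C10 * \<epsilon>\<^sup>2 * ?D\<^sup>2"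
        by (simp only: fnorm_square[OF nf_b[OF \<theta>]] C10_def power_mult_distrib)
    next
      show "opnorm (d \<theta>) (d \<theta>)
        (\<lambda>g. op_inverse (L_op a b J d \<epsilon> \<theta>) g -
             EE \<theta> (op_inverse (LL_op a b a' a'' Vs Z J d ((1 / \<epsilon>) *\<^sub>R \<theta>))
                (orth_proj (d 0) (H0_space Vs Z J) (inv (EE \<theta>) g))))
        \<le> ereal ((sqrt C10 + 1 / 2 * Ke / sqrt (\<nu>_star K KZ \<gamma>) *
                  (1 + sqrt ((1 + K\<^sup>2) / (2 * (1 - KZ))))) * \<epsilon>)"
        unfolding R_def[symmetric] sqrt_C10
      proof (rule opnorm_leI[OF d_ip[OF \<theta>]])
        show "0 \<le> (max c1 c2 + R) * \<epsilon>" using c1 R \<epsilon> by simp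
        fix g
        have "c2 * \<epsilon> * fnorm (d \<theta>) g \<le> (max c1 c2 + R) * \<epsilon> * fnorm (d \<theta>) g"
          using R \<epsilon> fnorm_nonneg[OF nf_d[OF \<theta>]] by (intro mult_right_mono) auto
        then show "fnorm (d \<theta>) (op_inverse (L_op a b J d \<epsilon> \<theta>) g -
            EE \<theta> (op_inverse (LL_op a b a' a'' Vs Z J d ((1 / \<epsilon>) *\<^sub>R \<theta>))
            (orth_proj (d 0) (H0_space Vs Z J) (inv (EE \<theta>) g)))) \<le> (max c1 c2 + R) * \<epsilon> * fnorm (d \<theta>) g"
          using oper[OF \<theta>, of \<epsilon> g] \<epsilon> by linarith
      qed
    }
  qed
qed

end
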